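(* Let $k=1$. Suppose that $D\subset\mathbb{R}$ is a non-degenerate interval with $\underline d:=\inf D$ and $\overline d:=\sup D$, let $g\in B_b(S,D)$ be consistent, and let there be two $\mu$-dominated $a,b\in B([0,T]\times S,\mathbb{R})$ such that $f(t,x,w)=a(t,x)+b(t,x)w$ for all $(t,x,w)\in[0,T]\times S\times D$. Additionally, for $\underline d>-\infty$ (resp. $\overline d<\infty$) let $a(\cdot,x)+b(\cdot,x)\underline d\le0$ (resp. $a(\cdot,x)+b(\cdot,x)\overline d\ge0$) for all $x\in S$ $\mu$-a.s. Then the unique global bounded solution $\overline u_g$ to (M) satisfies $$\overline u_g(r,x)=E_{r,x}\bigg[e^{-\int_r^Tb(s,X_s)\,\mu(ds)}g(X_T)\bigg]-E_{r,x}\bigg[\int_r^Te^{-\int_r^tb(s,X_s)\,\mu(ds)}a(t,X_t)\,\mu(dt)\bigg]$$ for every $(r,x)\in[0,T]\times S$. Furthermore, whenever $\mathcal{X}$ is Feller (respectively right-hand Feller), $a(s,\cdot)$ and $b(s,\cdot)$ are continuous for $\mu$-a.e. $s\in[0,T]$, and $g$ is continuous, then $\overline u_g$ is continuous (respectively right-continuous).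
   Context: **Spaces.** $S$ is a separable metrizable topological space, $T>0$, $\mu$ is an atomless Borel measure on $[0,T]$. $[0,T]\times S$ carries a pseudometric $d_S$ whose topology is coarser than or equal to the product topology; $\mathcal{B}(I\times S)$, Borel measurability and continuity on $I\times S$ ($I\subset[0,T]$ an interval) refer to $d_S$. A map $u:I\times S\to\mathbb{R}$ is consistent if $u(r,x)=u(s,y)$ whenever $d_S((r,x),(s,y))=0$, and right-continuous if for all $(r,x)\in I\times S$ and $\varepsilon>0$ there is $\delta>0$ with $|u(s,y)-u(r,x)|<\varepsilon$ for all $(s,y)\in I\times S$ with $s\ge r$ and $d_S((s,y),(r,x))<\delta$. A map $g$ on $S$ is consistent if $g(x)=g(y)$ whenever $d_S((T,x),(T,y))=0$. $B(S,D)$, $B(I\times S,D)$ are the sets of $D$-valued Borel measurable maps; $B_b$ denotes the bounded ones. **Markov process.** $\mathcal{X}=(X,(\mathcal{F}_t)_{t\in[0,T]},\mathbb{P})$ is a fixed consistent progressive Markov process on a measurable space $(\Omega,\mathcal{F})$ with state space $S$ and Borel measurable transition probabilities: $X:[0,T]\times\Omega\to S$ is a process adapted to the filtration $(\mathcal{F}_t)$, $\mathbb{P}=\{P_{r,x}\mid(r,x)\in[0,T]\times S\}$ is a set of probability measures on $(\Omega,\mathcal{F})$ (expectations $E_{r,x}$), and: (1) for each $(s,y)$, $P_{s,y}$-a.s. $d_S((r,X_r),(r,y))=0$ for all $r\in[0,s]$; (2) $[0,t]\times S\to[0,1]$, $(s,x)\mapsto P_{s,x}(X_t\in B)$ is consistent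 and Borel measurable for all $t\in[0,T]$, $B\in\mathcal{B}(S)$; (3) $P_{r,x}(X_t\in B\mid\mathcal{F}_s)=P_{s,X_s}(X_t\in B)$ $P_{r,x}$-a.s. for all $r\le s\le t$, $x\in S$, $B\in\mathcal{B}(S)$; (4) $X$ is progressively measurable with respect to its natural filtration and its natural backward filtration. $\mathcal{X}$ is Feller (resp. right-hand Feller) if $[0,t]\times S\to\mathbb{R}$, $(r,x)\mapsto E_{r,x}[\varphi(X_t)]$ is continuous (resp. right-continuous) for all $t\in[0,T]$ and all bounded continuous $\varphi:S\to\mathbb{R}$. **Domination.** A property of $(s,y)$ holds "for all $y\in S$ $\mu$-a.s." if there is a $\mu$-null set outside of which in $s$ it holds for all $y\in S$. $a\in B([0,T]\times S,\mathbb{R})$ is $\mu$-dominated if there is a $\mu$-integrable $\overline a\in B([0,T],\mathbb{R}_+)$ with $|a(\cdot,y)|\le\overline a$ for all $y\in S$ $\mu$-a.s. **Problem (M).** A global solution to (M) (with data $f,g$) is a consistent $u\in B([0,T]\times S,D)$ such that for all $r\le t$ in $[0,T]$ and $x\in S$, $|u(t,X_t)|$ and $\int_r^t|f(s,X_s,u(s,X_s))|\,\mu(ds)$ are finite and $P_{r,x}$-integrable, $E_{r,x}[u(t,X_t)]=u(r,x)+E_{r,x}[\int_r^tf(s,X_s,u(s,X_s))\,\mu(ds)]$, and $u(T,x)=g(x)$. Under the hypotheses of the claim there is a unique global bounded solution, denoted $\overline u_g$.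
   Formalization: Existence of the bounded solution and its (right-)continuity are proved assuming also that (r,x) ↦ r is continuous for d_S; without this a solution may not exist or may be discontinuous. The formula and uniqueness need no such assumption. *)

theory Defs
  imports "HOL-Probability.Probability"
begin

text \<open>The state space is a type \<open>'s\<close>; space-time points are pairs in \<open>real \<times> 's\<close> whose
  time component is always restricted to a subset of \<open>{0..T}\<close>.\<close>

section \<open>Pseudometrics, their topologies and Borel sets\<close>

definition pseudometric_on :: "'a set \<Rightarrow> ('a \<Rightarrow> 'a \<Rightarrow> real) \<Rightarrow> bool" where
  "pseudometric_on A d \<longleftrightarrow>
     (\<forall>p\<in>A. d p p = 0) \<and> (\<forall>p\<in>A. \<forall>q\<in>A. 0 \<le> d p q \<and> d p q = d q p) \<and>
     (\<forall>p\<in>A. \<forall>q\<in>A. \<forall>z\<in>A. d p z \<le> d p q + d q z)"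

definition pm_topology :: "('a \<Rightarrow> 'a \<Rightarrow> real) \<Rightarrow> 'a set \<Rightarrow> 'a topology" where
  "pm_topology d A =
     topology (\<lambda>U. U \<subseteq> A \<and> (\<forall>p\<in>U. \<exists>\<epsilon>>0. \<forall>q\<in>A. d p q < \<epsilon> \<longrightarrow> q \<in> U))"

lemma openin_pm_topology:
  "openin (pm_topology d A) U \<longleftrightarrow>
     U \<subseteq> A \<and> (\<forall>p\<in>U. \<exists>\<epsilon>>0. \<forall>q\<in>A. d p q < \<epsilon> \<longrightarrow> q \<in> U)"
proof -
  let ?P = "\<lambda>U. U \<subseteq> A \<and> (\<forall>p\<in>U. \<exists>\<epsilon>>0. \<forall>q\<in>A. d p q < \<epsilon> \<longrightarrow> q \<in> U)"
  have "?P (U \<inter> V)" if U: "?P U" and V: "?P V" for U V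
  proof (intro conjI ballI)
    show "U \<inter> V \<subseteq> A" using U by blast
    fix p assume p: "p \<in> U \<inter> V"
    obtain e1 where e1: "e1 > 0" "\<forall>q\<in>A. d p q < e1 \<longrightarrow> q \<in> U" using U p by blast
    obtain e2 where e2: "e2 > 0" "\<forall>q\<in>A. d p q < e2 \<longrightarrow> q \<in> V" using V p by blast
    show "\<exists>\<epsilon>>0. \<forall>q\<in>A. d p q < \<epsilon> \<longrightarrow> q \<in> U \<inter> V"
      by (rule exI[of _ "min e1 e2"]) (use e1 e2 in auto)
  qed
  moreover have "?P (\<Union>K)" if "\<forall>U\<in>K. ?P U" for K
    using that by (meson Union_iff Union_least)
  ultimately have "istopology ?P"
    unfolding istopology_def by blast
  then show ?thesis
    unfolding pm_topology_def by (simp add: topology_inverse')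
qed

lemma topspace_pm_topology: "topspace (pm_topology d A) = A"
proof -
  have "openin (pm_topology d A) A"
    unfolding openin_pm_topology by (auto intro: exI[of _ 1])
  then show ?thesis
    by (metis openin_pm_topology openin_subset openin_topspace subset_antisym)
qed

definition borel_of :: "'a topology \<Rightarrow> 'a measure" where
  "borel_of \<tau> = sigma (topspace \<tau>) {U. openin \<tau> U}"

abbreviation spacetime_borel :: "(real \<times> 's \<Rightarrow> real \<times> 's \<Rightarrow> real) \<Rightarrow> real set \<Rightarrow> (real \<times> 's) measure" where
  "spacetime_borel d I \<equiv> borel_of (pm_topology d (I \<times> UNIV))"

definition consistent_on :: "'a set \<Rightarrow> ('a \<Rightarrow> 'a \<Rightarrow> real) \<Rightarrow> ('a \<Rightarrow> real) \<Rightarrow> bool" where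
  "consistent_on A d u \<longleftrightarrow> (\<forall>p\<in>A. \<forall>q\<in>A. d p q = 0 \<longrightarrow> u p = u q)"

definition continuous_spacetime ::
    "(real \<times> 's \<Rightarrow> real \<times> 's \<Rightarrow> real) \<Rightarrow> real set \<Rightarrow> (real \<times> 's \<Rightarrow> real) \<Rightarrow> bool" where
  "continuous_spacetime d I u \<longleftrightarrow> continuous_map (pm_topology d (I \<times> UNIV)) euclideanreal u"

definition right_continuous_spacetime ::
    "(real \<times> 's \<Rightarrow> real \<times> 's \<Rightarrow> real) \<Rightarrow> real set \<Rightarrow> (real \<times> 's \<Rightarrow> real) \<Rightarrow> bool" where
  "right_continuous_spacetime d I u \<longleftrightarrow>
     (\<forall>r\<in>I. \<forall>x. \<forall>\<epsilon>>0. \<exists>\<delta>>0. \<forall>s\<in>I. \<forall>y.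
        s \<ge> r \<and> d (s, y) (r, x) < \<delta> \<longrightarrow> \<bar>u (s, y) - u (r, x)\<bar> < \<epsilon>)"

section \<open>Atomless measures\<close>

text \<open>An atom is an atom of the measure algebra. For a \<open>\<sigma>\<close>-finite measure this is the same as
  requiring that each measurable subset has measure zero or full measure; for an arbitrary Borel
  measure on an interval, having no atoms in this sense means that all singletons are null.\<close>

definition is_atom :: "'a measure \<Rightarrow> 'a set \<Rightarrow> bool" where
  "is_atom M A \<longleftrightarrow> A \<in> sets M \<and> emeasure M A > 0 \<and>
     (\<forall>B\<in>sets M. B \<subseteq> A \<longrightarrow> emeasure M B = 0 \<or> emeasure M (A - B) = 0)"

definition atomless :: "'a measure \<Rightarrow> bool" where
  "atomless M \<longleftrightarrow> (\<nexists>A. is_atom M A)"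

section \<open>Consistent progressive Markov processes\<close>

locale spacetime_setting =
  fixes T :: real and d :: "real \<times> 's::topological_space \<Rightarrow> real \<times> 's \<Rightarrow> real" and \<mu> :: "real measure"
  assumes metrizable_state: "metrizable_space (euclidean :: 's topology)"
    and separable_state: "separable_space (euclidean :: 's topology)"
    and T_pos: "T > 0"
    and sets_mu: "sets \<mu> = sets (restrict_space borel {0..T})"
    and atomless_mu: "atomless \<mu>"
    and pseudometric: "pseudometric_on ({0..T} \<times> UNIV) d"
    and coarser: "\<And>U. openin (pm_topology d ({0..T} \<times> UNIV)) U \<Longrightarrow>
      openin (prod_topology (top_of_set {0..T}) euclidean) U"

definition sigma_process :: "'w set \<Rightarrow> (real \<Rightarrow> 'w \<Rightarrow> 's::topological_space) \<Rightarrow> real set \<Rightarrow> 'w measure" where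
  "sigma_process \<Omega> X I = sigma \<Omega> {X q -` B \<inter> \<Omega> | q B. q \<in> I \<and> B \<in> sets borel}"

text \<open>\<open>M\<close> only serves as the measurable space \<open>(\<Omega>, \<F>)\<close>; its measure is irrelevant.
  \<open>P (r, x)\<close> is the law with starting time \<open>r\<close> and starting point \<open>x\<close>.\<close>

locale progressive_markov = spacetime_setting T d \<mu>
  for T :: real and d :: "real \<times> 's::topological_space \<Rightarrow> real \<times> 's \<Rightarrow> real" and \<mu> :: "real measure" +
  fixes M :: "'w measure" and F :: "real \<Rightarrow> 'w measure" and X :: "real \<Rightarrow> 'w \<Rightarrow> 's"
    and P :: "real \<times> 's \<Rightarrow> 'w measure"
  assumes subalg: "\<And>t. t \<in> {0..T} \<Longrightarrow> subalgebra M (F t)"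
    and filtration_mono: "\<And>s t. 0 \<le> s \<Longrightarrow> s \<le> t \<Longrightarrow> t \<le> T \<Longrightarrow> sets (F s) \<subseteq> sets (F t)"
    and adapted: "\<And>t. t \<in> {0..T} \<Longrightarrow> X t \<in> measurable (F t) borel"
    and prob: "\<And>r x. r \<in> {0..T} \<Longrightarrow> prob_space (P (r, x)) \<and> sets (P (r, x)) = sets M"
    and start: "\<And>s y. s \<in> {0..T} \<Longrightarrow> AE \<omega> in P (s, y). \<forall>r\<in>{0..s}. d (r, X r \<omega>) (r, y) = 0"
    and transition: "\<And>t B. t \<in> {0..T} \<Longrightarrow> B \<in> sets borel \<Longrightarrow>
      consistent_on ({0..t} \<times> UNIV) d (\<lambda>p. measure (P p) {\<omega> \<in> space M. X t \<omega> \<in> B}) \<and>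
      (\<lambda>p. measure (P p) {\<omega> \<in> space M. X t \<omega> \<in> B}) \<in> borel_measurable (spacetime_borel d {0..t})"
    and markov: "\<And>r s t x B. 0 \<le> r \<Longrightarrow> r \<le> s \<Longrightarrow> s \<le> t \<Longrightarrow> t \<le> T \<Longrightarrow> B \<in> sets borel \<Longrightarrow>
      AE \<omega> in P (r, x).
        real_cond_exp (P (r, x)) (F s) (indicator {\<omega>' \<in> space M. X t \<omega>' \<in> B}) \<omega> =
        measure (P (s, X s \<omega>)) {\<omega>' \<in> space M. X t \<omega>' \<in> B}"
    and progressive: "\<And>t. t \<in> {0..T} \<Longrightarrow>
      (\<lambda>(s, \<omega>). X s \<omega>) \<in> measurable
        (restrict_space borel {0..t} \<Otimes>\<^sub>M sigma_process (space M) X {0..t}) borel"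
    and progressive_backward: "\<And>t. t \<in> {0..T} \<Longrightarrow>
      (\<lambda>(s, \<omega>). X s \<omega>) \<in> measurable
        (restrict_space borel {t..T} \<Otimes>\<^sub>M sigma_process (space M) X {t..T}) borel"

definition feller :: "real \<Rightarrow> (real \<times> 's::topological_space \<Rightarrow> real \<times> 's \<Rightarrow> real) \<Rightarrow>
    (real \<Rightarrow> 'w \<Rightarrow> 's) \<Rightarrow> (real \<times> 's \<Rightarrow> 'w measure) \<Rightarrow> bool" where
  "feller T d X P \<longleftrightarrow>
     (\<forall>t\<in>{0..T}. \<forall>\<phi> :: 's \<Rightarrow> real. continuous_on UNIV \<phi> \<and> bounded (range \<phi>) \<longrightarrow>
        continuous_spacetime d {0..t} (\<lambda>p. LINT \<omega>|P p. \<phi> (X t \<omega>)))"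

definition right_hand_feller :: "real \<Rightarrow> (real \<times> 's::topological_space \<Rightarrow> real \<times> 's \<Rightarrow> real) \<Rightarrow>
    (real \<Rightarrow> 'w \<Rightarrow> 's) \<Rightarrow> (real \<times> 's \<Rightarrow> 'w measure) \<Rightarrow> bool" where
  "right_hand_feller T d X P \<longleftrightarrow>
     (\<forall>t\<in>{0..T}. \<forall>\<phi> :: 's \<Rightarrow> real. continuous_on UNIV \<phi> \<and> bounded (range \<phi>) \<longrightarrow>
        right_continuous_spacetime d {0..t} (\<lambda>p. LINT \<omega>|P p. \<phi> (X t \<omega>)))"

section \<open>The Markovian terminal value problem (M)\<close>

definition dominated :: "real \<Rightarrow> real measure \<Rightarrow> (real \<times> 's \<Rightarrow> real) \<Rightarrow> bool" where
  "dominated T \<mu> a \<longleftrightarrow>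
     (\<exists>a' :: real \<Rightarrow> real. integrable \<mu> a' \<and> (\<forall>s\<in>{0..T}. 0 \<le> a' s) \<and>
        (AE s in \<mu>. \<forall>y. \<bar>a (s, y)\<bar> \<le> a' s))"

text \<open>\<open>set_integrable\<close> expresses that \<open>\<integral>\<^sub>r\<^sup>t \<bar>f(s, X\<^sub>s, u(s, X\<^sub>s))\<bar> \<mu>(ds)\<close> is finite. The values of
  \<open>f\<close> outside \<open>{0..T} \<times> S \<times> D\<close> play no role.\<close>

definition global_solution :: "real \<Rightarrow> (real \<times> 's::topological_space \<Rightarrow> real \<times> 's \<Rightarrow> real) \<Rightarrow>
    real measure \<Rightarrow> 'w measure \<Rightarrow> (real \<Rightarrow> 'w \<Rightarrow> 's) \<Rightarrow> (real \<times> 's \<Rightarrow> 'w measure) \<Rightarrow> real set \<Rightarrow>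
    (real \<Rightarrow> 's \<Rightarrow> real \<Rightarrow> real) \<Rightarrow> ('s \<Rightarrow> real) \<Rightarrow> (real \<times> 's \<Rightarrow> real) \<Rightarrow> bool" where
  "global_solution T d \<mu> M X P D f g u \<longleftrightarrow>
     u \<in> borel_measurable (spacetime_borel d {0..T}) \<and>
     u ` ({0..T} \<times> UNIV) \<subseteq> D \<and>
     consistent_on ({0..T} \<times> UNIV) d u \<and>
     (\<forall>r t x. 0 \<le> r \<and> r \<le> t \<and> t \<le> T \<longrightarrow>
        integrable (P (r, x)) (\<lambda>\<omega>. \<bar>u (t, X t \<omega>)\<bar>) \<and>
        (\<forall>\<omega>\<in>space M. set_integrable \<mu> {r..t} (\<lambda>s. f s (X s \<omega>) (u (s, X s \<omega>)))) \<and>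
        integrable (P (r, x)) (\<lambda>\<omega>. LINT s:{r..t}|\<mu>. \<bar>f s (X s \<omega>) (u (s, X s \<omega>))\<bar>) \<and>
        (LINT \<omega>|P (r, x). u (t, X t \<omega>)) =
          u (r, x) + (LINT \<omega>|P (r, x). (LINT s:{r..t}|\<mu>. f s (X s \<omega>) (u (s, X s \<omega>))))) \<and>
     (\<forall>x. u (T, x) = g x)"

definition bounded_global_solution :: "real \<Rightarrow> (real \<times> 's::topological_space \<Rightarrow> real \<times> 's \<Rightarrow> real) \<Rightarrow>
    real measure \<Rightarrow> 'w measure \<Rightarrow> (real \<Rightarrow> 'w \<Rightarrow> 's) \<Rightarrow> (real \<times> 's \<Rightarrow> 'w measure) \<Rightarrow> real set \<Rightarrow>
    (real \<Rightarrow> 's \<Rightarrow> real \<Rightarrow> real) \<Rightarrow> ('s \<Rightarrow> real) \<Rightarrow> (real \<times> 's \<Rightarrow> real) \<Rightarrow> bool" where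
  "bounded_global_solution T d \<mu> M X P D f g u \<longleftrightarrow>
     global_solution T d \<mu> M X P D f g u \<and> bounded (u ` ({0..T} \<times> UNIV))"

text \<open>The time coordinate depends continuously on the space-time point, i.e. convergence in the
  pseudometric forces convergence in time, as is the case for product metrics and for
  \<open>d((r, x), (s, y)) = \<bar>r - s\<bar> + \<rho>(x\<^sup>r, y\<^sup>s)\<close> on path spaces. Without this, solutions need neither
  exist (take \<open>S\<close> a singleton, \<open>\<mu> \<noteq> 0\<close> finite, \<open>d = 0\<close>, \<open>a = 1\<close>, \<open>b = 0\<close>: consistent maps are constant) nor be continuous when they
  do: on \<open>[0, 1]\<close> with \<open>S = \<nat>\<close> (discrete) and Lebesgue measure, let the process under \<open>P (r, x)\<close> be
  equal to \<open>x\<close> before time \<open>1/2\<close> and to \<open>0\<close> from then on, and let \<open>d\<close> be induced by the map into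
  \<open>\<ell>\<^sup>2\<close> sending \<open>(r, n)\<close> to \<open>(1 - r) e + (2 - 4 r) / (n + 1) e\<^sub>n\<close> for \<open>r < 1/2\<close> and to \<open>r e\<close> for
  \<open>r \<ge> 1/2\<close> (with \<open>e\<close>, \<open>e\<^sub>0\<close>, \<open>e\<^sub>1\<close>, ... orthonormal). For \<open>a\<close> the indicator of \<open>{r < 1/2}\<close>, \<open>b = 0\<close> and
  \<open>g = 0\<close> all other hypotheses and the Feller property hold, \<open>u (r, n) = - max 0 (1/2 - r)\<close>, and
  \<open>(1/4, n)\<close> converges to \<open>(3/4, 0)\<close> while \<open>u (1/4, n) = -1/4\<close> and \<open>u (3/4, 0) = 0\<close>.\<close>

definition time_continuous :: "real \<Rightarrow> (real \<times> 's \<Rightarrow> real \<times> 's \<Rightarrow> real) \<Rightarrow> bool" where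
  "time_continuous T d \<longleftrightarrow> continuous_spacetime d {0..T} fst"

end

(* Along a path put V r = e^(- int_r^T b) g(X_T) - int_r^T e^(- int_r^t b) a(t, X_t) mu(dt). It depends
   only on the future of r and solves V t = V r + int_r^t (a + b V). Under E_{r,x} the Markov property
   replaces b(s, X_s) V s by b(s, X_s) E_{s,X_s}[V s], so (r, x) |-> E_{r,x}[V r] solves (M).

   Conversely, for a bounded solution u the process W s = g(X_T) - int_s^T (a + b u) has conditional
   expectation u(s, X_s). Integration by parts of e^(- int_r^s b) W s on [r, T], followed by the Markov
   property, leaves exactly u(r, x) = E_{r,x}[V r]; this also gives uniqueness.

   For the continuity, u is the fixed point of v |-> E g(X_T) - int_r^T E (a + b v), a contraction in a
   weighted supremum norm. The (right-hand) Feller property and dominated convergence make its iterates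
   (right-)continuous. *)

theory Submission
  imports Defs
begin

section \<open>Bounded measurable functions\<close>

text \<open>The argument therefore runs for a finite diffuse measure \<nu> and bounded coefficients,
  where functions in \<open>bmeas\<close> are integrable and stable under sums, products,
  exponentials and partial integrals. The assumptions on the process concern a single later time,
  while \<open>V r\<close> depends on the whole path after r: the Markov identity is tested against
  bounded functions of the past and passes to the future sigma-algebra through a pi-system of
  cylinder events. Measurability of (r, x) |-> E_{r,x}[V r] is a further obstacle, since starting
  time and functional move together and the kernel is controlled only for the future of a fixed
  time; rounding the starting time up to a grid separates the two. The Feller property also sees one
  time only, which is why continuity is not read off the explicit formula but obtained from
  fixed-point iterates, each built from one-time expectations.\<close>

definition bmeas :: "'a measure \<Rightarrow> ('a \<Rightarrow> real) set" where
  "bmeas N = {f \<in> borel_measurable N. \<exists>K. \<forall>x\<in>space N. \<bar>f x\<bar> \<le> K}"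

lemma bmeasI:
  "f \<in> borel_measurable N \<Longrightarrow> (\<And>x. x \<in> space N \<Longrightarrow> \<bar>f x\<bar> \<le> K) \<Longrightarrow> f \<in> bmeas N"
  by (auto simp: bmeas_def)

lemma bmeasD [measurable_dest]:
  "f \<in> bmeas N \<Longrightarrow> f \<in> borel_measurable N"
  by (simp add: bmeas_def)

lemma bmeas_bound:
  assumes "f \<in> bmeas N"
  obtains K where "K \<ge> 0" "\<And>x. x \<in> space N \<Longrightarrow> \<bar>f x\<bar> \<le> K"
proof -
  obtain K where "\<And>x. x \<in> space N \<Longrightarrow> \<bar>f x\<bar> \<le> K"
    using assms by (auto simp: bmeas_def)
  then show ?thesis by (intro that[of "max 0 K"]) (auto simp: max.coboundedI2)
qed

lemma bmeas_cong:
  "(\<And>x. x \<in> space N \<Longrightarrow> f x = h x) \<Longrightarrow> f \<in> bmeas N \<longleftrightarrow> h \<in> bmeas N"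
  by (simp add: bmeas_def cong: measurable_cong)

lemma bmeas_const: "(\<lambda>_. c) \<in> bmeas N"
  by (rule bmeasI[where K="\<bar>c\<bar>"]) auto

lemma bmeas_indicator:
  "A \<in> sets N \<Longrightarrow> (\<lambda>x. indicator A x) \<in> bmeas N"
  by (rule bmeasI[where K=1]) (auto simp: indicator_def)

lemma bmeas_uminus:
  assumes "f \<in> bmeas N" shows "(\<lambda>x. - f x) \<in> bmeas N"
  using assms by (auto simp: bmeas_def)

lemma bmeas_add:
  assumes f: "f \<in> bmeas N" and h: "h \<in> bmeas N"
  shows "(\<lambda>x. f x + h x) \<in> bmeas N"
proof -
  obtain K where K: "\<And>x. x \<in> space N \<Longrightarrow> \<bar>f x\<bar> \<le> K" using bmeas_bound[OF f] by blast
  obtain L where L: "\<And>x. x \<in> space N \<Longrightarrow> \<bar>h x\<bar> \<le> L" using bmeas_bound[OF h] by blast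
  show ?thesis
  proof (rule bmeasI)
    show "\<bar>f x + h x\<bar> \<le> K + L" if "x \<in> space N" for x
      using K[OF that] L[OF that] by linarith
  qed (use f h in measurable)
qed

lemma bmeas_diff:
  assumes "f \<in> bmeas N" "h \<in> bmeas N"
  shows "(\<lambda>x. f x - h x) \<in> bmeas N"
  using bmeas_add[OF assms(1) bmeas_uminus[OF assms(2)]] by simp

lemma bmeas_mult:
  assumes f: "f \<in> bmeas N" and h: "h \<in> bmeas N"
  shows "(\<lambda>x. f x * h x) \<in> bmeas N"
proof -
  obtain K where K: "K \<ge> 0" "\<And>x. x \<in> space N \<Longrightarrow> \<bar>f x\<bar> \<le> K" using bmeas_bound[OF f] by blast
  obtain L where L: "L \<ge> 0" "\<And>x. x \<in> space N \<Longrightarrow> \<bar>h x\<bar> \<le> L" using bmeas_bound[OF h] by blast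
  show ?thesis
  proof (rule bmeasI)
    show "\<bar>f x * h x\<bar> \<le> K * L" if "x \<in> space N" for x
      using K L that by (auto simp: abs_mult intro!: mult_mono)
  qed (use f h in measurable)
qed

lemma bmeas_exp:
  assumes f: "f \<in> bmeas N"
  shows "(\<lambda>x. exp (f x)) \<in> bmeas N"
proof -
  obtain K where K: "K \<ge> 0" "\<And>x. x \<in> space N \<Longrightarrow> \<bar>f x\<bar> \<le> K" using bmeas_bound[OF f] by blast
  show ?thesis
  proof (rule bmeasI)
    show "\<bar>exp (f x)\<bar> \<le> exp K" if "x \<in> space N" for x
      using K(2)[OF that] by simp
  qed (use f in measurable)
qed

lemma bmeas_compose:
  assumes "f \<in> bmeas N" "h \<in> measurable M N"
  shows "(\<lambda>x. f (h x)) \<in> bmeas M"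
  using assms by (auto simp: bmeas_def dest: measurable_space)

lemma (in finite_measure) integrable_bmeas:
  assumes "f \<in> bmeas M" shows "integrable M f"
proof -
  obtain K where "K \<ge> 0" "\<And>x. x \<in> space M \<Longrightarrow> \<bar>f x\<bar> \<le> K" using bmeas_bound[OF assms] by blast
  then show ?thesis
    using assms by (intro integrable_const_bound[where B=K]) (auto simp: bmeas_def)
qed

lemma (in finite_measure) abs_integral_le:
  assumes "f \<in> borel_measurable M" "\<And>x. x \<in> space M \<Longrightarrow> \<bar>f x\<bar> \<le> K"
  shows "\<bar>integral\<^sup>L M f\<bar> \<le> K * measure M (space M)"
proof -
  have i: "integrable M f"
    using assms by (intro integrable_bmeas bmeasI)
  have "\<bar>integral\<^sup>L M f\<bar> \<le> (\<integral>x. \<bar>f x\<bar> \<partial>M)" by (rule integral_abs_bound)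
  also have "\<dots> \<le> (\<integral>x. K \<partial>M)" using assms i by (intro integral_mono) auto
  finally show ?thesis by (simp add: mult.commute)
qed

lemma bmeas_integral:
  assumes f: "f \<in> bmeas (N \<Otimes>\<^sub>M M)" and M: "finite_measure M"
  shows "(\<lambda>x. \<integral>y. f (x, y) \<partial>M) \<in> bmeas N"
proof -
  interpret finite_measure M by fact
  obtain K where K: "K \<ge> 0" "\<And>z. z \<in> space (N \<Otimes>\<^sub>M M) \<Longrightarrow> \<bar>f z\<bar> \<le> K"
    using bmeas_bound[OF f] by blast
  show ?thesis
  proof (rule bmeasI)
    show "(\<lambda>x. \<integral>y. f (x, y) \<partial>M) \<in> borel_measurable N"
      using f by (intro borel_measurable_lebesgue_integral) (auto simp: bmeas_def)
    show "\<bar>\<integral>y. f (x, y) \<partial>M\<bar> \<le> K * measure M (space M)" if "x \<in> space N" for x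
      using that f K(2) by (intro abs_integral_le) (auto simp: space_pair_measure bmeas_def)
  qed
qed

lemma Fubini_bmeas:
  assumes f: "f \<in> bmeas (N \<Otimes>\<^sub>M M)" and N: "finite_measure N" and M: "finite_measure M"
  shows "(\<integral>y. \<integral>x. f (x, y) \<partial>N \<partial>M) = (\<integral>x. \<integral>y. f (x, y) \<partial>M \<partial>N)"
proof -
  interpret N: finite_measure N by fact
  interpret M: finite_measure M by fact
  interpret pair_sigma_finite N M ..
  interpret finite_measure "N \<Otimes>\<^sub>M M"
    by (rule finite_measure_pair_measure[OF M N])
  show ?thesis
    using Fubini_integral[of "\<lambda>x y. f (x, y)"] integrable_bmeas[OF f] by simp
qed

section \<open>Diffuse measures on a compact interval\<close>

text \<open>Null singletons are the form in which atomlessness is used. They make closed intervals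
  additive at common end points and remove the diagonal from product integrals.\<close>

locale diffuse_measure = finite_measure \<nu> for \<nu> :: "real measure" +
  fixes T :: real
  assumes sets_nu [measurable_cong]: "sets \<nu> = sets (restrict_space borel {0..T})"
    and singleton_null: "emeasure \<nu> {s} = 0"
begin

lemma space_nu: "space \<nu> = {0..T}"
  using sets_eq_imp_space_eq[OF sets_nu] by (simp add: space_restrict_space)

lemma measurable_ident_nu [measurable]: "(\<lambda>s. s) \<in> borel_measurable \<nu>"
  using measurable_ident_sets[OF sets_nu] by (intro measurable_restrict_space1[where N=borel, THEN measurable_cong_sets[OF sets_nu refl, THEN equalityD2, THEN subsetD]]) auto

lemma AE_neq: "AE s in \<nu>. s \<noteq> c"
proof (cases "c \<in> {0..T}")
  case True
  then have "{c} \<in> sets \<nu>"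
    by (auto simp: sets_nu sets_restrict_space intro!: image_eqI[of _ _ "{c}"])
  then have "{c} \<in> null_sets \<nu>" using singleton_null by auto
  then show ?thesis by (intro AE_I'[of "{c}"]) auto
next
  case False
  then show ?thesis by (intro AE_I2) (auto simp: space_nu)
qed

lemma bmeas_indicator_interval:
  "(\<lambda>s. indicator {r..t} s) \<in> bmeas \<nu>"
proof (rule bmeasI[where K=1])
  show "(\<lambda>s. indicator {r..t} s :: real) \<in> borel_measurable \<nu>"
    by (rule measurable_compose[OF measurable_ident_nu]) simp
qed (simp add: indicator_def)

lemma set_integrable_bmeas:
  assumes "\<alpha> \<in> bmeas \<nu>"
  shows "set_integrable \<nu> {r..t} \<alpha>"
  unfolding set_integrable_def real_scaleR_def
  by (intro integrable_bmeas bmeas_mult assms bmeas_indicator_interval)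

text \<open>For t = r the interval is one \<nu>-null point; for t < r it is empty.\<close>

lemma interval_integral_empty:
  assumes "t \<le> r" shows "(LINT s:{r..t}|\<nu>. \<alpha> s) = (0::real)"
proof -
  have "AE s in \<nu>. indicator {r..t} s *\<^sub>R \<alpha> s = 0"
    using AE_neq[of t] assms by (rule_tac AE_mp) (auto simp: indicator_def)
  then show ?thesis
    unfolding set_lebesgue_integral_def by (rule integral_eq_zero_AE)
qed

text \<open>The two closed intervals share only the point s, which is \<nu>-null.\<close>

lemma interval_integral_split:
  assumes \<alpha>: "\<alpha> \<in> bmeas \<nu>" and "0 \<le> r" "r \<le> s" "s \<le> t" "t \<le> T"
  shows "(LINT q:{r..t}|\<nu>. \<alpha> q) = (LINT q:{r..s}|\<nu>. \<alpha> q) + (LINT q:{s..t}|\<nu>. \<alpha> q)"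
proof -
  have *: "{r..t} = {r..s} \<union> {s..t}" using assms by auto
  show ?thesis unfolding *
    by (rule set_integral_Un_AE)
       (use AE_neq[of s] assms in \<open>auto intro!: set_integrable_bmeas[OF \<alpha>] simp: sets_nu sets_restrict_space_iff\<close>)
qed

text \<open>The set of (x, s) with l x <= s <= h x is measurable in the product, so end points that
  vary with the parameter are absorbed into an indicator. When x contains a time that is its own end
  point, this covers running integrals.\<close>

lemma bmeas_interval_integral:
  assumes f: "f \<in> bmeas (N \<Otimes>\<^sub>M \<nu>)"
    and [measurable]: "l \<in> borel_measurable N" "h \<in> borel_measurable N"
  shows "(\<lambda>x. LINT s:{l x..h x}|\<nu>. f (x, s)) \<in> bmeas N"
proof -
  have "(\<lambda>(x, s). indicator {l x..h x} s :: real) = (\<lambda>(x, s). if l x \<le> s \<and> s \<le> h x then 1 else 0)"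
    by (auto simp: indicator_def)
  also have "\<dots> \<in> bmeas (N \<Otimes>\<^sub>M \<nu>)"
    by (rule bmeasI[where K=1]) (measurable, auto)
  finally have "(\<lambda>z. (case z of (x, s) \<Rightarrow> indicator {l x..h x} s) * f z) \<in> bmeas (N \<Otimes>\<^sub>M \<nu>)"
    using f by (rule bmeas_mult)
  from bmeas_integral[OF this finite_measure_axioms]
  show ?thesis by (simp add: set_lebesgue_integral_def)
qed

lemma bmeas_interval_integral1:
  assumes "\<alpha> \<in> bmeas \<nu>"
  shows "(\<lambda>t. LINT s:{r..t}|\<nu>. \<alpha> s) \<in> bmeas \<nu>"
  using bmeas_interval_integral[of "\<lambda>z. \<alpha> (snd z)" \<nu> "\<lambda>_. r" "\<lambda>t. t"]
    bmeas_compose[OF assms, of snd "\<nu> \<Otimes>\<^sub>M \<nu>"] by simp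

text \<open>The square over [r, t] splits into the triangles q <= s and s <= q; Fubini turns the
  second into the first with the roles of \<alpha> and \<beta> exchanged. This product rule replaces
  differentiation, since \<nu> may be singular to Lebesgue measure.\<close>

lemma interval_integral_product0:
  assumes \<alpha>: "\<alpha> \<in> bmeas \<nu>" and \<beta>: "\<beta> \<in> bmeas \<nu>"
  shows "(LINT s:{r..t}|\<nu>. \<alpha> s) * (LINT s:{r..t}|\<nu>. \<beta> s) =
    (LINT s:{r..t}|\<nu>. \<alpha> s * (LINT q:{r..s}|\<nu>. \<beta> q)) +
    (LINT s:{r..t}|\<nu>. \<beta> s * (LINT q:{r..s}|\<nu>. \<alpha> q))"
proof -
  define J where "J \<alpha> s = indicator {r..t} s * \<alpha> s" for \<alpha> :: "real \<Rightarrow> real" and s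
  have J: "J \<gamma> \<in> bmeas \<nu>" if "\<gamma> \<in> bmeas \<nu>" for \<gamma>
    unfolding J_def by (intro bmeas_mult that bmeas_indicator_interval)
  have fs: "(\<lambda>z. fst z) \<in> borel_measurable (\<nu> \<Otimes>\<^sub>M \<nu>)" "(\<lambda>z. snd z) \<in> borel_measurable (\<nu> \<Otimes>\<^sub>M \<nu>)"
    by (rule measurable_compose[OF measurable_fst measurable_ident_nu] measurable_compose[OF measurable_snd measurable_ident_nu])+
  have le: "(\<lambda>z. of_bool (snd z \<le> fst z)) \<in> bmeas (\<nu> \<Otimes>\<^sub>M \<nu>)"
    proof (rule bmeasI[where K=1])
      show "(\<lambda>z. of_bool (snd z \<le> fst z)) \<in> borel_measurable (\<nu> \<Otimes>\<^sub>M \<nu>)"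
        using fs unfolding of_bool_def by measurable
    qed auto
  have eq: "(\<integral>q. J \<beta> q * of_bool (q \<le> s) \<partial>\<nu>) = (LINT q:{r..s}|\<nu>. \<beta> q)" if "s \<le> t" for \<beta> s
    unfolding set_lebesgue_integral_def J_def using that
    by (intro Bochner_Integration.integral_cong) (auto simp: indicator_def)
  have dom: "(\<integral>s. J \<alpha> s * (\<integral>q. J \<beta> q * of_bool (q \<le> s) \<partial>\<nu>) \<partial>\<nu>) =
      (LINT s:{r..t}|\<nu>. \<alpha> s * (LINT q:{r..s}|\<nu>. \<beta> q))" for \<alpha> \<beta>
    unfolding set_lebesgue_integral_def[of _ "{r..t}"]
    by (intro Bochner_Integration.integral_cong) (auto simp: indicator_def eq J_def[of \<alpha>])
  have int: "(\<lambda>z. J \<alpha> (fst z) * (J \<beta> (snd z) * of_bool (snd z \<le> fst z))) \<in> bmeas (\<nu> \<Otimes>\<^sub>M \<nu>)"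
    if "\<alpha> \<in> bmeas \<nu>" "\<beta> \<in> bmeas \<nu>" for \<alpha> \<beta>
    using that by (intro bmeas_mult le
        bmeas_compose[OF J measurable_fst] bmeas_compose[OF J measurable_snd])
  have "(LINT s:{r..t}|\<nu>. \<alpha> s) * (LINT s:{r..t}|\<nu>. \<beta> s) = (\<integral>s. J \<alpha> s * (\<integral>q. J \<beta> q \<partial>\<nu>) \<partial>\<nu>)"
    by (simp add: set_lebesgue_integral_def J_def)
  also have "\<dots> = (\<integral>s. J \<alpha> s * (\<integral>q. J \<beta> q * of_bool (q \<le> s) \<partial>\<nu>) + J \<alpha> s * (\<integral>q. J \<beta> q * of_bool (s \<le> q) \<partial>\<nu>) \<partial>\<nu>)"
  proof (intro Bochner_Integration.integral_cong refl)
    fix s assume s: "s \<in> space \<nu>"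
    have hb: "(\<lambda>q. of_bool (q \<le> s)) \<in> bmeas \<nu>" "(\<lambda>q. of_bool (s \<le> q)) \<in> bmeas \<nu>"
      unfolding of_bool_def by (rule bmeasI[where K=1]; measurable; simp)+
    have "(\<integral>q. J \<beta> q \<partial>\<nu>) = (\<integral>q. J \<beta> q * of_bool (q \<le> s) + J \<beta> q * of_bool (s \<le> q) \<partial>\<nu>)"
    proof (rule integral_cong_AE)
      \<comment> \<open>At q = s both indicators are 1; this point is null.\<close>
      show "AE q in \<nu>. J \<beta> q = J \<beta> q * of_bool (q \<le> s) + J \<beta> q * of_bool (s \<le> q)"
        using AE_neq[of s] by eventually_elim (auto simp: of_bool_def)
    qed (intro bmeasD bmeas_add bmeas_mult J \<beta> hb)+
    also have "\<dots> = (\<integral>q. J \<beta> q * of_bool (q \<le> s) \<partial>\<nu>) + (\<integral>q. J \<beta> q * of_bool (s \<le> q) \<partial>\<nu>)"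
      by (intro Bochner_Integration.integral_add integrable_bmeas bmeas_mult J \<beta> hb)
    finally show "J \<alpha> s * (\<integral>q. J \<beta> q \<partial>\<nu>) =
      J \<alpha> s * (\<integral>q. J \<beta> q * of_bool (q \<le> s) \<partial>\<nu>) + J \<alpha> s * (\<integral>q. J \<beta> q * of_bool (s \<le> q) \<partial>\<nu>)"
      by (simp add: distrib_left)
  qed
  also have "\<dots> = (\<integral>s. J \<alpha> s * (\<integral>q. J \<beta> q * of_bool (q \<le> s) \<partial>\<nu>) \<partial>\<nu>) +
      (\<integral>s. J \<alpha> s * (\<integral>q. J \<beta> q * of_bool (s \<le> q) \<partial>\<nu>) \<partial>\<nu>)"
  proof (rule Bochner_Integration.integral_add)
    have le': "(\<lambda>z. of_bool (fst z \<le> snd z)) \<in> bmeas (\<nu> \<Otimes>\<^sub>M \<nu>)"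
    proof (rule bmeasI[where K=1])
      show "(\<lambda>z. of_bool (fst z \<le> snd z)) \<in> borel_measurable (\<nu> \<Otimes>\<^sub>M \<nu>)"
        using fs unfolding of_bool_def by measurable
    qed auto
    show "integrable \<nu> (\<lambda>s. J \<alpha> s * (\<integral>q. J \<beta> q * of_bool (q \<le> s) \<partial>\<nu>))"
      using bmeas_integral[OF int[OF \<alpha> \<beta>] finite_measure_axioms]
      by (intro integrable_bmeas) simp
    show "integrable \<nu> (\<lambda>s. J \<alpha> s * (\<integral>q. J \<beta> q * of_bool (s \<le> q) \<partial>\<nu>))"
      using bmeas_integral[OF bmeas_mult[OF bmeas_compose[OF J[OF \<alpha>] measurable_fst]
          bmeas_mult[OF bmeas_compose[OF J[OF \<beta>] measurable_snd] le']] finite_measure_axioms]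
      by (intro integrable_bmeas) simp
  qed
  also have "(\<integral>s. J \<alpha> s * (\<integral>q. J \<beta> q * of_bool (s \<le> q) \<partial>\<nu>) \<partial>\<nu>) =
      (\<integral>s. \<integral>q. J \<beta> q * (J \<alpha> s * of_bool (s \<le> q)) \<partial>\<nu> \<partial>\<nu>)"
    by (simp add: mult.left_commute flip: integral_mult_right_zero)
  \<comment> \<open>Fubini is applied to the triangle s <= q, and q becomes the outer
    variable.\<close>
  also have "\<dots> = (\<integral>q. \<integral>s. J \<beta> q * (J \<alpha> s * of_bool (s \<le> q)) \<partial>\<nu> \<partial>\<nu>)"
    using Fubini_bmeas[OF int[OF \<beta> \<alpha>] finite_measure_axioms finite_measure_axioms] by simp
  also have "\<dots> = (\<integral>q. J \<beta> q * (\<integral>s. J \<alpha> s * of_bool (s \<le> q) \<partial>\<nu>) \<partial>\<nu>)"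
    by simp
  finally show ?thesis by (simp add: dom)
qed

lemma interval_integral_add:
  assumes "\<alpha> \<in> bmeas \<nu>" "\<beta> \<in> bmeas \<nu>"
  shows "(LINT s:{r..t}|\<nu>. \<alpha> s + \<beta> s) = (LINT s:{r..t}|\<nu>. \<alpha> s) + (LINT s:{r..t}|\<nu>. \<beta> s)"
  using assms by (intro set_integral_add set_integrable_bmeas)

lemma interval_integral_diff:
  assumes "\<alpha> \<in> bmeas \<nu>" "\<beta> \<in> bmeas \<nu>"
  shows "(LINT s:{r..t}|\<nu>. \<alpha> s - \<beta> s) = (LINT s:{r..t}|\<nu>. \<alpha> s) - (LINT s:{r..t}|\<nu>. \<beta> s)"
  using assms by (intro set_integral_diff set_integrable_bmeas)

lemma interval_integral_cong:
  "(\<And>s. s \<in> {0..T} \<Longrightarrow> r \<le> s \<Longrightarrow> s \<le> t \<Longrightarrow> \<alpha> s = \<beta> s) \<Longrightarrow> (LINT s:{r..t}|\<nu>. \<alpha> s) = (LINT s:{r..t}|\<nu>. \<beta> s)"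
  unfolding set_lebesgue_integral_def
  by (intro Bochner_Integration.integral_cong) (auto simp: space_nu indicator_def)

text \<open>Integration by parts; the diagonal does not contribute since \<open>\<nu>\<close> is diffuse.\<close>

lemma interval_integral_product:
  assumes \<alpha>: "\<alpha> \<in> bmeas \<nu>" and \<beta>: "\<beta> \<in> bmeas \<nu>"
    and A: "\<And>s. s \<in> {0..T} \<Longrightarrow> r \<le> s \<Longrightarrow> s \<le> t \<Longrightarrow> A s = c + (LINT q:{r..s}|\<nu>. \<alpha> q)"
    and B: "\<And>s. s \<in> {0..T} \<Longrightarrow> r \<le> s \<Longrightarrow> s \<le> t \<Longrightarrow> B s = e + (LINT q:{r..s}|\<nu>. \<beta> q)"
    and t: "t \<in> {0..T}" "r \<le> t"
  shows "A t * B t = c * e + (LINT s:{r..t}|\<nu>. \<alpha> s * B s + \<beta> s * A s)"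
proof -
  have [simp]: "(\<lambda>s. \<gamma> s * (LINT q:{r..s}|\<nu>. \<delta> q)) \<in> bmeas \<nu>"
    if "\<gamma> \<in> bmeas \<nu>" "\<delta> \<in> bmeas \<nu>" for \<gamma> \<delta>
    by (intro bmeas_mult bmeas_interval_integral1 that)
  have [simp]: "(\<lambda>s. \<gamma> s * k) \<in> bmeas \<nu>" if "\<gamma> \<in> bmeas \<nu>" for \<gamma> k
    by (intro bmeas_mult bmeas_const that)
  have "(LINT s:{r..t}|\<nu>. \<alpha> s * B s + \<beta> s * A s) =
      (LINT s:{r..t}|\<nu>. (\<alpha> s * e + \<alpha> s * (LINT q:{r..s}|\<nu>. \<beta> q)) + (\<beta> s * c + \<beta> s * (LINT q:{r..s}|\<nu>. \<alpha> q)))"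
    by (rule interval_integral_cong) (simp add: A B algebra_simps)
  also have "\<dots> = (LINT s:{r..t}|\<nu>. \<alpha> s) * e + (LINT s:{r..t}|\<nu>. \<beta> s) * c +
     (LINT s:{r..t}|\<nu>. \<alpha> s) * (LINT s:{r..t}|\<nu>. \<beta> s)"
    using \<alpha> \<beta> by (simp add: interval_integral_add bmeas_add interval_integral_product0)
  finally show ?thesis using t by (simp add: A B algebra_simps)
qed

text \<open>The exponential series is integrated term by term. With B the running integral of
  \<beta>, repeated integration by parts shows that B^(n+1) is the integral of (n+1) \<beta> B^n,
  and the series is dominated through bounds of \<beta> and B. This is the chain rule for the
  exponential with respect to \<nu>.\<close>

lemma exp_interval_integral:
  assumes \<beta>: "\<beta> \<in> bmeas \<nu>" and t: "t \<in> {0..T}" "r \<le> t"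
  shows "exp (LINT s:{r..t}|\<nu>. \<beta> s) = 1 + (LINT s:{r..t}|\<nu>. \<beta> s * exp (LINT q:{r..s}|\<nu>. \<beta> q))"
proof -
  define B where "B t = (LINT s:{r..t}|\<nu>. \<beta> s)" for t
  have B: "B \<in> bmeas \<nu>"
    unfolding B_def by (rule bmeas_interval_integral1[OF \<beta>])
  have Bn: "(\<lambda>s. B s ^ n) \<in> bmeas \<nu>" for n
    by (induction n) (auto intro: bmeas_mult bmeas_const B)
  have pow: "B t ^ Suc n = (LINT s:{r..t}|\<nu>. of_nat (Suc n) * (\<beta> s * B s ^ n))"
    if "t \<in> {0..T}" "r \<le> t" for n t
    using that
  proof (induction n arbitrary: t)
    case (Suc n)
    \<comment> \<open>Both factors are running integrals with starting constant 0. The product rule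
      yields \<beta> B^(n+1) with the coefficients n + 1 and 1, which add up to n + 2.\<close>
    have "B t ^ Suc n * B t = 0 * 0 + (LINT s:{r..t}|\<nu>. of_nat (Suc n) * (\<beta> s * B s ^ n) * B s + \<beta> s * B s ^ Suc n)"
    proof (rule interval_integral_product)
      show "(\<lambda>s. of_nat (Suc n) * (\<beta> s * B s ^ n)) \<in> bmeas \<nu>"
        by (intro bmeas_mult bmeas_const \<beta> Bn)
      show "B s ^ Suc n = 0 + (LINT q:{r..s}|\<nu>. of_nat (Suc n) * (\<beta> q * B q ^ n))"
        if "s \<in> {0..T}" "r \<le> s" for s
        using Suc.IH[OF that] by simp
    qed (use Suc.prems \<beta> in \<open>auto simp: B_def\<close>)
    also have "(\<lambda>s. of_nat (Suc n) * (\<beta> s * B s ^ n) * B s + \<beta> s * B s ^ Suc n) =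
        (\<lambda>s. of_nat (Suc (Suc n)) * (\<beta> s * B s ^ Suc n))"
      by (auto simp: algebra_simps)
    finally show ?case by (simp add: mult_ac)
  qed (simp add: B_def)
  obtain K where K: "K \<ge> 0" "\<And>s. s \<in> space \<nu> \<Longrightarrow> \<bar>B s\<bar> \<le> K" using bmeas_bound[OF B] by blast
  obtain L where L: "L \<ge> 0" "\<And>s. s \<in> space \<nu> \<Longrightarrow> \<bar>\<beta> s\<bar> \<le> L" using bmeas_bound[OF \<beta>] by blast
  define h where "h n s = indicator {r..t} s * (\<beta> s * (B s ^ n / fact n))" for n s
  have hb: "h n \<in> bmeas \<nu>" for n
    unfolding h_def divide_inverse
    by (intro bmeas_mult \<beta> Bn bmeas_const bmeas_indicator_interval)
  have hint: "integral\<^sup>L \<nu> (h n) = B t ^ Suc n / fact (Suc n)" for n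
  proof -
    have "B t ^ Suc n = of_nat (Suc n) * (LINT s:{r..t}|\<nu>. \<beta> s * B s ^ n)"
      by (subst pow[OF t]) (rule set_integral_mult_right)
    then have "B t ^ Suc n / fact (Suc n) = (LINT s:{r..t}|\<nu>. \<beta> s * B s ^ n) / fact n"
      by (simp del: of_nat_Suc power_Suc)
    also have "\<dots> = integral\<^sup>L \<nu> (h n)"
      by (simp add: set_lebesgue_integral_def h_def[abs_def])
    finally show ?thesis ..
  qed
  have hK: "norm (h n s) \<le> L * (K ^ n / fact n)" if "s \<in> space \<nu>" for n s
  proof -
    have "\<bar>B s\<bar> ^ n \<le> K ^ n" using K(2)[OF that] by (intro power_mono) auto
    moreover have "\<bar>\<beta> s\<bar> \<le> L" using L that by auto
    ultimately show ?thesis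
      using L K unfolding h_def
      by (auto simp: indicator_def abs_mult power_abs intro!: mult_mono divide_right_mono)
  qed
  have sK: "summable (\<lambda>n. L * (K ^ n / fact n))"
    using summable_exp[of K] by (intro summable_mult) (simp add: field_simps)
  have hsum: "(\<lambda>n. h n s) sums (indicator {r..t} s * (\<beta> s * exp (B s)))" for s
    unfolding h_def using exp_converges[of "B s"] by (intro sums_mult) (simp add: field_simps)
  have "(\<lambda>n. integral\<^sup>L \<nu> (h n)) sums (\<integral>s. (\<Sum>n. h n s) \<partial>\<nu>)"
  proof (rule sums_integral)
    show "integrable \<nu> (h n)" for n by (rule integrable_bmeas[OF hb])
    show "AE s in \<nu>. summable (\<lambda>n. norm (h n s))"
      using hK by (intro AE_I2 summable_comparison_test'[OF sK, of 0]) auto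
    show "summable (\<lambda>n. \<integral>s. norm (h n s) \<partial>\<nu>)"
    proof (rule summable_comparison_test'[of "\<lambda>n. L * (K ^ n / fact n) * measure \<nu> (space \<nu>)" 0])
      show "summable (\<lambda>n. L * (K ^ n / fact n) * measure \<nu> (space \<nu>))"
        by (intro summable_mult2 sK)
      show "norm (\<integral>s. norm (h n s) \<partial>\<nu>) \<le> L * (K ^ n / fact n) * measure \<nu> (space \<nu>)" for n
        unfolding real_norm_def[of "integral\<^sup>L _ _"] using hb[of n] hK
        by (intro abs_integral_le) (auto simp: bmeas_def)
    qed
  qed
  moreover have "(\<integral>s. (\<Sum>n. h n s) \<partial>\<nu>) = (LINT s:{r..t}|\<nu>. \<beta> s * exp (B s))"
    unfolding set_lebesgue_integral_def using hsum by (simp add: sums_iff)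
  ultimately have "(\<lambda>n. B t ^ Suc n / fact (Suc n)) sums (LINT s:{r..t}|\<nu>. \<beta> s * exp (B s))"
    by (simp add: hint del: power_Suc fact_Suc)
  \<comment> \<open>The index shift drops the term n = 0 of the exponential series, hence exp -
    1.\<close>
  moreover have "(\<lambda>n. B t ^ Suc n / fact (Suc n)) sums (exp (B t) - 1)"
    using exp_converges[of "B t"] by (subst sums_Suc_iff) (simp add: field_simps)
  ultimately show ?thesis
    unfolding B_def using sums_unique2 by fastforce
qed

text \<open>Off the point r each s is eventually inside or eventually outside the moving interval,
  so the indicators are eventually constant; r itself is null.\<close>

lemma interval_integral_tendsto:
  assumes \<alpha>: "\<alpha> \<in> bmeas \<nu>" and t: "t \<longlonglongrightarrow> r"
  shows "(\<lambda>n. LINT s:{c..t n}|\<nu>. \<alpha> s) \<longlonglongrightarrow> (LINT s:{c..r}|\<nu>. \<alpha> s)"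
  unfolding set_lebesgue_integral_def
proof (rule integral_dominated_convergence[where w="\<lambda>s. \<bar>\<alpha> s\<bar>"])
  show "integrable \<nu> (\<lambda>s. \<bar>\<alpha> s\<bar>)"
    using integrable_bmeas[OF \<alpha>] by simp
  show "AE s in \<nu>. (\<lambda>n. indicator {c..t n} s *\<^sub>R \<alpha> s) \<longlonglongrightarrow> indicator {c..r} s *\<^sub>R \<alpha> s"
    using AE_neq[of r]
  proof eventually_elim
    case (elim s)
    have "\<forall>\<^sub>F n in sequentially. indicator {c..t n} s = (indicator {c..r} s :: real)"
    proof (cases "s < r")
      case True
      show ?thesis using order_tendstoD(1)[OF t True] by eventually_elim (use True in \<open>auto simp: indicator_def\<close>)
    next
      case False
      then have "s > r" using elim by auto
      show ?thesis using order_tendstoD(2)[OF t \<open>s > r\<close>] by eventually_elim (use \<open>s > r\<close> in \<open>auto simp: indicator_def\<close>)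
    qed
    then show ?case by (intro tendsto_eventually) (auto elim: eventually_mono)
  qed
qed (use \<alpha> in \<open>auto simp: indicator_def bmeas_def\<close>)

end

section \<open>The Borel sets of a pseudometric\<close>

lemma space_borel_of: "space (borel_of \<tau>) = topspace \<tau>"
  unfolding borel_of_def by (rule space_measure_of) (auto dest: openin_subset)

lemma sets_borel_of: "sets (borel_of \<tau>) = sigma_sets (topspace \<tau>) {U. openin \<tau> U}"
  unfolding borel_of_def by (rule sets_measure_of) (auto dest: openin_subset)

lemma measurable_borel_ofI:
  assumes "\<And>x. x \<in> space M \<Longrightarrow> f x \<in> topspace \<tau>"
    and "\<And>U. openin \<tau> U \<Longrightarrow> f -` U \<inter> space M \<in> sets M"
  shows "f \<in> measurable M (borel_of \<tau>)"
  unfolding borel_of_def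
proof (rule measurable_measure_of)
  show "{U. openin \<tau> U} \<subseteq> Pow (topspace \<tau>)" by (auto dest: openin_subset)
  show "f \<in> space M \<rightarrow> topspace \<tau>" using assms(1) by blast
  show "f -` U \<inter> space M \<in> sets M" if "U \<in> {U. openin \<tau> U}" for U
    using that assms(2) by blast
qed

lemma space_spacetime_borel: "space (spacetime_borel d I) = I \<times> UNIV"
  by (simp add: space_borel_of topspace_pm_topology)

lemma pseudometric_on_subset:
  "pseudometric_on A d \<Longrightarrow> B \<subseteq> A \<Longrightarrow> pseudometric_on B d"
  unfolding pseudometric_on_def by (intro conjI ballI) blast+

text \<open>Around each point of U some ball of A has its trace on B inside U, and balls are open by
  the triangle inequality. Taking V as the union of all open sets with trace inside U avoids a
  choice of radii.\<close>

lemma openin_pm_topology_subset: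
  assumes d: "pseudometric_on A d" and "B \<subseteq> A" and U: "openin (pm_topology d B) U"
  obtains V where "openin (pm_topology d A) V" "U = V \<inter> B"
proof -
  define V where "V = \<Union>{W. openin (pm_topology d A) W \<and> W \<inter> B \<subseteq> U}"
  have "openin (pm_topology d A) V" unfolding V_def by blast
  moreover have "U \<subseteq> V \<inter> B"
  proof
    fix p assume p: "p \<in> U"
    with U have pB: "p \<in> B" by (auto simp: openin_pm_topology)
    obtain e where e: "e > 0" "\<And>q. q \<in> B \<Longrightarrow> d p q < e \<Longrightarrow> q \<in> U"
      using U p unfolding openin_pm_topology by blast
    define W where "W = {q \<in> A. d p q < e}"
    have "openin (pm_topology d A) W"
      unfolding openin_pm_topology
    proof (intro conjI ballI)
      fix q assume q: "q \<in> W"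
      show "\<exists>\<epsilon>>0. \<forall>z\<in>A. d q z < \<epsilon> \<longrightarrow> z \<in> W"
      proof (intro exI[of _ "e - d p q"] conjI ballI impI)
        fix z assume z: "z \<in> A" "d q z < e - d p q"
        have "d p z \<le> d p q + d q z"
          using d q pB \<open>B \<subseteq> A\<close> z unfolding pseudometric_on_def W_def by blast
        then show "z \<in> W" using z by (auto simp: W_def)
      qed (use q in \<open>auto simp: W_def\<close>)
    qed (auto simp: W_def)
    moreover have "W \<inter> B \<subseteq> U" using e by (auto simp: W_def)
    moreover have "d p p = 0" using d pB \<open>B \<subseteq> A\<close> unfolding pseudometric_on_def by blast
    then have "p \<in> W" using pB \<open>B \<subseteq> A\<close> e by (auto simp: W_def)
    ultimately show "p \<in> V \<inter> B" using pB unfolding V_def by blast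
  qed
  moreover have "V \<inter> B \<subseteq> U" unfolding V_def by blast
  ultimately show ?thesis using that by blast
qed

text \<open>An open set contains with a point every point of A at distance 0 from it, and
  complements and countable unions inherit this.\<close>

lemma borel_pm_topology_saturated:
  assumes d: "pseudometric_on A d" and B: "B \<in> sets (borel_of (pm_topology d A))"
    and p: "p \<in> A" "q \<in> A" "d p q = 0"
  shows "p \<in> B \<longleftrightarrow> q \<in> B"
proof -
  have "B \<in> sigma_sets A {U. openin (pm_topology d A) U}"
    using B by (simp add: sets_borel_of topspace_pm_topology)
  then show ?thesis
  proof induction
    case (Basic U)
    have sym: "d q p = d p q" using d p(1,2) unfolding pseudometric_on_def by blast
    have "y \<in> U" if "x \<in> U" "y \<in> A" "d x y = 0" for x y
    proof -
      have "\<exists>\<epsilon>>0. \<forall>z\<in>A. d x z < \<epsilon> \<longrightarrow> z \<in> U"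
        using Basic that(1) by (simp add: openin_pm_topology)
      then show ?thesis using that by auto
    qed
    from this[of p q] this[of q p] p sym show ?case by auto
  next
    case (Compl a)
    then show ?case using p(1,2) by blast
  qed simp_all
qed

text \<open>Level sets of u are Borel, hence saturated under distance 0. Consistency of a solution
  thus follows from its measurability.\<close>

lemma borel_measurable_pm_topology_eq:
  assumes d: "pseudometric_on A d" and u: "u \<in> borel_measurable (borel_of (pm_topology d A))"
    and p: "p \<in> A" "q \<in> A" "d p q = 0"
  shows "u p = (u q :: real)"
proof -
  have "u -` {u p} \<inter> A \<in> sets (borel_of (pm_topology d A))"
    using measurable_sets[OF u, of "{u p}"] by (simp add: space_borel_of topspace_pm_topology)
  from borel_pm_topology_saturated[OF d this p] p show ?thesis by auto
qed

text \<open>A bridge from the topological definition of continuity to the \<epsilon>-\<delta> form,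
  in which it can be treated together with right-continuity.\<close>

lemma continuous_map_pm_topology_iff:
  assumes d: "pseudometric_on A d"
  shows "continuous_map (pm_topology d A) euclideanreal u \<longleftrightarrow>
    (\<forall>p\<in>A. \<forall>\<epsilon>>0. \<exists>\<delta>>0. \<forall>q\<in>A. d q p < \<delta> \<longrightarrow> \<bar>u q - u p\<bar> < \<epsilon>)"
  (is "?L \<longleftrightarrow> ?R")
proof
  have sym: "d p q = d q p" if "p \<in> A" "q \<in> A" for p q
    using d that unfolding pseudometric_on_def by blast
  {
    assume L: ?L
    show ?R
    proof (intro ballI allI impI)
      fix p and \<epsilon> :: real assume p: "p \<in> A" "\<epsilon> > 0"
      have "openin (pm_topology d A) {q \<in> topspace (pm_topology d A). u q \<in> ball (u p) \<epsilon>}"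
        using L by (rule openin_continuous_map_preimage) simp
      then obtain \<delta> where \<delta>: "\<delta> > 0" "\<And>q. q \<in> A \<Longrightarrow> d p q < \<delta> \<Longrightarrow> u q \<in> ball (u p) \<epsilon>"
        using p unfolding openin_pm_topology topspace_pm_topology by fastforce
      show "\<exists>\<delta>>0. \<forall>q\<in>A. d q p < \<delta> \<longrightarrow> \<bar>u q - u p\<bar> < \<epsilon>"
      proof (intro exI[of _ \<delta>] conjI ballI impI)
        fix q assume "q \<in> A" "d q p < \<delta>"
        then show "\<bar>u q - u p\<bar> < \<epsilon>"
          using \<delta>(2)[of q] sym[of p q] p by (simp add: dist_real_def abs_minus_commute)
      qed (rule \<delta>)
    qed
  next
    assume R: ?R
    show ?L
      unfolding continuous_map_def topspace_pm_topology
    proof (intro conjI allI impI)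
      fix U :: "real set" assume "openin euclideanreal U"
      then have U: "open U" by simp
      show "openin (pm_topology d A) {x \<in> A. u x \<in> U}"
        unfolding openin_pm_topology
      proof (intro conjI ballI)
        fix p assume p: "p \<in> {x \<in> A. u x \<in> U}"
        then obtain e where e: "e > 0" "ball (u p) e \<subseteq> U" using U open_contains_ball by blast
        obtain \<delta> where "\<delta> > 0" "\<forall>q\<in>A. d q p < \<delta> \<longrightarrow> \<bar>u q - u p\<bar> < e" using R p e(1) by blast
        moreover have "u q \<in> U" if "\<bar>u q - u p\<bar> < e" for q
          using that e(2) by (auto simp: dist_real_def abs_minus_commute subset_iff)
        ultimately show "\<exists>\<epsilon>>0. \<forall>q\<in>A. d p q < \<epsilon> \<longrightarrow> q \<in> {x \<in> A. u x \<in> U}"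
          using sym p by (intro exI[of _ \<delta>]) auto
      qed auto
    qed auto
  }
qed

text \<open>The balls of radius 1/(n+1) around a countable dense set form a base. A countable base
  of S makes sets that are open in the product topology measurable for the product
  sigma-algebra.\<close>

lemma second_countable_metrizable_separable:
  assumes m: "metrizable_space X" and s: "separable_space X"
  shows "second_countable X"
proof -
  obtain S e where me: "Metric_space S e" and X: "X = Metric_space.mtopology S e"
    using m unfolding metrizable_space_def by blast
  interpret Metric_space S e by (rule me)
  obtain C where C: "countable C" "C \<subseteq> S" "X closure_of C = S"
    using s unfolding separable_space_def X by auto
  show ?thesis
    unfolding second_countable_def
  proof (intro exI conjI ballI allI impI)
    let ?B = "(\<lambda>(c, n). mball c (inverse (real (Suc n)))) ` (C \<times> UNIV)"
    show "countable ?B" using C(1) by auto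
    show "openin X V" if "V \<in> ?B" for V using that by (auto simp: X)
    fix U x assume U: "openin X U \<and> x \<in> U"
    then obtain r where r: "r > 0" "mball x r \<subseteq> U" and x: "x \<in> S"
      unfolding X openin_mtopology by blast
    \<comment> \<open>Half of r suffices: a centre c within h of x and a ball of radius h around c
      stay within 2 h < r of x.\<close>
    obtain n where n: "inverse (real (Suc n)) < r / 2"
      using reals_Archimedean[of "r / 2"] r by auto
    define h where "h = inverse (real (Suc n))"
    have h: "h > 0" "2 * h < r" using n by (auto simp: h_def)
    obtain c where c: "c \<in> C" "c \<in> mball x h"
      using C(3) x h(1) unfolding X metric_closure_of by blast
    have "mball c h \<subseteq> mball x r"
    proof
      fix y assume "y \<in> mball c h"
      then have y: "y \<in> S" "c \<in> S" "e c y < h" by simp_all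
      have "e x y \<le> e x c + e c y" using x y by (intro triangle)
      moreover have "e x c < h" using c by simp
      ultimately show "y \<in> mball x r" using y x h by simp
    qed
    then have "mball c h \<subseteq> U" using r(2) by (rule subset_trans)
    moreover have "x \<in> mball c h" using c by (simp add: commute)
    moreover have "mball c h \<in> ?B" unfolding h_def using c(1) by (intro image_eqI[where x="(c, n)"]) simp_all
    ultimately show "\<exists>V\<in>?B. x \<in> V \<and> V \<subseteq> U" by (intro bexI conjI)
  qed
qed

text \<open>A predicate \<open>R\<close> restricting the admissible times treats continuity and right-continuity
  at once.\<close>

definition relatively_continuous ::
    "(real \<Rightarrow> real \<Rightarrow> bool) \<Rightarrow> (real \<times> 's \<Rightarrow> real \<times> 's \<Rightarrow> real) \<Rightarrow> real set \<Rightarrow> (real \<times> 's \<Rightarrow> real) \<Rightarrow> bool" where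
  "relatively_continuous R d I u \<longleftrightarrow>
     (\<forall>r\<in>I. \<forall>x. \<forall>\<epsilon>>0. \<exists>\<delta>>0. \<forall>s\<in>I. \<forall>y.
        R r s \<and> d (s, y) (r, x) < \<delta> \<longrightarrow> \<bar>u (s, y) - u (r, x)\<bar> < \<epsilon>)"

lemma right_continuous_spacetime_iff:
  "right_continuous_spacetime d I u \<longleftrightarrow> relatively_continuous (\<lambda>r s. r \<le> s) d I u"
  unfolding right_continuous_spacetime_def relatively_continuous_def by (rule refl)

lemma continuous_spacetime_iff:
  assumes "pseudometric_on (I \<times> UNIV) d"
  shows "continuous_spacetime d I u \<longleftrightarrow> relatively_continuous (\<lambda>_ _. True) d I u"
  unfolding continuous_spacetime_def relatively_continuous_def continuous_map_pm_topology_iff[OF assms]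
  unfolding Ball_def split_paired_All by simp

text \<open>Membership in I is asked only eventually, because starting times that converge to r < t
  lie in {0..t} only from some index on.\<close>

lemma relatively_continuous_sequentially:
  assumes u: "relatively_continuous R d I u" and r: "r \<in> I"
    and s: "\<forall>\<^sub>F n in sequentially. s n \<in> I \<and> R r (s n)"
    and lim: "(\<lambda>n. d (s n, y n) (r, x)) \<longlonglongrightarrow> 0"
  shows "(\<lambda>n. u (s n, y n)) \<longlonglongrightarrow> u (r, x)"
proof (rule tendstoI)
  fix e :: real assume "e > 0"
  then obtain \<delta> where \<delta>: "\<delta> > 0"
      "\<forall>s\<in>I. \<forall>y. R r s \<and> d (s, y) (r, x) < \<delta> \<longrightarrow> \<bar>u (s, y) - u (r, x)\<bar> < e"
    using u r unfolding relatively_continuous_def by blast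
  show "\<forall>\<^sub>F n in sequentially. dist (u (s n, y n)) (u (r, x)) < e"
    using s order_tendstoD(2)[OF lim \<delta>(1)]
    by eventually_elim (use \<delta>(2) in \<open>unfold dist_real_def, blast\<close>)
qed

text \<open>If some \<epsilon> admits no \<delta>, the failures for \<delta> = 1/(n+1) form an
  offending sequence. Sequences are what dominated convergence can handle.\<close>

lemma relatively_continuousI:
  assumes d: "\<And>s y r x. s \<in> I \<Longrightarrow> r \<in> I \<Longrightarrow> 0 \<le> d (s, y) (r, x)"
    and lim: "\<And>r x s y. \<lbrakk>r \<in> I; \<And>n. s n \<in> I; \<And>n. R r (s n); (\<lambda>n. d (s n, y n) (r, x)) \<longlonglongrightarrow> 0\<rbrakk> \<Longrightarrow>
      (\<lambda>n. u (s n, y n)) \<longlonglongrightarrow> u (r, x)"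
  shows "relatively_continuous R d I u"
  unfolding relatively_continuous_def
proof (intro ballI allI impI, rule ccontr)
  fix r x and \<epsilon> :: real
  assume r: "r \<in> I" and "\<epsilon> > 0"
    and no: "\<not> (\<exists>\<delta>>0. \<forall>s\<in>I. \<forall>y. R r s \<and> d (s, y) (r, x) < \<delta> \<longrightarrow> \<bar>u (s, y) - u (r, x)\<bar> < \<epsilon>)"
  have "\<exists>s y. s \<in> I \<and> R r s \<and> d (s, y) (r, x) < inverse (real (Suc n)) \<and> \<not> \<bar>u (s, y) - u (r, x)\<bar> < \<epsilon>" for n
  proof -
    have "0 < inverse (real (Suc n))" by simp
    with no show ?thesis by blast
  qed
  then obtain s y where sy: "\<And>n. s n \<in> I" "\<And>n. R r (s n)"
      "\<And>n. d (s n, y n) (r, x) < inverse (real (Suc n))" "\<And>n. \<not> \<bar>u (s n, y n) - u (r, x)\<bar> < \<epsilon>"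
    by metis
  have "(\<lambda>n. d (s n, y n) (r, x)) \<longlonglongrightarrow> 0"
  proof (rule tendsto_sandwich[OF _ _ tendsto_const LIMSEQ_inverse_real_of_nat])
    show "\<forall>\<^sub>F n in sequentially. 0 \<le> d (s n, y n) (r, x)"
      by (intro always_eventually allI d[OF sy(1) r])
    show "\<forall>\<^sub>F n in sequentially. d (s n, y n) (r, x) \<le> inverse (real (Suc n))"
      by (intro always_eventually allI less_imp_le sy(3))
  qed
  from lim[OF r sy(1,2) this] have "\<forall>\<^sub>F n in sequentially. dist (u (s n, y n)) (u (r, x)) < \<epsilon>"
    using \<open>\<epsilon> > 0\<close> by (rule tendstoD)
  then obtain n where "dist (u (s n, y n)) (u (r, x)) < \<epsilon>"
    using eventually_happens'[OF sequentially_bot] by blast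
  with sy(4)[of n] show False
    unfolding dist_real_def by (rule notE)
qed

section \<open>The Borel sets of d and the product sigma-algebra on space-time\<close>

context spacetime_setting
begin

abbreviation ST :: "real \<Rightarrow> (real \<times> 's) measure" where
  "ST t \<equiv> spacetime_borel d {0..t}"

text \<open>Two sigma-algebras coexist. The sets of \<open>ST T\<close> belong to
  \<open>time_space T\<close>, because the topology of d is coarser than the product topology.
  Solutions have to be measurable for \<open>ST T\<close>, whereas composition with paths works for
  all of \<open>time_space T\<close>.\<close>

abbreviation time_space :: "real \<Rightarrow> (real \<times> 's) measure" where
  "time_space t \<equiv> restrict_space borel {0..t} \<Otimes>\<^sub>M borel"

lemma pseudometric_sub:
  assumes "t \<le> T" shows "pseudometric_on ({0..t} \<times> UNIV) d"
  by (rule pseudometric_on_subset[OF pseudometric]) (use assms in auto)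

lemma dist_nonneg: "s \<in> {0..T} \<Longrightarrow> r \<in> {0..T} \<Longrightarrow> 0 \<le> d (s, y) (r, x)"
  using pseudometric[unfolded pseudometric_on_def, THEN conjunct2, THEN conjunct1, rule_format, of "(s, y)" "(r, x)"]
  by simp

lemma dist_self: "r \<in> {0..T} \<Longrightarrow> d (r, x) (r, x) = 0"
  using pseudometric[unfolded pseudometric_on_def, THEN conjunct1, rule_format, of "(r, x)"] by simp

text \<open>For each basic open set V of S, \<open>J V\<close> collects all open time sets W with W
  x V inside U; then U is the countable union of the rectangles \<open>J V\<close> x V.\<close>

lemma open_time_space:
  assumes U: "openin (prod_topology (top_of_set {0..T}) euclidean) U"
  shows "U \<in> sets (time_space T)"
proof -
  obtain \<B> where \<B>: "countable \<B>" "\<And>V. V \<in> \<B> \<Longrightarrow> openin euclidean V"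
      "\<And>W x. openin euclidean W \<Longrightarrow> x \<in> W \<Longrightarrow> \<exists>V\<in>\<B>. x \<in> V \<and> V \<subseteq> (W :: 's set)"
    using second_countable_metrizable_separable[OF metrizable_state separable_state]
    unfolding second_countable_def by metis
  define J where "J V = \<Union>{W. openin (top_of_set {0..T}) W \<and> W \<times> V \<subseteq> U}" for V :: "'s set"
  have J: "openin (top_of_set {0..T}) (J V)" for V unfolding J_def by blast
  have "U = (\<Union>V\<in>\<B>. J V \<times> V)"
  proof
    show "(\<Union>V\<in>\<B>. J V \<times> V) \<subseteq> U" unfolding J_def by blast
    show "U \<subseteq> (\<Union>V\<in>\<B>. J V \<times> V)"
    proof clarify
      fix r x assume rx: "(r, x) \<in> U"
      then obtain W G where W: "openin (top_of_set {0..T}) W" "openin euclidean G" "r \<in> W" "x \<in> G" "W \<times> G \<subseteq> U"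
        using openin_prod_topology_alt[THEN iffD1, OF U, THEN spec, THEN spec, THEN mp, OF rx] by blast
      then obtain V where V: "V \<in> \<B>" "x \<in> V" "V \<subseteq> G" using \<B>(3) by blast
      then have "W \<times> V \<subseteq> U" using W by blast
      with W V show "(r, x) \<in> (\<Union>V\<in>\<B>. J V \<times> V)" unfolding J_def by blast
    qed
  qed
  also have "\<dots> \<in> sets (time_space T)"
  proof (intro sets.countable_UN'' \<B>(1) pair_measureI)
    fix V assume V: "V \<in> \<B>"
    show "V \<in> sets borel" using \<B>(2)[OF V] by simp
    obtain G where "open G" "J V = {0..T} \<inter> G" using J[of V] unfolding openin_open by blast
    then show "J V \<in> sets (restrict_space borel {0..T})"
      by (auto simp: sets_restrict_space_iff)
  qed
  finally show ?thesis .
qed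

lemma measurable_time_space_borel:
  "(\<lambda>p. p) \<in> measurable (time_space T) (ST T)"
proof (rule measurable_borel_ofI)
  fix U assume "openin (pm_topology d ({0..T} \<times> UNIV)) U"
  then have "U \<in> sets (time_space T)" by (intro open_time_space coarser)
  then show "(\<lambda>p. p) -` U \<inter> space (time_space T) \<in> sets (time_space T)"
    unfolding vimage_ident by (rule sets.Int) (rule sets.top)
next
  show "p \<in> topspace (pm_topology d ({0..T} \<times> UNIV))" if "p \<in> space (time_space T)" for p
    using that by (simp add: space_pair_measure space_restrict_space topspace_pm_topology)
qed

lemma borel_measurable_time_space:
  assumes "u \<in> borel_measurable (ST T)"
  shows "u \<in> borel_measurable (time_space T)"
  by (rule measurable_compose[OF measurable_time_space_borel assms])

lemma openin_spacetime_sub: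
  assumes "t \<le> T" "openin (pm_topology d ({0..t} \<times> UNIV)) U"
  obtains V where "openin (pm_topology d ({0..T} \<times> UNIV)) V" "U = V \<inter> {0..t} \<times> UNIV"
proof -
  have "{0..t} \<times> (UNIV::'s set) \<subseteq> {0..T} \<times> UNIV" using assms(1) by auto
  from openin_pm_topology_subset[OF pseudometric this assms(2)] that show thesis by blast
qed

text \<open>Transition probabilities to time t are measurable on the strip [0, t] x S. Sets open in
  the strip are traces of open sets of the whole space-time, so Borel maps on the strip restrict to
  Borel maps on any set C of starting points inside it.\<close>

lemma measurable_spacetime_borel_sub:
  assumes "t \<le> T" "C \<subseteq> {0..t} \<times> UNIV"
  shows "(\<lambda>p. p) \<in> measurable (restrict_space (ST T) C) (ST t)"
proof (rule measurable_borel_ofI)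
  fix U assume "openin (pm_topology d ({0..t} \<times> UNIV)) U"
  then obtain V where V: "openin (pm_topology d ({0..T} \<times> UNIV)) V" "U = V \<inter> {0..t} \<times> UNIV"
    using openin_spacetime_sub assms by metis
  have "V \<in> sets (ST T)"
    unfolding sets_borel_of using V(1) by (intro sigma_sets.Basic CollectI)
  then have "C \<inter> V \<in> sets (restrict_space (ST T) C)"
    unfolding sets_restrict_space by (rule imageI)
  moreover have "V \<subseteq> {0..T} \<times> UNIV"
    using openin_subset[OF V(1)] unfolding topspace_pm_topology .
  then have "(\<lambda>p. p) -` U \<inter> (C \<inter> {0..T} \<times> UNIV) = C \<inter> V"
    unfolding V(2) using assms(2) by blast
  ultimately show "(\<lambda>p. p) -` U \<inter> space (restrict_space (ST T) C)
      \<in> sets (restrict_space (ST T) C)"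
    unfolding space_restrict_space space_spacetime_borel by simp
next
  show "p \<in> topspace (pm_topology d ({0..t} \<times> UNIV))"
    if "p \<in> space (restrict_space (ST T) C)" for p
    using that assms(2) unfolding topspace_pm_topology space_restrict_space by blast
qed

lemma measurable_slice:
  assumes "s \<in> {0..t}" "t \<le> T"
  shows "(\<lambda>y. (s, y)) \<in> measurable borel (ST t)"
proof (rule measurable_borel_ofI)
  fix U assume "openin (pm_topology d ({0..t} \<times> UNIV)) U"
  then obtain V where V: "openin (pm_topology d ({0..T} \<times> UNIV)) V" "U = V \<inter> {0..t} \<times> UNIV"
    using openin_spacetime_sub assms by metis
  have "V \<in> sets (time_space T)" using V by (intro open_time_space coarser)
  then have "Pair s -` V \<in> sets borel" by (rule sets_Pair1)
  moreover have "Pair s -` U = Pair s -` V" unfolding V(2) using assms(1) by blast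
  ultimately show "Pair s -` U \<inter> space borel \<in> sets borel" by simp
qed (use assms(1) in \<open>simp add: topspace_pm_topology\<close>)

text \<open>Balls of d are open in the product topology, so a ball around (t, x) contains a
  neighbourhood of x in the slice at t; \<open>R t t\<close> admits the fixed time. This supplies
  continuous test functions on S for the Feller property.\<close>

lemma relatively_continuous_imp_continuous_slice:
  assumes u: "relatively_continuous R d {0..T} u" and t: "t \<in> {0..T}" "R t t"
  shows "continuous_on UNIV (\<lambda>y. u (t, y))"
  unfolding continuous_on_def
proof (intro ballI tendstoI)
  fix x and e :: real assume "e > 0"
  with u t(1) have "\<exists>\<delta>>0. \<forall>s\<in>{0..T}. \<forall>y. R t s \<and> d (s, y) (t, x) < \<delta> \<longrightarrow> \<bar>u (s, y) - u (t, x)\<bar> < e"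
    unfolding relatively_continuous_def by blast
  then obtain \<delta> where \<delta>: "\<delta> > 0"
      "\<And>y. d (t, y) (t, x) < \<delta> \<Longrightarrow> \<bar>u (t, y) - u (t, x)\<bar> < e"
    using t by blast
  define U where "U = {q \<in> {0..T} \<times> UNIV. d q (t, x) < \<delta>}"
  have "openin (pm_topology d ({0..T} \<times> UNIV)) U"
    unfolding openin_pm_topology
  proof (intro conjI ballI)
    fix p assume p: "p \<in> U"
    show "\<exists>\<epsilon>>0. \<forall>q\<in>{0..T} \<times> UNIV. d p q < \<epsilon> \<longrightarrow> q \<in> U"
    proof (intro exI[of _ "\<delta> - d p (t, x)"] conjI ballI impI)
      fix q assume q: "q \<in> {0..T} \<times> (UNIV :: 's set)" "d p q < \<delta> - d p (t, x)"
      have "d q (t, x) \<le> d q p + d p (t, x)" "d q p = d p q"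
        using pseudometric q(1) p t unfolding pseudometric_on_def U_def by blast+
      then show "q \<in> U" using q by (auto simp: U_def)
    qed (use p in \<open>auto simp: U_def\<close>)
  qed (auto simp: U_def)
  then have oU: "openin (prod_topology (top_of_set {0..T}) euclidean) U" by (rule coarser)
  have tx: "(t, x) \<in> U" using t \<delta> by (auto simp: U_def dist_self)
  obtain W V where "openin (euclidean :: 's topology) V" "t \<in> W" "x \<in> V" "W \<times> V \<subseteq> U"
    using openin_prod_topology_alt[THEN iffD1, OF oU, THEN spec, THEN spec, THEN mp, OF tx] by blast
  then have V: "open V" "x \<in> V" "\<And>y. y \<in> V \<Longrightarrow> (t, y) \<in> U" by auto
  have "dist (u (t, y)) (u (t, x)) < e" if "y \<in> V" for y
  proof -
    have "d (t, y) (t, x) < \<delta>" using V(3)[OF that] unfolding U_def by blast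
    then show ?thesis unfolding dist_real_def by (rule \<delta>(2))
  qed
  with V(1,2) show "\<forall>\<^sub>F y in at x within UNIV. dist (u (t, y)) (u (t, x)) < e"
    unfolding eventually_at_topological by (intro exI[of _ V] conjI ballI impI)
qed

end

section \<open>The Markov property\<close>

lemma space_sigma_process: "space (sigma_process \<Omega> X I) = \<Omega>"
  unfolding sigma_process_def by (rule space_measure_of) blast

lemma sets_sigma_process:
  "sets (sigma_process \<Omega> X I) = sigma_sets \<Omega> {X q -` B \<inter> \<Omega> | q B. q \<in> I \<and> B \<in> sets borel}"
  unfolding sigma_process_def by (rule sets_measure_of) blast

lemma sets_sigma_process_subset:
  assumes "\<And>q. q \<in> I \<Longrightarrow> X q \<in> measurable N borel" and "space N = \<Omega>"
  shows "sets (sigma_process \<Omega> X I) \<subseteq> sets N"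
  unfolding sets_sigma_process assms(2)[symmetric]
  by (intro sets.sigma_sets_subset subsetI, clarify) (rule measurable_sets[OF assms(1)])

lemma measurable_sigma_process:
  assumes "q \<in> I" shows "X q \<in> measurable (sigma_process \<Omega> X I) borel"
  by (rule measurableI) (use assms in \<open>auto simp: space_sigma_process sets_sigma_process\<close>)

lemma measurable_mono_sets:
  assumes "f \<in> measurable M1 N" "space M1 = space M2" "sets M1 \<subseteq> sets M2"
  shows "f \<in> measurable M2 N"
  using assms unfolding measurable_def by auto

lemma (in spacetime_setting) measurable_spacetime_borel_mono:
  assumes "s \<le> t"
  shows "(\<lambda>p. p) \<in> measurable (ST s) (ST t)"
proof (rule measurable_borel_ofI)
  fix U assume U: "openin (pm_topology d ({0..t} \<times> UNIV)) U"
  have "openin (pm_topology d ({0..s} \<times> UNIV)) (U \<inter> {0..s} \<times> UNIV)"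
    unfolding openin_pm_topology
  proof (intro conjI ballI)
    fix p assume "p \<in> U \<inter> {0..s} \<times> UNIV"
    then have "p \<in> U" by blast
    then obtain \<epsilon> where "\<epsilon> > 0" "\<forall>q\<in>{0..t} \<times> UNIV. d p q < \<epsilon> \<longrightarrow> q \<in> U"
      using U unfolding openin_pm_topology by blast
    moreover have "{0..s} \<times> (UNIV::'s set) \<subseteq> {0..t} \<times> UNIV" using assms by auto
    ultimately show "\<exists>\<epsilon>>0. \<forall>q\<in>{0..s} \<times> UNIV. d p q < \<epsilon> \<longrightarrow> q \<in> U \<inter> {0..s} \<times> UNIV"
      by blast
  qed blast
  then show "(\<lambda>p. p) -` U \<inter> space (ST s) \<in> sets (ST s)"
    unfolding vimage_ident space_spacetime_borel sets_borel_of by (intro sigma_sets.Basic CollectI)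
next
  show "p \<in> topspace (pm_topology d ({0..t} \<times> UNIV))" if "p \<in> space (ST s)" for p
    using that assms by (auto simp: space_spacetime_borel topspace_pm_topology)
qed

context progressive_markov
begin

abbreviation future :: "real \<Rightarrow> 'w measure" where
  "future t \<equiv> sigma_process (space M) X {t..T}"

lemma prob_space_P: "r \<in> {0..T} \<Longrightarrow> prob_space (P (r, x))"
  and sets_P: "r \<in> {0..T} \<Longrightarrow> sets (P (r, x)) = sets M"
  using prob by simp_all

lemma finite_measure_P: "r \<in> {0..T} \<Longrightarrow> finite_measure (P (r, x))"
  using prob_space_P prob_space.axioms(1) by blast

lemma space_P: "r \<in> {0..T} \<Longrightarrow> space (P (r, x)) = space M"
  using sets_P by (rule sets_eq_imp_space_eq)

lemma measure_P_space: "r \<in> {0..T} \<Longrightarrow> measure (P (r, x)) (space M) = 1"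
  using prob_space.prob_space[OF prob_space_P] space_P by metis

lemma space_F: "t \<in> {0..T} \<Longrightarrow> space (F t) = space M"
  and sets_F: "t \<in> {0..T} \<Longrightarrow> sets (F t) \<subseteq> sets M"
  using subalg by (auto simp: subalgebra_def)

lemma measurable_F_mono:
  assumes "0 \<le> s" "s \<le> t" "t \<le> T" "f \<in> measurable (F s) N"
  shows "f \<in> measurable (F t) N"
  by (rule measurable_mono_sets[OF assms(4)]) (use assms space_F filtration_mono in simp_all)

lemma measurable_F_P:
  assumes "t \<in> {0..T}" "r \<in> {0..T}" "f \<in> measurable (F t) N"
  shows "f \<in> measurable (P (r, x)) N"
  by (rule measurable_mono_sets[OF assms(3)]) (use assms space_F space_P sets_P sets_F in simp_all)

lemma measurable_X: "t \<in> {0..T} \<Longrightarrow> X t \<in> measurable M borel"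
  by (rule measurable_mono_sets[OF adapted]) (simp_all add: space_F sets_F)

lemma sets_future: "t \<in> {0..T} \<Longrightarrow> sets (future t) \<subseteq> sets M"
  by (rule sets_sigma_process_subset) (auto intro: measurable_X)

section \<open>Extension of measurability and Markov identities from pi-systems\<close>

lemma subalgebra_P:
  assumes "r \<in> {0..T}" "space N = space M" "sets N \<subseteq> sets M"
  shows "subalgebra (P (r, x)) N"
  using assms by (simp add: subalgebra_def space_P sets_P)

text \<open>A pi-system argument for kernels. \<open>P p\<close> is restricted to N because
  measurability in p is supplied only for events that generate N, not for all of M.\<close>

lemma kernel_extension:
  assumes s: "s \<in> {0..T}"
    and N: "space N = space M" "sets N \<subseteq> sets M" "sets N = sigma_sets (space M) E"
    and E: "Int_stable E" "space M \<in> E"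
    and base: "\<And>C. C \<in> E \<Longrightarrow> (\<lambda>p. measure (P p) C) \<in> borel_measurable (ST s)"
  shows "(\<lambda>p. restr_to_subalg (P p) N) \<in> measurable (ST s) (subprob_algebra N)"
proof -
  have EN: "C \<in> sets N" if "C \<in> E" for C unfolding N(3) using that by (rule sigma_sets.Basic)
  have sub: "subalgebra (P p) N" and ps: "prob_space (P p)" if "p \<in> space (ST s)" for p
    using that s N subalgebra_P prob_space_P by (auto simp: space_spacetime_borel)
  have *: "(\<lambda>p. emeasure (restr_to_subalg (P p) N) C) \<in> borel_measurable (ST s)"
    if C: "C \<in> E" for C
  proof -
    have "emeasure (restr_to_subalg (P p) N) C = ennreal (measure (P p) C)"
      if "p \<in> space (ST s)" for p
    proof -
      interpret prob_space "P p" by (rule ps[OF that])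
      show ?thesis using emeasure_restr_to_subalg[OF sub[OF that] EN[OF C]] by (simp add: emeasure_eq_measure)
    qed
    moreover have "(\<lambda>p. ennreal (measure (P p) C)) \<in> borel_measurable (ST s)"
      using base[OF C] by measurable
    ultimately show ?thesis by (simp cong: measurable_cong)
  qed
  show ?thesis
  proof (rule measurable_subprob_algebra_generated[OF N(3) E(1)])
    show "E \<subseteq> Pow (space M)" using EN N sets.sets_into_space by blast
    show "subprob_space (restr_to_subalg (P p) N)" if "p \<in> space (ST s)" for p
      using prob_space_restr_to_subalg[OF sub ps] that by (simp add: prob_space_imp_subprob_space)
    show "sets (restr_to_subalg (P p) N) = sets N" if "p \<in> space (ST s)" for p
      using sets_restr_to_subalg[OF sub] that by simp
  qed (use * E in simp_all)
qed

lemma expectation_extension: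
  assumes s: "s \<in> {0..T}"
    and N: "space N = space M" "sets N \<subseteq> sets M" "sets N = sigma_sets (space M) E"
    and E: "Int_stable E" "space M \<in> E"
    and base: "\<And>C. C \<in> E \<Longrightarrow> (\<lambda>p. measure (P p) C) \<in> borel_measurable (ST s)"
    and f: "f \<in> borel_measurable N"
  shows "(\<lambda>p. integral\<^sup>L (P p) f :: real) \<in> borel_measurable (ST s)"
proof -
  have "(\<lambda>p. integral\<^sup>L (restr_to_subalg (P p) N) f) \<in> borel_measurable (ST s)"
    by (rule measurable_compose[OF kernel_extension[OF s N E base] integral_measurable_subprob_algebra[OF f]])
  moreover have "integral\<^sup>L (restr_to_subalg (P p) N) f = integral\<^sup>L (P p) f"
    if "p \<in> space (ST s)" for p
    by (rule integral_subalgebra2[OF _ f])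
       (use that s N subalgebra_P in \<open>auto simp: space_spacetime_borel\<close>)
  ultimately show ?thesis by (simp cong: measurable_cong)
qed

lemma bmeas_P:
  assumes N: "space N = space M" "sets N \<subseteq> sets M" and f: "f \<in> bmeas N"
    and r: "r \<in> {0..T}"
  shows "f \<in> bmeas (P (r, x))"
proof -
  obtain K where K: "\<And>w. w \<in> space N \<Longrightarrow> \<bar>f w\<bar> \<le> K"
    using bmeas_bound[OF f] by blast
  show ?thesis
  proof (rule bmeasI)
    show "f \<in> borel_measurable (P (r, x))"
      by (rule measurable_mono_sets[OF bmeasD[OF f]]) (simp_all only: N space_P[OF r] sets_P[OF r])
    show "\<bar>f w\<bar> \<le> K" if "w \<in> space (P (r, x))" for w
      using that by (intro K) (simp only: N space_P[OF r])
  qed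
qed

text \<open>For Z >= 0 both sides are, as functions of f, integrals against finite measures on N:
  the measure with density Z, and its mixture of the kernels \<open>P (s, X s w)\<close>. These
  agree on the pi-system, hence on N. Testing against bounded Z avoids conditional expectations of
  general functionals.\<close>

lemma markov_extension:
  assumes s: "s \<in> {0..T}"
    and N: "space N = space M" "sets N \<subseteq> sets M" "sets N = sigma_sets (space M) E"
    and E: "Int_stable E" "space M \<in> E"
    and base: "\<And>C. C \<in> E \<Longrightarrow> (\<lambda>p. measure (P p) C) \<in> borel_measurable (ST s)"
    and base_markov: "\<And>C Z. C \<in> E \<Longrightarrow> Z \<in> bmeas (F s) \<Longrightarrow>
      (\<integral>w. Z w * indicator C w \<partial>P (r, x)) = (\<integral>w. Z w * measure (P (s, X s w)) C \<partial>P (r, x))"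
    and r: "0 \<le> r" "r \<le> s"
    and Z: "Z \<in> bmeas (F s)" and f: "f \<in> bmeas N"
  shows "(\<integral>w. Z w * f w \<partial>P (r, x)) = (\<integral>w. Z w * integral\<^sup>L (P (s, X s w)) f \<partial>P (r, x))"
proof -
  have r': "r \<in> {0..T}" using r s by auto
  interpret prob_space "P (r, x)" by (rule prob_space_P[OF r'])
  note sp = space_P[OF r', of x] and st = sets_P[OF r', of x]
  have Xs: "X s \<in> measurable (P (r, x)) borel" by (rule measurable_F_P[OF s r' adapted[OF s]])
  have slice: "(\<lambda>w. (s, X s w)) \<in> measurable (P (r, x)) (ST s)"
    by (rule measurable_compose[OF Xs measurable_slice]) (use s in auto)
  have EN: "C \<in> sets N" if "C \<in> E" for C unfolding N(3) using that by (rule sigma_sets.Basic)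
  have EP: "E \<subseteq> Pow (space M)" using EN sets.sets_into_space unfolding N(1)[symmetric] by blast
  note fP = bmeas_P[OF N(1,2)]
  have ZP: "Z \<in> bmeas (P (r, x))" if Z: "Z \<in> bmeas (F s)" for Z
    by (rule bmeas_P[OF space_F[OF s] sets_F[OF s] Z r'])
  define h where "h f w = integral\<^sup>L (P (s, X s w)) f" for w and f :: "'w \<Rightarrow> real"
  have h: "h f \<in> bmeas (P (r, x))" if f: "f \<in> bmeas N" for f
  proof -
    obtain K where K: "K \<ge> 0" "\<And>w. w \<in> space N \<Longrightarrow> \<bar>f w\<bar> \<le> K"
      using bmeas_bound[OF f] by blast
    show ?thesis
    proof (rule bmeasI)
      show "h f \<in> borel_measurable (P (r, x))"
        unfolding h_def
        by (rule measurable_compose[OF slice expectation_extension[OF s N E base bmeasD[OF f]]])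
      show "\<bar>h f w\<bar> \<le> K" for w
      proof -
        interpret Q: prob_space "P (s, X s w)" by (rule prob_space_P[OF s])
        have "\<bar>h f w\<bar> \<le> K * measure (P (s, X s w)) (space (P (s, X s w)))"
          unfolding h_def by (rule Q.abs_integral_le[OF bmeasD[OF fP[OF f s]]])
            (simp only: space_P[OF s] N(1)[symmetric] K(2))
        then show ?thesis by (simp only: Q.prob_space mult_1_right)
      qed
    qed
  qed
  have main: "(\<integral>w. Z w * f w \<partial>P (r, x)) = (\<integral>w. Z w * h f w \<partial>P (r, x))"
    if Z: "Z \<in> bmeas (F s)" and Z0: "\<And>w. w \<in> space M \<Longrightarrow> 0 \<le> Z w"
      and f: "f \<in> bmeas N" and f0: "\<And>w. w \<in> space M \<Longrightarrow> 0 \<le> f w" for Z f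
  proof -
    note ZP = ZP[OF Z]
    have Zm: "Z \<in> borel_measurable (P (r, x))" by (rule bmeasD[OF ZP])
    have fm: "(\<lambda>w. ennreal (f w)) \<in> borel_measurable N" using bmeasD[OF f] by measurable
    have h0: "0 \<le> h f w" for w unfolding h_def by (intro integral_nonneg_AE AE_I2) (simp add: f0 space_P[OF s])
    have dens: "(\<integral>\<^sup>+w. ennreal (k w) \<partial>density (P (r, x)) Z) = ennreal (\<integral>w. Z w * k w \<partial>P (r, x))"
      if k: "k \<in> bmeas (P (r, x))" "\<And>w. w \<in> space M \<Longrightarrow> 0 \<le> k w" for k
    proof -
      have "(\<integral>\<^sup>+w. ennreal (k w) \<partial>density (P (r, x)) Z) = (\<integral>\<^sup>+w. ennreal (Z w) * ennreal (k w) \<partial>P (r, x))"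
        using bmeasD[OF k(1)] Zm by (intro nn_integral_density) simp_all
      also have "\<dots> = (\<integral>\<^sup>+w. ennreal (Z w * k w) \<partial>P (r, x))"
        by (intro nn_integral_cong) (simp add: ennreal_mult Z0 k(2) sp)
      also have "\<dots> = ennreal (\<integral>w. Z w * k w \<partial>P (r, x))"
        by (intro nn_integral_eq_integral integrable_bmeas bmeas_mult ZP k(1) AE_I2)
          (simp add: Z0 k(2) sp)
      finally show ?thesis .
    qed
    define D where "D = density (P (r, x)) Z"
    have spD: "space D = space M" and stD: "sets D = sets M" by (simp_all add: D_def sp st)
    have subD: "subalgebra D N" using N(1,2) by (simp add: subalgebra_def spD stD)
    define \<kappa> where "\<kappa> w = restr_to_subalg (P (s, X s w)) N" for w
    have subs: "subalgebra (P (s, X s w)) N" for w by (rule subalgebra_P[OF s N(1,2)])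
    have "\<kappa> \<in> measurable (P (r, x)) (subprob_algebra N)"
      unfolding \<kappa>_def by (rule measurable_compose[OF slice kernel_extension[OF s N E base]])
    then have \<kappa>: "\<kappa> \<in> measurable D (subprob_algebra N)" by (simp add: D_def)
    have ne: "space D \<noteq> {}" using not_empty by (simp add: D_def)
    have emD: "emeasure D C = ennreal (\<integral>w. Z w * indicator C w \<partial>P (r, x))" if "C \<in> sets M" for C
    proof -
      have "emeasure D C = (\<integral>\<^sup>+w. ennreal (indicator C w) \<partial>D)"
        using that stD by (simp add: ennreal_indicator)
      also have "\<dots> = ennreal (\<integral>w. Z w * indicator C w \<partial>P (r, x))"
        unfolding D_def using that st by (intro dens bmeas_indicator) simp_all
      finally show ?thesis .
    qed
    have rD: "emeasure (restr_to_subalg D N) C = ennreal (\<integral>w. Z w * indicator C w \<partial>P (r, x))" if "C \<in> E" for C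
      unfolding emeasure_restr_to_subalg[OF subD EN[OF that]]
      by (rule emD[OF subsetD[OF N(2) EN[OF that]]])
    \<comment> \<open>Uniqueness of measures: both sides agree on E by \<open>base_markov\<close>,
      and the whole space lies in E with finite mass.\<close>
    have "restr_to_subalg D N = D \<bind> \<kappa>"
    proof (rule measure_eqI_generator_eq[OF E(1) EP, of _ _ "\<lambda>_. space M"])
      show "sets (restr_to_subalg D N) = sigma_sets (space M) E"
        unfolding sets_restr_to_subalg[OF subD] by (rule N(3))
      show "sets (D \<bind> \<kappa>) = sigma_sets (space M) E"
        by (rule trans[OF sets_bind N(3)]) (use sets_kernel[OF \<kappa>] ne in auto)
      show "range (\<lambda>_. space M) \<subseteq> E" "(\<Union>i. space M) = space M" using E(2) by simp_all
      show "emeasure (restr_to_subalg D N) (space M) \<noteq> \<infinity>" using rD[OF E(2)] by simp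
      show "emeasure (restr_to_subalg D N) C = emeasure (D \<bind> \<kappa>) C" if C: "C \<in> E" for C
      proof -
        have mC: "(\<lambda>w. measure (P (s, X s w)) C) \<in> bmeas (P (r, x))"
        proof (rule bmeasI[where K=1])
          show "(\<lambda>w. measure (P (s, X s w)) C) \<in> borel_measurable (P (r, x))"
            by (rule measurable_compose[OF slice base[OF C]])
          show "\<bar>measure (P (s, X s w)) C\<bar> \<le> 1" for w
            using prob_space.prob_le_1[OF prob_space_P[OF s]] by simp
        qed
        have "emeasure (D \<bind> \<kappa>) C = (\<integral>\<^sup>+w. emeasure (\<kappa> w) C \<partial>D)"
          by (rule emeasure_bind[OF ne \<kappa> EN[OF C]])
        also have "\<dots> = (\<integral>\<^sup>+w. ennreal (measure (P (s, X s w)) C) \<partial>D)"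
        proof (rule nn_integral_cong)
          fix w
          interpret Q: prob_space "P (s, X s w)" by (rule prob_space_P[OF s])
          show "emeasure (\<kappa> w) C = ennreal (measure (P (s, X s w)) C)"
            unfolding \<kappa>_def emeasure_restr_to_subalg[OF subs EN[OF C]] by (rule Q.emeasure_eq_measure)
        qed
        also have "\<dots> = ennreal (\<integral>w. Z w * measure (P (s, X s w)) C \<partial>P (r, x))"
          unfolding D_def by (rule dens[OF mC measure_nonneg])
        finally show ?thesis using rD[OF C] base_markov[OF C Z] by simp
      qed
    qed
    then have "(\<integral>\<^sup>+w. f w \<partial>restr_to_subalg D N) = (\<integral>\<^sup>+w. f w \<partial>(D \<bind> \<kappa>))" by simp
    also have "(\<integral>\<^sup>+w. f w \<partial>(D \<bind> \<kappa>)) = (\<integral>\<^sup>+w. (\<integral>\<^sup>+w'. f w' \<partial>\<kappa> w) \<partial>D)"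
      by (rule nn_integral_bind[OF fm \<kappa>])
    also have "\<dots> = (\<integral>\<^sup>+w. ennreal (h f w) \<partial>D)"
    proof (rule nn_integral_cong)
      fix w
      interpret Q: prob_space "P (s, X s w)" by (rule prob_space_P[OF s])
      show "(\<integral>\<^sup>+w'. f w' \<partial>\<kappa> w) = ennreal (h f w)"
        unfolding \<kappa>_def nn_integral_subalgebra2[OF subs fm] h_def
        by (intro nn_integral_eq_integral Q.integrable_bmeas fP[OF f s] AE_I2) (simp add: f0 space_P[OF s])
    qed
    also have "\<dots> = ennreal (\<integral>w. Z w * h f w \<partial>P (r, x))"
      unfolding D_def by (rule dens[OF h[OF f] h0])
    also have "(\<integral>\<^sup>+w. f w \<partial>restr_to_subalg D N) = ennreal (\<integral>w. Z w * f w \<partial>P (r, x))"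
      unfolding nn_integral_subalgebra2[OF subD fm] unfolding D_def by (rule dens[OF fP[OF f r'] f0])
    finally have "ennreal (\<integral>w. Z w * f w \<partial>P (r, x)) = ennreal (\<integral>w. Z w * h f w \<partial>P (r, x))" .
    moreover have "0 \<le> (\<integral>w. Z w * f w \<partial>P (r, x))" "0 \<le> (\<integral>w. Z w * h f w \<partial>P (r, x))"
      by (intro integral_nonneg_AE AE_I2 mult_nonneg_nonneg Z0 f0 h0; simp add: sp)+
    ultimately show ?thesis by simp
  qed
  obtain L where L: "\<And>w. w \<in> space (F s) \<Longrightarrow> \<bar>Z w\<bar> \<le> L"
    using bmeas_bound[OF Z] by blast
  obtain K where K: "\<And>w. w \<in> space N \<Longrightarrow> \<bar>f w\<bar> \<le> K"
    using bmeas_bound[OF f] by blast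
  \<comment> \<open>Adding the bounds K and L makes f and Z nonnegative, so that \<open>main\<close>
    applies.\<close>
  let ?f = "\<lambda>w. f w + K"
  have f': "?f \<in> bmeas N" and Z': "(\<lambda>w. Z w + L) \<in> bmeas (F s)"
    by (intro bmeas_add bmeas_const f Z)+
  have f'0: "0 \<le> f w + K" and Z'0: "0 \<le> Z w + L" if "w \<in> space M" for w
    using K[of w] L[of w] that by (simp_all add: N(1) space_F[OF s])
  have hf': "h ?f w = h f w + K" for w
  proof -
    interpret Q: prob_space "P (s, X s w)" by (rule prob_space_P[OF s])
    show ?thesis
      unfolding h_def using Q.integrable_bmeas[OF fP[OF f s]] by (simp add: Q.prob_space)
  qed
  have lin: "(\<integral>w. (Z w + L) * (k w + K) \<partial>P (r, x)) =
      (\<integral>w. Z w * k w \<partial>P (r, x)) + (\<integral>w. K * Z w \<partial>P (r, x)) + L * (\<integral>w. k w + K \<partial>P (r, x))"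
    if k: "k \<in> bmeas (P (r, x))" for k
  proof -
    have "(\<integral>w. (Z w + L) * (k w + K) \<partial>P (r, x)) = (\<integral>w. Z w * k w + K * Z w + L * (k w + K) \<partial>P (r, x))"
      by (intro Bochner_Integration.integral_cong) (simp_all add: algebra_simps)
    then show ?thesis
      using ZP[OF Z] k
      by (simp add: integrable_bmeas bmeas_mult bmeas_add bmeas_const)
  qed
  \<comment> \<open>The case Z = 1. It shows that the extra terms created by the shift agree on both
    sides.\<close>
  have "(\<integral>w. f w + K \<partial>P (r, x)) = (\<integral>w. h f w + K \<partial>P (r, x))"
    using main[OF bmeas_const[of 1] _ f' f'0] by (simp add: hf')
  with main[OF Z' Z'0 f' f'0] have "(\<integral>w. Z w * f w \<partial>P (r, x)) = (\<integral>w. Z w * h f w \<partial>P (r, x))"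
    unfolding hf' lin[OF fP[OF f r']] lin[OF h[OF f]] by simp
  then show ?thesis unfolding h_def .
qed

text \<open>The pi-system consists of the events {X_t in B}. For these the base claims are the
  assumed measurability of the transition probabilities and the assumed Markov property, the latter
  with conditional probabilities tested against Z.\<close>

lemma
  assumes t: "t \<in> {0..T}" and \<phi>: "\<phi> \<in> bmeas borel"
  shows expectation_one_time:
      "s \<in> {0..t} \<Longrightarrow> (\<lambda>p. \<integral>w. \<phi> (X t w) \<partial>P p) \<in> borel_measurable (ST s)"
    and markov_one_time:
      "\<lbrakk>0 \<le> r; r \<le> s; s \<le> t; Z \<in> bmeas (F s)\<rbrakk> \<Longrightarrow>
        (\<integral>w. Z w * \<phi> (X t w) \<partial>P (r, x)) =
        (\<integral>w. Z w * (\<integral>w'. \<phi> (X t w') \<partial>P (s, X s w)) \<partial>P (r, x))"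
proof -
  define E where "E = {X t -` B \<inter> space M | B. B \<in> sets borel}"
  define N where "N = sigma_process (space M) X {t}"
  have N: "space N = space M" "sets N \<subseteq> sets M" "sets N = sigma_sets (space M) E"
  proof -
    show "space N = space M" unfolding N_def by (rule space_sigma_process)
    show "sets N \<subseteq> sets M"
      unfolding N_def by (rule sets_sigma_process_subset[OF measurable_X]) (use t in simp_all)
    show "sets N = sigma_sets (space M) E" unfolding N_def sets_sigma_process E_def by simp
  qed
  have E: "Int_stable E" "space M \<in> E"
  proof -
    show "Int_stable E"
    proof (rule Int_stableI)
      fix A B assume "A \<in> E" "B \<in> E"
      then obtain a b where "a \<in> sets borel" "b \<in> sets borel" "A = X t -` a \<inter> space M" "B = X t -` b \<inter> space M"
        unfolding E_def by blast
      then have "A \<inter> B = X t -` (a \<inter> b) \<inter> space M" "a \<inter> b \<in> sets borel" by auto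
      then show "A \<inter> B \<in> E" unfolding E_def by blast
    qed
    show "space M \<in> E" unfolding E_def by (intro CollectI exI[of _ UNIV]) simp
  qed
  have E_cases: thesis
    if C: "C \<in> E" and *: "\<And>B. B \<in> sets borel \<Longrightarrow> C = {w \<in> space M. X t w \<in> B} \<Longrightarrow> thesis" for C thesis
  proof -
    from C obtain B where B: "B \<in> sets borel" "C = X t -` B \<inter> space M" unfolding E_def by blast
    have "C = {w \<in> space M. X t w \<in> B}" unfolding B(2) by blast
    with B(1) show thesis by (rule *)
  qed
  have base: "(\<lambda>p. measure (P p) C) \<in> borel_measurable (ST s)"
    if C: "C \<in> E" and s: "s \<le> t" for C s
  proof -
    obtain B where "B \<in> sets borel" "C = {w \<in> space M. X t w \<in> B}" by (rule E_cases[OF C])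
    then have "(\<lambda>p. measure (P p) C) \<in> borel_measurable (ST t)"
      using transition[OF t] by simp
    from measurable_compose[OF measurable_spacetime_borel_mono[OF s] this] show ?thesis .
  qed
  have X: "X t \<in> measurable N borel" unfolding N_def by (rule measurable_sigma_process) simp
  have f: "(\<lambda>w. \<phi> (X t w)) \<in> bmeas N"
    by (rule bmeas_compose[OF \<phi> X])
  {
    assume s: "s \<in> {0..t}"
    then have "s \<in> {0..T}" using t by auto
    from expectation_extension[OF this N E base bmeasD[OF f]] s
    show "(\<lambda>p. \<integral>w. \<phi> (X t w) \<partial>P p) \<in> borel_measurable (ST s)" by simp
  next
    assume rs: "0 \<le> r" "r \<le> s" "s \<le> t" and Z: "Z \<in> bmeas (F s)"
    then have s: "s \<in> {0..T}" and r: "r \<in> {0..T}" using t by auto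
    have "(\<integral>w. Z w * indicator C w \<partial>P (r, x)) = (\<integral>w. Z w * measure (P (s, X s w)) C \<partial>P (r, x))"
      if C: "C \<in> E" and Z: "Z \<in> bmeas (F s)" for C Z
    proof -
      obtain B where B: "B \<in> sets borel" "C = {w \<in> space M. X t w \<in> B}" by (rule E_cases[OF C])
      have CM: "C \<in> sets M" using C N(2,3) by auto
      interpret p: prob_space "P (r, x)" by (rule prob_space_P[OF r])
      interpret c: finite_measure_subalgebra "P (r, x)" "F s"
        by unfold_locales (rule subalgebra_P[OF r space_F[OF s] sets_F[OF s]])
      have ZP: "Z \<in> bmeas (P (r, x))"
        by (rule bmeas_P[OF space_F[OF s] sets_F[OF s] Z r])
      have i: "(\<lambda>w. indicator C w :: real) \<in> bmeas (P (r, x))"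
        using CM sets_P[OF r] by (intro bmeas_indicator) simp
      have ae: "AE w in P (r, x). real_cond_exp (P (r, x)) (F s) (indicator C) w = measure (P (s, X s w)) C"
        unfolding B(2) using rs t B(1) by (intro markov) auto
      have m: "(\<lambda>w. measure (P (s, X s w)) C) \<in> borel_measurable (P (r, x))"
        using measurable_compose[OF measurable_compose[OF measurable_F_P[OF s r adapted[OF s]] measurable_slice] base[OF C rs(3)]] s
        by auto
      \<comment> \<open>Z is measurable for \<open>F s\<close>, so under the integral the indicator
        may be exchanged for its conditional expectation.\<close>
      have "(\<integral>w. Z w * indicator C w \<partial>P (r, x)) =
          (\<integral>w. Z w * real_cond_exp (P (r, x)) (F s) (indicator C) w \<partial>P (r, x))"
        by (rule c.real_cond_exp_intg(2)[symmetric])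
          (use bmeasD[OF Z] bmeasD[OF i] in
            \<open>auto intro!: p.integrable_bmeas bmeas_mult ZP i\<close>)
      also have "\<dots> = (\<integral>w. Z w * measure (P (s, X s w)) C \<partial>P (r, x))"
      proof (rule integral_cong_AE)
        show "AE w in P (r, x). Z w * real_cond_exp (P (r, x)) (F s) (indicator C) w = Z w * measure (P (s, X s w)) C"
          using ae by eventually_elim simp
        show "(\<lambda>w. Z w * real_cond_exp (P (r, x)) (F s) (indicator C) w) \<in> borel_measurable (P (r, x))"
          by (intro borel_measurable_times bmeasD[OF ZP] borel_measurable_cond_exp2)
        show "(\<lambda>w. Z w * measure (P (s, X s w)) C) \<in> borel_measurable (P (r, x))"
          by (intro borel_measurable_times bmeasD[OF ZP] m)
      qed
      finally show ?thesis .
    qed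
    from markov_extension[OF s N E base[OF _ rs(3)] this rs(1,2) Z f]
    show "(\<integral>w. Z w * \<phi> (X t w) \<partial>P (r, x)) =
        (\<integral>w. Z w * (\<integral>w'. \<phi> (X t w') \<partial>P (s, X s w)) \<partial>P (r, x))" .
  }
qed

section \<open>From one later time to the whole future: cylinder events\<close>

definition cylinder :: "(real \<times> 's set) list \<Rightarrow> 'w set" where
  "cylinder L = {w \<in> space M. \<forall>(q, B)\<in>set L. X q w \<in> B}"

text \<open>Times are sorted so that the head is the earliest: conditioning there leaves a cylinder
  of later times. Repeated times are allowed, so two lists can be merged by sorting their
  concatenation.\<close>

definition cylinder_lists :: "real \<Rightarrow> (real \<times> 's set) list set" where
  "cylinder_lists s = {L. sorted (map fst L) \<and> (\<forall>(q, B)\<in>set L. s \<le> q \<and> q \<le> T \<and> B \<in> sets borel)}"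

lemma cylinder_Nil: "cylinder [] = space M"
  by (simp add: cylinder_def)

lemma indicator_cylinder_Cons:
  "indicator (cylinder ((q, B) # L)) w = (indicator B (X q w) * indicator (cylinder L) w :: real)"
  by (auto simp: cylinder_def indicator_def)

lemma sets_cylinder:
  assumes "L \<in> cylinder_lists s" "s \<in> {0..T}" shows "cylinder L \<in> sets (future s)"
  using assms
proof (induction L)
  case Nil
  show ?case using sets.top[of "future s"] by (simp add: cylinder_Nil space_sigma_process)
next
  case (Cons a L)
  obtain q B where a: "a = (q, B)" by force
  with Cons.prems have q: "q \<in> {s..T}" "B \<in> sets borel" "L \<in> cylinder_lists s"
    by (auto simp: cylinder_lists_def)
  have "cylinder (a # L) = (X q -` B \<inter> space (future s)) \<inter> cylinder L"
    by (auto simp: a cylinder_def space_sigma_process)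
  also have "\<dots> \<in> sets (future s)"
    by (rule sets.Int[OF measurable_sets[OF measurable_sigma_process[OF q(1)] q(2)] Cons.IH[OF q(3) Cons.prems(2)]])
  finally show ?case .
qed

text \<open>Conditioning at the earliest time q replaces the tail of the list by its probability
  h(X_q) from (q, X_q), which leaves the function 1_B h of X_q alone. Both claims go through the
  induction together: measurability of h makes this function admissible, and the Markov identity at
  q performs the replacement. The time s varies because the induction hypothesis is used at
  q.\<close>

lemma cylinder_base:
  assumes "L \<in> cylinder_lists s" "s \<in> {0..T}"
  shows "(\<lambda>p. measure (P p) (cylinder L)) \<in> borel_measurable (ST s) \<and>
    (\<forall>r x Z. 0 \<le> r \<longrightarrow> r \<le> s \<longrightarrow> Z \<in> bmeas (F s) \<longrightarrow>
      (\<integral>w. Z w * indicator (cylinder L) w \<partial>P (r, x)) =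
      (\<integral>w. Z w * measure (P (s, X s w)) (cylinder L) \<partial>P (r, x)))"
  using assms
proof (induction L arbitrary: s)
  case Nil
  have "(\<lambda>p. measure (P p) (cylinder [])) \<in> borel_measurable (ST s)"
    using Nil by (subst measurable_cong[where g="\<lambda>_. 1"])
      (auto simp: cylinder_Nil space_spacetime_borel measure_P_space)
  moreover have "(\<integral>w. Z w * indicator (cylinder []) w \<partial>P (r, x)) =
      (\<integral>w. Z w * measure (P (s, X s w)) (cylinder []) \<partial>P (r, x))" if "0 \<le> r" "r \<le> s" for r x Z
    using that Nil(2) by (intro Bochner_Integration.integral_cong)
      (simp_all add: cylinder_Nil space_P measure_P_space)
  ultimately show ?case by blast
next
  case (Cons a L)
  obtain q B where a: "a = (q, B)" by force
  with Cons.prems have q: "s \<le> q" "q \<in> {0..T}" "B \<in> sets borel" "L \<in> cylinder_lists q"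
    by (auto simp: cylinder_lists_def)
  note s = Cons.prems(2)
  note IH = Cons.IH[OF q(4,2)]
  define h where "h y = measure (P (q, y)) (cylinder L)" for y
  define \<phi> where "\<phi> y = indicator B y * h y" for y
  have h: "h \<in> bmeas borel"
  proof (rule bmeasI[where K=1])
    show "h \<in> borel_measurable borel"
      unfolding h_def by (rule measurable_compose[OF measurable_slice conjunct1[OF IH]]) (use q in auto)
    show "\<bar>h y\<bar> \<le> 1" for y
      unfolding h_def using prob_space.prob_le_1[OF prob_space_P[OF q(2)]] by simp
  qed
  have \<phi>: "\<phi> \<in> bmeas borel"
    unfolding \<phi>_def by (intro bmeas_mult bmeas_indicator h q(3))
  have step: "(\<integral>w. Z w * indicator (cylinder (a # L)) w \<partial>P (r, x)) = (\<integral>w. Z w * \<phi> (X q w) \<partial>P (r, x))"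
    if r: "0 \<le> r" "r \<le> q" and Z: "Z \<in> bmeas (F q)" for r x Z
  proof -
    \<comment> \<open>The indicator of {X_q in B} belongs to the past of q and joins Z
      there.\<close>
    have "(\<lambda>w. indicator B (X q w) :: real) \<in> bmeas (F q)"
      by (rule bmeas_compose[OF bmeas_indicator[OF q(3)] adapted[OF q(2)]])
    from conjunct2[OF IH, rule_format, OF r bmeas_mult[OF Z this]]
    show ?thesis by (simp add: a indicator_cylinder_Cons \<phi>_def h_def mult.assoc)
  qed
  have eq: "measure (P p) (cylinder (a # L)) = (\<integral>w. \<phi> (X q w) \<partial>P p)"
    if p: "p \<in> {0..s} \<times> UNIV" for p
  proof -
    have p': "fst p \<in> {0..T}" "0 \<le> fst p" "fst p \<le> q" using p q s by auto
    have "cylinder (a # L) \<in> sets M" using sets_cylinder[OF Cons.prems] sets_future[OF s] by blast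
    then have "measure (P p) (cylinder (a # L)) = (\<integral>w. 1 * indicator (cylinder (a # L)) w \<partial>P (fst p, snd p))"
      using sets_P[OF p'(1), of "snd p"] by simp
    also have "\<dots> = (\<integral>w. \<phi> (X q w) \<partial>P p)"
      by (subst step[OF p'(2,3) bmeas_const]) simp
    finally show ?thesis .
  qed
  have "(\<lambda>p. measure (P p) (cylinder (a # L))) \<in> borel_measurable (ST s)"
    using expectation_one_time[OF q(2) \<phi>, of s] q(1) s eq
    by (subst measurable_cong[where g="\<lambda>p. \<integral>w. \<phi> (X q w) \<partial>P p"]) (simp_all add: space_spacetime_borel)
  moreover have "(\<integral>w. Z w * indicator (cylinder (a # L)) w \<partial>P (r, x)) =
      (\<integral>w. Z w * measure (P (s, X s w)) (cylinder (a # L)) \<partial>P (r, x))"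
    if r: "0 \<le> r" "r \<le> s" and Z: "Z \<in> bmeas (F s)" for r x Z
  proof -
    have Zq: "Z \<in> bmeas (F q)"
      using Z measurable_F_mono[of s q Z borel] s q space_F by (simp add: bmeas_def)
    have "(\<integral>w. Z w * indicator (cylinder (a # L)) w \<partial>P (r, x)) = (\<integral>w. Z w * \<phi> (X q w) \<partial>P (r, x))"
      using r q(1) by (intro step Zq) auto
    also have "\<dots> = (\<integral>w. Z w * (\<integral>w'. \<phi> (X q w') \<partial>P (s, X s w)) \<partial>P (r, x))"
      by (rule markov_one_time[OF q(2) \<phi> r q(1) Z])
    finally show ?thesis using eq s by simp
  qed
  ultimately show ?case by blast
qed

text \<open>An intersection of two cylinders is the cylinder of the concatenated lists, and sorting
  by time restores the required order.\<close>

lemma future_generator: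
  assumes s: "s \<in> {0..T}"
  defines "E \<equiv> cylinder ` cylinder_lists s"
  shows "sets (future s) = sigma_sets (space M) E" "Int_stable E" "space M \<in> E"
proof -
  show "space M \<in> E"
    unfolding E_def by (rule image_eqI[where x="[]"]) (simp_all add: cylinder_Nil cylinder_lists_def)
  show "Int_stable E"
  proof (rule Int_stableI)
    fix A B assume "A \<in> E" "B \<in> E"
    then obtain K L where K: "K \<in> cylinder_lists s" "A = cylinder K" and L: "L \<in> cylinder_lists s" "B = cylinder L"
      unfolding E_def by blast
    have "A \<inter> B = cylinder (sort_key fst (K @ L))"
      unfolding K(2) L(2) cylinder_def by auto
    moreover have "sort_key fst (K @ L) \<in> cylinder_lists s"
      using K(1) L(1) unfolding cylinder_lists_def by auto
    ultimately show "A \<inter> B \<in> E" unfolding E_def by (rule image_eqI)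
  qed
  show "sets (future s) = sigma_sets (space M) E"
  proof
    show "sigma_sets (space M) E \<subseteq> sets (future s)"
      using sets.sigma_sets_subset[of E "future s"] sets_cylinder[OF _ s]
      unfolding space_sigma_process E_def by blast
    show "sets (future s) \<subseteq> sigma_sets (space M) E"
      unfolding sets_sigma_process
    proof (rule sigma_sets_mono, clarify)
      fix q and B :: "'s set" assume q: "q \<in> {s..T}" and B: "B \<in> sets borel"
      have "X q -` B \<inter> space M = cylinder [(q, B)]" unfolding cylinder_def by auto
      moreover have "[(q, B)] \<in> cylinder_lists s" using q B by (simp add: cylinder_lists_def)
      ultimately have "X q -` B \<inter> space M \<in> E" unfolding E_def by (rule image_eqI)
      then show "X q -` B \<inter> space M \<in> sigma_sets (space M) E" by (rule sigma_sets.Basic)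
    qed
  qed
qed

lemma expectation_future:
  assumes s: "s \<in> {0..T}" and f: "f \<in> borel_measurable (future s)"
  shows "(\<lambda>p. integral\<^sup>L (P p) f :: real) \<in> borel_measurable (ST s)"
  by (rule expectation_extension[OF s space_sigma_process sets_future[OF s] future_generator[OF s] _ f])
     (use cylinder_base[OF _ s] in blast)

text \<open>Cylinder events carry both base claims, so the extension reaches every bounded
  functional of the future. In later uses Z is 1, or b(s, X_s), or the latter times a discount
  factor.\<close>

lemma markov_future:
  assumes s: "s \<in> {0..T}" and r: "0 \<le> r" "r \<le> s"
    and Z: "Z \<in> bmeas (F s)" and f: "f \<in> bmeas (future s)"
  shows "(\<integral>w. Z w * f w \<partial>P (r, x)) = (\<integral>w. Z w * integral\<^sup>L (P (s, X s w)) f \<partial>P (r, x))"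
  by (rule markov_extension[OF s space_sigma_process sets_future[OF s] future_generator[OF s] _ _ r Z f])
     (use cylinder_base[OF _ s] r in blast)+

end

section \<open>Linear equations along a path\<close>

context diffuse_measure
begin

text \<open>Variation of constants for the backward equation dy = (\<alpha> + \<beta> y) d\<nu> with
  terminal value y(T) = c.\<close>

definition backward_solution :: "(real \<Rightarrow> real) \<Rightarrow> (real \<Rightarrow> real) \<Rightarrow> real \<Rightarrow> real \<Rightarrow> real" where
  "backward_solution \<beta> \<alpha> c r =
     exp (- (LINT s:{r..T}|\<nu>. \<beta> s)) * c - (LINT t:{r..T}|\<nu>. exp (- (LINT s:{r..t}|\<nu>. \<beta> s)) * \<alpha> t)"

lemma bmeas_exp_integral:
  assumes "\<beta> \<in> bmeas \<nu>"
  shows "(\<lambda>t. exp (LINT s:{r..t}|\<nu>. \<beta> s)) \<in> bmeas \<nu>"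
    and "(\<lambda>t. exp (- (LINT s:{r..t}|\<nu>. \<beta> s))) \<in> bmeas \<nu>"
  by (intro bmeas_exp bmeas_uminus bmeas_interval_integral1 assms)+

lemma exp_minus_interval_integral:
  assumes \<beta>: "\<beta> \<in> bmeas \<nu>" and t: "t \<in> {0..T}" "r \<le> t"
  shows "exp (- (LINT s:{r..t}|\<nu>. \<beta> s)) = 1 + (LINT s:{r..t}|\<nu>. - \<beta> s * exp (- (LINT q:{r..s}|\<nu>. \<beta> q)))"
proof -
  have *: "(LINT s:{r..t}|\<nu>. - \<beta> s) = - (LINT s:{r..t}|\<nu>. \<beta> s)" for t
    by (simp add: set_lebesgue_integral_def)
  show ?thesis using exp_interval_integral[OF bmeas_uminus[OF \<beta>] t] unfolding * .
qed

lemma backward_solution_T: "backward_solution \<beta> \<alpha> c T = c"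
  unfolding backward_solution_def interval_integral_empty[OF order_refl] by simp

context
  fixes \<beta> \<alpha> :: "real \<Rightarrow> real"
  assumes \<beta>: "\<beta> \<in> bmeas \<nu>" and \<alpha>: "\<alpha> \<in> bmeas \<nu>"
begin

lemma bmeas_discounted:
  "(\<lambda>t. exp (- (LINT s:{r..t}|\<nu>. \<beta> s)) * \<alpha> t) \<in> bmeas \<nu>"
  by (intro bmeas_mult bmeas_exp_integral \<alpha> \<beta>)

text \<open>Anchoring the integrals at 0 leaves r only as an upper limit. In this form measurability
  in r and the product rule become accessible.\<close>

lemma backward_solution_forward:
  assumes r: "r \<in> {0..T}"
  shows "backward_solution \<beta> \<alpha> c r = exp (LINT s:{0..r}|\<nu>. \<beta> s) *
    (backward_solution \<beta> \<alpha> c 0 + (LINT t:{0..r}|\<nu>. exp (- (LINT s:{0..t}|\<nu>. \<beta> s)) * \<alpha> t))"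
proof -
  define B where "B t = (LINT s:{0..t}|\<nu>. \<beta> s)" for t
  have B: "(LINT s:{r..t}|\<nu>. \<beta> s) = B t - B r" if "r \<le> t" "t \<le> T" for t
    unfolding B_def using interval_integral_split[OF \<beta>, of 0 r t] that r by simp
  have "(LINT t:{r..T}|\<nu>. exp (- (LINT s:{r..t}|\<nu>. \<beta> s)) * \<alpha> t) =
      (LINT t:{r..T}|\<nu>. exp (B r) * (exp (- B t) * \<alpha> t))"
    by (rule interval_integral_cong) (simp add: B exp_diff exp_minus field_simps)
  also have "\<dots> = exp (B r) * (LINT t:{r..T}|\<nu>. exp (- B t) * \<alpha> t)"
    by (rule set_integral_mult_right)
  also have "(LINT t:{r..T}|\<nu>. exp (- B t) * \<alpha> t) =
      (LINT t:{0..T}|\<nu>. exp (- B t) * \<alpha> t) - (LINT t:{0..r}|\<nu>. exp (- B t) * \<alpha> t)"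
    using interval_integral_split[OF bmeas_discounted[of 0], of 0 r T] r by (simp add: B_def)
  finally have I: "(LINT t:{r..T}|\<nu>. exp (- (LINT s:{r..t}|\<nu>. \<beta> s)) * \<alpha> t) =
    exp (B r) * ((LINT t:{0..T}|\<nu>. exp (- B t) * \<alpha> t) - (LINT t:{0..r}|\<nu>. exp (- B t) * \<alpha> t))" .
  have "(LINT s:{r..T}|\<nu>. \<beta> s) = B T - B r" using B[of T] r by simp
  then have e: "exp (- (LINT s:{r..T}|\<nu>. \<beta> s)) = exp (B r) * exp (- B T)"
    by (simp flip: exp_add)
  show ?thesis
    unfolding backward_solution_def I e B_def[symmetric] by (simp add: algebra_simps)
qed

lemma bmeas_backward_solution: "backward_solution \<beta> \<alpha> c \<in> bmeas \<nu>"
proof -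
  have "(\<lambda>r. exp (LINT s:{0..r}|\<nu>. \<beta> s) *
      (backward_solution \<beta> \<alpha> c 0 + (LINT t:{0..r}|\<nu>. exp (- (LINT s:{0..t}|\<nu>. \<beta> s)) * \<alpha> t))) \<in> bmeas \<nu>"
    by (intro bmeas_mult bmeas_add bmeas_const
        bmeas_exp_integral \<beta> bmeas_interval_integral1 \<alpha>)
  then show ?thesis
    by (subst bmeas_cong[OF backward_solution_forward]) (simp_all add: space_nu)
qed

text \<open>The forward form is the exponential of the running integral of \<beta> times a running
  integral. The product rule gives the equation from 0, and subtracting two instances gives it from
  r.\<close>

lemma backward_solution_equation:
  assumes r: "0 \<le> r" "r \<le> t" "t \<le> T"
  shows "backward_solution \<beta> \<alpha> c t = backward_solution \<beta> \<alpha> c r +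
    (LINT s:{r..t}|\<nu>. \<alpha> s + \<beta> s * backward_solution \<beta> \<alpha> c s)"
proof -
  let ?y = "backward_solution \<beta> \<alpha> c"
  have bm: "(\<lambda>s. \<alpha> s + \<beta> s * ?y s) \<in> bmeas \<nu>"
    by (intro bmeas_mult bmeas_add \<beta> \<alpha> bmeas_backward_solution)
  have eq: "?y t = ?y 0 + (LINT s:{0..t}|\<nu>. \<alpha> s + \<beta> s * ?y s)" if t: "t \<in> {0..T}" for t
  proof -
    define A where "A s = exp (LINT q:{0..s}|\<nu>. \<beta> q)" for s
    define B where "B s = ?y 0 + (LINT q:{0..s}|\<nu>. exp (- (LINT z:{0..q}|\<nu>. \<beta> z)) * \<alpha> q)" for s
    have y: "?y s = A s * B s" if "s \<in> {0..T}" for s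
      unfolding A_def B_def by (rule backward_solution_forward[OF that])
    have "A t * B t = 1 * ?y 0 + (LINT s:{0..t}|\<nu>. \<beta> s * A s * B s + (exp (- (LINT q:{0..s}|\<nu>. \<beta> q)) * \<alpha> s) * A s)"
    proof (rule interval_integral_product)
      show "(\<lambda>s. \<beta> s * A s) \<in> bmeas \<nu>"
        unfolding A_def by (intro bmeas_mult \<beta> bmeas_exp_integral)
      show "A s = 1 + (LINT q:{0..s}|\<nu>. \<beta> q * A q)" if "s \<in> {0..T}" "0 \<le> s" for s
        unfolding A_def by (rule exp_interval_integral[OF \<beta> that])
    qed (use t in \<open>simp_all add: B_def bmeas_discounted\<close>)
    also have "(LINT s:{0..t}|\<nu>. \<beta> s * A s * B s + (exp (- (LINT q:{0..s}|\<nu>. \<beta> q)) * \<alpha> s) * A s) =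
        (LINT s:{0..t}|\<nu>. \<alpha> s + \<beta> s * ?y s)"
      by (rule interval_integral_cong) (simp add: y A_def exp_minus)
    finally show ?thesis using y[OF t] by simp
  qed
  show ?thesis
    using eq[of t] eq[of r] interval_integral_split[OF bm, of 0 r t] r by simp
qed

text \<open>y - l solves the same linear equation with source \<alpha> + \<beta> l and terminal
  value c - l; in the formula this holds because \<beta> times the discount factor integrates to 1
  minus the final discount factor. With l an end point of D the new source has a sign.\<close>

lemma backward_solution_shift:
  assumes r: "r \<in> {0..T}"
  shows "backward_solution \<beta> \<alpha> c r - l = exp (- (LINT s:{r..T}|\<nu>. \<beta> s)) * (c - l) -
    (LINT t:{r..T}|\<nu>. exp (- (LINT s:{r..t}|\<nu>. \<beta> s)) * (\<alpha> t + \<beta> t * l))"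
proof -
  define A where "A t = exp (- (LINT s:{r..t}|\<nu>. \<beta> s))" for t
  have A: "A \<in> bmeas \<nu>" unfolding A_def by (rule bmeas_exp_integral[OF \<beta>])
  have "(LINT t:{r..T}|\<nu>. A t * (\<alpha> t + \<beta> t * l)) = (LINT t:{r..T}|\<nu>. A t * \<alpha> t - l * (- \<beta> t * A t))"
    by (rule interval_integral_cong) (simp add: algebra_simps)
  also have "\<dots> = (LINT t:{r..T}|\<nu>. A t * \<alpha> t) - l * (LINT t:{r..T}|\<nu>. - \<beta> t * A t)"
    by (subst interval_integral_diff)
      (intro bmeas_mult bmeas_const bmeas_uminus A \<alpha> \<beta>
        arg_cong2[where f="(-)"] refl set_integral_mult_right)+
  also have "(LINT t:{r..T}|\<nu>. - \<beta> t * A t) = A T - 1"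
    using exp_minus_interval_integral[OF \<beta>, of T r] r unfolding A_def[symmetric] by simp
  finally show ?thesis
    unfolding backward_solution_def A_def[symmetric] by (simp add: algebra_simps)
qed

text \<open>After the shift by l the source is nonpositive and enters with a minus sign, so dropping
  its integral only decreases the value.\<close>

lemma backward_solution_ge:
  assumes r: "r \<in> {0..T}" and l: "AE s in \<nu>. \<alpha> s + \<beta> s * l \<le> 0"
  shows "exp (- (LINT s:{r..T}|\<nu>. \<beta> s)) * (c - l) \<le> backward_solution \<beta> \<alpha> c r - l"
proof -
  have "0 \<le> (\<integral>t. - (indicator {r..T} t *\<^sub>R (exp (- (LINT s:{r..t}|\<nu>. \<beta> s)) * (\<alpha> t + \<beta> t * l))) \<partial>\<nu>)"
  proof (rule integral_nonneg_AE)
    show "AE t in \<nu>. 0 \<le> - (indicator {r..T} t *\<^sub>R (exp (- (LINT s:{r..t}|\<nu>. \<beta> s)) * (\<alpha> t + \<beta> t * l)))"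
      using l by eventually_elim (simp add: indicator_def mult_nonneg_nonpos)
  qed
  then show ?thesis
    unfolding backward_solution_shift[OF r] by (simp add: set_lebesgue_integral_def)
qed

lemma backward_solution_le:
  assumes r: "r \<in> {0..T}" and l: "AE s in \<nu>. 0 \<le> \<alpha> s + \<beta> s * l"
  shows "backward_solution \<beta> \<alpha> c r - l \<le> exp (- (LINT s:{r..T}|\<nu>. \<beta> s)) * (c - l)"
proof -
  have "0 \<le> (\<integral>t. indicator {r..T} t *\<^sub>R (exp (- (LINT s:{r..t}|\<nu>. \<beta> s)) * (\<alpha> t + \<beta> t * l)) \<partial>\<nu>)"
  proof (rule integral_nonneg_AE)
    show "AE t in \<nu>. 0 \<le> indicator {r..T} t *\<^sub>R (exp (- (LINT s:{r..t}|\<nu>. \<beta> s)) * (\<alpha> t + \<beta> t * l))"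
      using l by eventually_elim (simp add: indicator_def)
  qed
  then show ?thesis
    unfolding backward_solution_shift[OF r] by (simp add: set_lebesgue_integral_def)
qed

text \<open>The inequalities at the end points keep the solution inside \<open>D\<close>. It can reach an end point only
  if \<open>c\<close> equals that end point, which then belongs to \<open>D\<close>.\<close>

lemma backward_solution_in_interval:
  assumes D: "is_interval D" and c: "c \<in> D" and r: "r \<in> {0..T}"
    and lower: "bdd_below D \<Longrightarrow> AE s in \<nu>. \<alpha> s + \<beta> s * Inf D \<le> 0"
    and upper: "bdd_above D \<Longrightarrow> AE s in \<nu>. 0 \<le> \<alpha> s + \<beta> s * Sup D"
  shows "backward_solution \<beta> \<alpha> c r \<in> D"
proof -
  define y where "y = backward_solution \<beta> \<alpha> c r"
  define A where "A = exp (- (LINT s:{r..T}|\<nu>. \<beta> s))"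
  have A: "0 < A" by (simp add: A_def)
  have "\<exists>w\<in>D. w \<le> y"
  proof (rule ccontr)
    assume "\<not> (\<exists>w\<in>D. w \<le> y)"
    then have lt: "\<And>w. w \<in> D \<Longrightarrow> y < w" by force
    then have bd: "bdd_below D" by (meson bdd_belowI less_imp_le)
    have "y \<le> Inf D" using c lt by (intro cInf_greatest) (auto intro: less_imp_le)
    moreover have lc: "Inf D \<le> c" using c bd by (rule cInf_lower)
    moreover have ge: "A * (c - Inf D) \<le> y - Inf D"
      unfolding A_def y_def by (rule backward_solution_ge[OF r lower[OF bd]])
    moreover have "0 \<le> A * (c - Inf D)" using A lc by simp
    ultimately have "y = Inf D" "A * (c - Inf D) \<le> 0" by linarith+
    then have "c \<le> y" using A by (simp add: mult_le_0_iff)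
    with lt[OF c] show False by simp
  qed
  moreover have "\<exists>w\<in>D. y \<le> w"
  proof (rule ccontr)
    assume "\<not> (\<exists>w\<in>D. y \<le> w)"
    then have lt: "\<And>w. w \<in> D \<Longrightarrow> w < y" by force
    then have bd: "bdd_above D" by (meson bdd_aboveI less_imp_le)
    have "Sup D \<le> y" using c lt by (intro cSup_least) (auto intro: less_imp_le)
    moreover have lc: "c \<le> Sup D" using c bd by (rule cSup_upper)
    moreover have "y - Sup D \<le> A * (c - Sup D)"
      unfolding A_def y_def by (rule backward_solution_le[OF r upper[OF bd]])
    moreover have "A * (c - Sup D) \<le> 0" using A lc by (simp add: mult_le_0_iff)
    ultimately have "y = Sup D" "0 \<le> A * (c - Sup D)" by linarith+
    then have "y \<le> c" using A by (simp add: zero_le_mult_iff)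
    with lt[OF c] show False by simp
  qed
  ultimately show ?thesis using D unfolding is_interval_1 y_def by blast
qed

text \<open>The product rule for the discount factor and W. It is meant for \<gamma> = a + b u along
  a path, where W s has conditional expectation u(s, X_s), so that \<gamma> - \<beta> W averages to
  a.\<close>

lemma discounted_forward_integral:
  assumes r: "0 \<le> r" "r \<le> T" and \<gamma>: "\<gamma> \<in> bmeas \<nu>"
    and W: "\<And>s. s \<in> {0..T} \<Longrightarrow> r \<le> s \<Longrightarrow> W s = w + (LINT q:{r..s}|\<nu>. \<gamma> q)"
  shows "exp (- (LINT s:{r..T}|\<nu>. \<beta> s)) * W T =
    w + (LINT s:{r..T}|\<nu>. exp (- (LINT q:{r..s}|\<nu>. \<beta> q)) * (\<gamma> s - \<beta> s * W s))"
proof -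
  define A where "A s = exp (- (LINT q:{r..s}|\<nu>. \<beta> q))" for s
  have "A T * W T = 1 * w + (LINT s:{r..T}|\<nu>. (- \<beta> s * A s) * W s + \<gamma> s * A s)"
  proof (rule interval_integral_product[OF _ \<gamma> _ W])
    show "(\<lambda>s. - \<beta> s * A s) \<in> bmeas \<nu>"
      unfolding A_def by (intro bmeas_mult bmeas_uminus \<beta> bmeas_exp_integral)
    show "A s = 1 + (LINT q:{r..s}|\<nu>. - \<beta> q * A q)" if "s \<in> {0..T}" "r \<le> s" for s
      unfolding A_def by (rule exp_minus_interval_integral[OF \<beta> that])
  qed (use r in simp_all)
  also have "(LINT s:{r..T}|\<nu>. (- \<beta> s * A s) * W s + \<gamma> s * A s) = (LINT s:{r..T}|\<nu>. A s * (\<gamma> s - \<beta> s * W s))"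
    by (rule interval_integral_cong) (simp add: algebra_simps)
  finally show ?thesis unfolding A_def by simp
qed

end

end

section \<open>Linear equations along the Markov process\<close>

lemma bmeas_cong_sets:
  assumes "sets N1 = sets N2"
  shows "bmeas N1 = bmeas N2"
proof -
  have "(borel_measurable N1 :: ('a \<Rightarrow> real) set) = borel_measurable N2"
    by (rule measurable_cong_sets[OF assms refl])
  then show ?thesis
    unfolding bmeas_def sets_eq_imp_space_eq[OF assms] by simp
qed

lemma measurable_id_subset:
  "space N1 = space N2 \<Longrightarrow> sets N2 \<subseteq> sets N1 \<Longrightarrow> (\<lambda>x. x) \<in> measurable N1 N2"
  by (rule measurable_mono_sets[OF measurable_ident_sets[OF refl]]) simp_all

locale markov_diffuse = progressive_markov T d \<mu> M F X P + nu: diffuse_measure \<nu> T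
  for T :: real and d :: "real \<times> 's::topological_space \<Rightarrow> real \<times> 's \<Rightarrow> real" and \<mu> :: "real measure"
    and M :: "'w measure" and F :: "real \<Rightarrow> 'w measure" and X :: "real \<Rightarrow> 'w \<Rightarrow> 's"
    and P :: "real \<times> 's \<Rightarrow> 'w measure" and \<nu> :: "real measure"
begin

lemma measurable_snd_nu: "snd \<in> measurable (N \<Otimes>\<^sub>M \<nu>) (restrict_space borel {0..T})"
  using measurable_snd[of N \<nu>] measurable_cong_sets[OF refl nu.sets_nu, of "N \<Otimes>\<^sub>M \<nu>"] by simp

lemma measurable_snd_nu_borel: "snd \<in> borel_measurable (N \<Otimes>\<^sub>M \<nu>)"
  by (rule measurable_compose[OF measurable_snd nu.measurable_ident_nu])

lemma snd_space_nu: "z \<in> space (N \<Otimes>\<^sub>M \<nu>) \<Longrightarrow> snd z \<in> {0..T}"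
  by (auto simp: space_pair_measure nu.space_nu)

text \<open>Outside \<open>{r..T}\<close> the process is not measurable with respect to the future of \<open>r\<close>, hence the
  truncation of the time; under an integral over \<open>{r..T}\<close> it has no effect.\<close>

lemma process_future:
  assumes r: "r \<in> {0..T}"
  shows "(\<lambda>z. (snd z, X (max r (snd z)) (fst z))) \<in> measurable (future r \<Otimes>\<^sub>M \<nu>) (time_space T)"
proof (rule measurable_Pair[OF measurable_snd_nu])
  have "(\<lambda>z. max r (snd z)) \<in> measurable (future r \<Otimes>\<^sub>M \<nu>) (restrict_space borel {r..T})"
  proof (rule measurable_restrict_space2)
    show "(\<lambda>z. max r (snd z)) \<in> space (future r \<Otimes>\<^sub>M \<nu>) \<rightarrow> {r..T}"
      using r snd_space_nu by fastforce
    show "(\<lambda>z. max r (snd z)) \<in> borel_measurable (future r \<Otimes>\<^sub>M \<nu>)"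
      by (intro borel_measurable_max borel_measurable_const measurable_snd_nu_borel)
  qed
  from measurable_compose[OF measurable_Pair[OF this measurable_fst] progressive_backward[OF r]]
  show "(\<lambda>z. X (max r (snd z)) (fst z)) \<in> borel_measurable (future r \<Otimes>\<^sub>M \<nu>)" by simp
qed

text \<open>Truncating the time at t keeps the process a functional of the past of t; under an
  integral up to t the truncation has no effect.\<close>

lemma process_past:
  assumes t: "t \<in> {0..T}"
  shows "(\<lambda>z. (snd z, X (min t (snd z)) (fst z))) \<in> measurable (F t \<Otimes>\<^sub>M \<nu>) (time_space T)"
proof (rule measurable_Pair[OF measurable_snd_nu])
  have s: "(\<lambda>z. min t (snd z)) \<in> measurable (F t \<Otimes>\<^sub>M \<nu>) (restrict_space borel {0..t})"
  proof (rule measurable_restrict_space2)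
    show "(\<lambda>z. min t (snd z)) \<in> space (F t \<Otimes>\<^sub>M \<nu>) \<rightarrow> {0..t}"
      using t snd_space_nu by fastforce
    show "(\<lambda>z. min t (snd z)) \<in> borel_measurable (F t \<Otimes>\<^sub>M \<nu>)"
      by (intro borel_measurable_min borel_measurable_const measurable_snd_nu_borel)
  qed
  have "sets (sigma_process (space M) X {0..t}) \<subseteq> sets (F t)"
  proof (rule sets_sigma_process_subset)
    show "X q \<in> borel_measurable (F t)" if "q \<in> {0..t}" for q
      using that t by (intro measurable_F_mono[OF _ _ _ adapted]) auto
  qed (rule space_F[OF t])
  then have "(\<lambda>w. w) \<in> measurable (F t) (sigma_process (space M) X {0..t})"
    by (intro measurable_id_subset) (simp_all add: space_F[OF t] space_sigma_process)
  from measurable_compose[OF measurable_Pair[OF s measurable_compose[OF measurable_fst this]] progressive[OF t]]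
  show "(\<lambda>z. X (min t (snd z)) (fst z)) \<in> borel_measurable (F t \<Otimes>\<^sub>M \<nu>)" by simp
qed

lemma measurable_M_future: "t \<in> {0..T} \<Longrightarrow> (\<lambda>w. w) \<in> measurable M (future t)"
  by (intro measurable_id_subset sets_future) (simp_all add: space_sigma_process)

lemma zero_mem: "0 \<in> {0..T}" and T_mem: "T \<in> {0..T}"
  using T_pos by simp_all

lemma measurable_M_future_nu:
  "t \<in> {0..T} \<Longrightarrow> (\<lambda>z. (fst z, snd z)) \<in> measurable (M \<Otimes>\<^sub>M \<nu>) (future t \<Otimes>\<^sub>M \<nu>)"
  by (rule measurable_Pair[OF measurable_compose[OF measurable_fst measurable_M_future] measurable_snd])

lemma process_all:
  "(\<lambda>z. (snd z, X (snd z) (fst z))) \<in> measurable (M \<Otimes>\<^sub>M \<nu>) (time_space T)"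
proof -
  from measurable_compose[OF measurable_M_future_nu[OF zero_mem] process_future[OF zero_mem]]
  have *: "(\<lambda>z. (snd z, X (max 0 (snd z)) (fst z))) \<in> measurable (M \<Otimes>\<^sub>M \<nu>) (time_space T)" by simp
  show ?thesis
    by (rule measurable_cong[THEN iffD1, OF _ *]) (simp add: snd_space_nu[THEN atLeastAtMost_iff[THEN iffD1, THEN conjunct1]] max_absorb2)
qed

lemma sets_P_nu: "r \<in> {0..T} \<Longrightarrow> sets (P (r, x) \<Otimes>\<^sub>M N) = sets (M \<Otimes>\<^sub>M N)"
  by (intro sets_pair_measure_cong sets_P refl)

lemma bmeas_P_iff: "r \<in> {0..T} \<Longrightarrow> bmeas (P (r, x)) = bmeas M"
  by (intro bmeas_cong_sets sets_P)

lemma bmeas_F_P: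
  assumes "s \<in> {0..T}" "f \<in> bmeas (F s)" "r \<in> {0..T}"
  shows "f \<in> bmeas (P (r, x))"
  by (rule bmeas_P[OF space_F[OF assms(1)] sets_F[OF assms(1)] assms(2,3)])

lemma bmeas_future_P:
  assumes "s \<in> {0..T}" "f \<in> bmeas (future s)" "r \<in> {0..T}"
  shows "f \<in> bmeas (P (r, x))"
  by (rule bmeas_P[OF space_sigma_process sets_future[OF assms(1)] assms(2,3)])

lemma bmeas_F_M:
  assumes s: "s \<in> {0..T}" and f: "f \<in> bmeas (F s)" shows "f \<in> bmeas M"
  using bmeas_F_P[OF s f zero_mem] bmeas_P_iff[OF zero_mem] by blast

lemma bmeas_future_M:
  assumes s: "s \<in> {0..T}" and f: "f \<in> bmeas (future s)" shows "f \<in> bmeas M"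
  by (rule bmeas_compose[OF f measurable_M_future[OF s]])

lemma bmeas_section:
  assumes f: "f \<in> bmeas (N \<Otimes>\<^sub>M \<nu>)"
  shows "w \<in> space N \<Longrightarrow> (\<lambda>s. f (w, s)) \<in> bmeas \<nu>"
    and "s \<in> {0..T} \<Longrightarrow> (\<lambda>w. f (w, s)) \<in> bmeas N"
  by (auto intro!: bmeas_compose[OF f] measurable_Pair1' measurable_Pair2' simp: nu.space_nu)

lemma Fubini_interval:
  assumes f: "f \<in> bmeas (M \<Otimes>\<^sub>M \<nu>)" and r: "r \<in> {0..T}"
  shows "(\<integral>w. (LINT s:{l..t}|\<nu>. f (w, s)) \<partial>P (r, x)) = (LINT s:{l..t}|\<nu>. (\<integral>w. f (w, s) \<partial>P (r, x)))"
proof -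
  have "(\<lambda>z. indicator {l..t} (snd z) * f z) \<in> bmeas (P (r, x) \<Otimes>\<^sub>M \<nu>)"
    unfolding bmeas_cong_sets[OF sets_P_nu[OF r]]
    by (intro bmeas_mult f bmeas_compose[OF nu.bmeas_indicator_interval measurable_snd])
  from Fubini_bmeas[OF this finite_measure_P[OF r] nu.finite_measure_axioms]
  show ?thesis by (simp add: set_lebesgue_integral_def)
qed

lemma bmeas_expectation:
  assumes f: "f \<in> bmeas (M \<Otimes>\<^sub>M \<nu>)" and r: "r \<in> {0..T}"
  shows "(\<lambda>s. \<integral>w. f (w, s) \<partial>P (r, x)) \<in> bmeas \<nu>"
proof -
  have "(\<lambda>z. f (snd z, fst z)) \<in> bmeas (\<nu> \<Otimes>\<^sub>M M)"
    by (rule bmeas_compose[OF f]) simp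
  then have "(\<lambda>z. f (snd z, fst z)) \<in> bmeas (\<nu> \<Otimes>\<^sub>M P (r, x))"
    using bmeas_cong_sets[OF sets_pair_measure_cong[OF refl sets_P[OF r, of x], of \<nu>]] by blast
  from bmeas_integral[OF this finite_measure_P[OF r]] show ?thesis by simp
qed

section \<open>Measurability of integrals along the path\<close>

context
  fixes c :: "real \<times> 's \<Rightarrow> real"
  assumes c: "c \<in> bmeas (time_space T)"
begin

lemma bmeas_process: "(\<lambda>z. c (snd z, X (snd z) (fst z))) \<in> bmeas (M \<Otimes>\<^sub>M \<nu>)"
  by (rule bmeas_compose[OF c process_all])

lemma bmeas_path: "w \<in> space M \<Longrightarrow> (\<lambda>s. c (s, X s w)) \<in> bmeas \<nu>"
  using bmeas_section(1)[OF bmeas_process] by simp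

lemma bmeas_slice:
  assumes "s \<in> {0..T}" shows "(\<lambda>y. c (s, y)) \<in> bmeas borel"
  by (rule bmeas_compose[OF c measurable_Pair1']) (use assms in \<open>simp add: space_restrict_space\<close>)

lemma bmeas_at:
  assumes "s \<in> {0..T}" shows "(\<lambda>w. c (s, X s w)) \<in> bmeas (F s)"
  by (rule bmeas_compose[OF bmeas_slice[OF assms] adapted[OF assms]])

lemma bmeas_integral_future:
  assumes r: "r \<in> {0..T}"
  shows "(\<lambda>z. LINT s:{r..snd z}|\<nu>. c (s, X s (fst z))) \<in> bmeas (future r \<Otimes>\<^sub>M \<nu>)"
proof -
  have "(\<lambda>y. c (snd y, X (max r (snd y)) (fst (fst y)))) \<in> bmeas ((future r \<Otimes>\<^sub>M \<nu>) \<Otimes>\<^sub>M \<nu>)"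
    using bmeas_compose[OF bmeas_compose[OF c process_future[OF r]],
        of "\<lambda>y. (fst (fst y), snd y)" "(future r \<Otimes>\<^sub>M \<nu>) \<Otimes>\<^sub>M \<nu>"] by simp
  from nu.bmeas_interval_integral[OF this borel_measurable_const[of r] measurable_snd_nu_borel]
  have "(\<lambda>z. LINT s:{r..snd z}|\<nu>. c (s, X (max r s) (fst z))) \<in> bmeas (future r \<Otimes>\<^sub>M \<nu>)" by simp
  moreover have "(LINT s:{r..snd z}|\<nu>. c (s, X (max r s) (fst z))) = (LINT s:{r..snd z}|\<nu>. c (s, X s (fst z)))" for z
    by (rule nu.interval_integral_cong) (simp add: max_absorb2)
  ultimately show ?thesis by simp
qed

text \<open>This makes the discount factor between r and t a function of the past of t, so that it
  may enter the test variable Z of the Markov identity.\<close>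

lemma bmeas_integral_past:
  assumes t: "t \<in> {0..T}"
  shows "(\<lambda>w. LINT s:{r..t}|\<nu>. c (s, X s w)) \<in> bmeas (F t)"
proof -
  from nu.bmeas_interval_integral[OF bmeas_compose[OF c process_past[OF t]]
      borel_measurable_const[of r] borel_measurable_const[of t]]
  have "(\<lambda>w. LINT s:{r..t}|\<nu>. c (s, X (min t s) w)) \<in> bmeas (F t)" by simp
  moreover have "(LINT s:{r..t}|\<nu>. c (s, X (min t s) w)) = (LINT s:{r..t}|\<nu>. c (s, X s w))" for w
    by (rule nu.interval_integral_cong) (simp add: min_absorb2)
  ultimately show ?thesis by simp
qed

lemma bmeas_integral_future_T:
  assumes r: "r \<in> {0..T}"
  shows "(\<lambda>w. LINT s:{r..T}|\<nu>. c (s, X s w)) \<in> bmeas (future r)"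
  using bmeas_section(2)[OF bmeas_integral_future[OF r] T_mem] by simp

end

end

text \<open>The coefficients are measurable for the product sigma-algebra, the class that survives
  rescaling by a function of time.\<close>

locale linear_problem = markov_diffuse T d \<mu> M F X P \<nu>
  for T :: real and d :: "real \<times> 's::topological_space \<Rightarrow> real \<times> 's \<Rightarrow> real" and \<mu> :: "real measure"
    and M :: "'w measure" and F :: "real \<Rightarrow> 'w measure" and X :: "real \<Rightarrow> 'w \<Rightarrow> 's"
    and P :: "real \<times> 's \<Rightarrow> 'w measure" and \<nu> :: "real measure" +
  fixes a b :: "real \<times> 's \<Rightarrow> real" and g :: "'s \<Rightarrow> real"
  assumes a: "a \<in> bmeas (time_space T)"
    and b: "b \<in> bmeas (time_space T)"
    and g: "g \<in> bmeas borel"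
begin

abbreviation source :: "(real \<times> 's \<Rightarrow> real) \<Rightarrow> real \<times> 's \<Rightarrow> real" where
  "source v p \<equiv> a p + b p * v p"

definition V :: "real \<Rightarrow> 'w \<Rightarrow> real" where
  "V r w = nu.backward_solution (\<lambda>s. b (s, X s w)) (\<lambda>s. a (s, X s w)) (g (X T w)) r"

definition value_function :: "real \<times> 's \<Rightarrow> real" where
  "value_function p = (\<integral>w. V (fst p) w \<partial>P p)"

lemma bmeas_terminal:
  assumes r: "r \<in> {0..T}" shows "(\<lambda>w. g (X T w)) \<in> bmeas (future r)"
  by (rule bmeas_compose[OF g measurable_sigma_process]) (use r in simp)

text \<open>The upper limit stays free in order to have joint measurability in the path and the
  time; the inner integral is of the same kind, with its own upper limit as the integration variable
  of the outer one.\<close>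

lemma bmeas_discounted_source:
  assumes r: "r \<in> {0..T}"
  shows "(\<lambda>z. LINT t:{r..snd z}|\<nu>. exp (- (LINT s:{r..t}|\<nu>. b (s, X s (fst z)))) * a (t, X t (fst z)))
    \<in> bmeas (future r \<Otimes>\<^sub>M \<nu>)"
proof -
  have "(\<lambda>z. exp (- (LINT s:{r..snd z}|\<nu>. b (s, X s (fst z)))) * a (snd z, X (max r (snd z)) (fst z)))
      \<in> bmeas (future r \<Otimes>\<^sub>M \<nu>)"
    by (intro bmeas_mult bmeas_exp bmeas_uminus
        bmeas_integral_future[OF b r] bmeas_compose[OF a process_future[OF r]])
  from bmeas_compose[OF this, of "\<lambda>y. (fst (fst y), snd y)" "(future r \<Otimes>\<^sub>M \<nu>) \<Otimes>\<^sub>M \<nu>"]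
  have "(\<lambda>y. exp (- (LINT s:{r..snd y}|\<nu>. b (s, X s (fst (fst y))))) * a (snd y, X (max r (snd y)) (fst (fst y))))
      \<in> bmeas ((future r \<Otimes>\<^sub>M \<nu>) \<Otimes>\<^sub>M \<nu>)" by simp
  from nu.bmeas_interval_integral[OF this borel_measurable_const[of r] measurable_snd_nu_borel]
  have "(\<lambda>z. LINT t:{r..snd z}|\<nu>. exp (- (LINT s:{r..t}|\<nu>. b (s, X s (fst z)))) * a (t, X (max r t) (fst z)))
      \<in> bmeas (future r \<Otimes>\<^sub>M \<nu>)" by simp
  moreover have "(LINT t:{r..snd z}|\<nu>. exp (- (LINT s:{r..t}|\<nu>. b (s, X s (fst z)))) * a (t, X (max r t) (fst z))) =
      (LINT t:{r..snd z}|\<nu>. exp (- (LINT s:{r..t}|\<nu>. b (s, X s (fst z)))) * a (t, X t (fst z)))" for z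
    by (rule nu.interval_integral_cong) (simp add: max_absorb2)
  ultimately show ?thesis by simp
qed

lemma bmeas_V:
  assumes r: "r \<in> {0..T}" shows "V r \<in> bmeas (future r)"
  unfolding V_def[abs_def] nu.backward_solution_def
  using bmeas_section(2)[OF bmeas_discounted_source[OF r] T_mem]
  by (intro bmeas_diff bmeas_mult bmeas_exp bmeas_uminus
      bmeas_integral_future_T[OF b r] bmeas_terminal[OF r]) simp

lemma V_equation:
  assumes w: "w \<in> space M" and r: "0 \<le> r" "r \<le> t" "t \<le> T"
  shows "V t w = V r w + (LINT s:{r..t}|\<nu>. a (s, X s w) + b (s, X s w) * V s w)"
  unfolding V_def
  by (rule nu.backward_solution_equation[OF bmeas_path[OF b w] bmeas_path[OF a w] r])

text \<open>In \<open>V r\<close> the time r is a lower limit of integration. The forward form from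
  0 turns it into an upper limit, for which joint measurability with the path is known.\<close>

lemma bmeas_V_joint: "(\<lambda>z. V (snd z) (fst z)) \<in> bmeas (M \<Otimes>\<^sub>M \<nu>)"
proof -
  let ?E = "\<lambda>z. exp (LINT s:{0..snd z}|\<nu>. b (s, X s (fst z))) *
     (V 0 (fst z) + (LINT t:{0..snd z}|\<nu>. exp (- (LINT s:{0..t}|\<nu>. b (s, X s (fst z)))) * a (t, X t (fst z))))"
  have "?E \<in> bmeas (future 0 \<Otimes>\<^sub>M \<nu>)"
    by (intro bmeas_mult bmeas_add bmeas_exp
        bmeas_integral_future[OF b zero_mem] bmeas_discounted_source[OF zero_mem]
        bmeas_compose[OF bmeas_V[OF zero_mem] measurable_fst])
  from bmeas_compose[OF this measurable_M_future_nu[OF zero_mem]]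
  have "?E \<in> bmeas (M \<Otimes>\<^sub>M \<nu>)" by simp
  moreover have "V (snd z) (fst z) = ?E z" if "z \<in> space (M \<Otimes>\<^sub>M \<nu>)" for z
  proof -
    have "fst z \<in> space M" using that by (auto simp: space_pair_measure)
    then show ?thesis
      unfolding V_def
      by (intro nu.backward_solution_forward bmeas_path b a snd_space_nu[OF that])
  qed
  ultimately show ?thesis by (subst bmeas_cong[of _ _ ?E]) auto
qed

lemma V_markov:
  assumes r: "0 \<le> r" "r \<le> s" "s \<le> T" and Z: "Z \<in> bmeas (F s)"
  shows "(\<integral>w. Z w * V s w \<partial>P (r, x)) = (\<integral>w. Z w * value_function (s, X s w) \<partial>P (r, x))"
  unfolding value_function_def fst_conv
  by (rule markov_future[OF _ r(1,2) Z bmeas_V]) (use r in simp_all)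

text \<open>Measurability of u is a hypothesis here, because that of the value function is obtained
  separately from time continuity of d. Fubini brings the expectation to a fixed time s, where the
  Markov identity can act.\<close>

lemma value_function_equation:
  assumes u: "u \<in> bmeas (time_space T)"
    and eq: "\<And>s y. s \<in> {0..T} \<Longrightarrow> u (s, y) = value_function (s, y)"
    and r: "0 \<le> r" "r \<le> t" "t \<le> T"
  shows "(\<integral>w. u (t, X t w) \<partial>P (r, x)) = u (r, x) +
    (\<integral>w. (LINT s:{r..t}|\<nu>. source u (s, X s w)) \<partial>P (r, x))"
proof -
  have rT: "r \<in> {0..T}" and tT: "t \<in> {0..T}" using r by auto
  interpret p: prob_space "P (r, x)" by (rule prob_space_P[OF rT])
  note pr = bmeas_process
  let ?c = "\<lambda>z. a (snd z, X (snd z) (fst z)) + b (snd z, X (snd z) (fst z)) * V (snd z) (fst z)"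
  let ?e = "\<lambda>z. source u (snd z, X (snd z) (fst z))"
  have c: "?c \<in> bmeas (M \<Otimes>\<^sub>M \<nu>)"
    by (intro bmeas_add bmeas_mult pr a b bmeas_V_joint)
  have e: "?e \<in> bmeas (M \<Otimes>\<^sub>M \<nu>)"
    by (intro bmeas_add bmeas_mult pr a b u)
  have ci: "(\<lambda>w. LINT s:{r..t}|\<nu>. ?c (w, s)) \<in> bmeas M"
    using nu.bmeas_interval_integral[OF c borel_measurable_const borel_measurable_const] .
  have Vb: "V s \<in> bmeas (P (r, x))" if "s \<in> {0..T}" for s
    unfolding bmeas_P_iff[OF rT] by (rule bmeas_future_M[OF that bmeas_V[OF that]])
  have "(\<integral>w. u (t, X t w) \<partial>P (r, x)) = (\<integral>w. 1 * V t w \<partial>P (r, x))"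
    by (subst V_markov[OF r bmeas_const]) (use tT in \<open>simp add: eq\<close>)
  also have "\<dots> = (\<integral>w. V r w + (LINT s:{r..t}|\<nu>. ?c (w, s)) \<partial>P (r, x))"
    by (intro Bochner_Integration.integral_cong refl) (simp add: space_P[OF rT] V_equation[OF _ r])
  also have "\<dots> = (\<integral>w. V r w \<partial>P (r, x)) + (\<integral>w. (LINT s:{r..t}|\<nu>. ?c (w, s)) \<partial>P (r, x))"
    by (intro Bochner_Integration.integral_add p.integrable_bmeas Vb rT)
      (simp only: bmeas_P_iff[OF rT] ci)
  also have "(\<integral>w. V r w \<partial>P (r, x)) = u (r, x)" using rT by (simp add: eq value_function_def)
  also have "(\<integral>w. (LINT s:{r..t}|\<nu>. ?c (w, s)) \<partial>P (r, x)) = (LINT s:{r..t}|\<nu>. (\<integral>w. ?c (w, s) \<partial>P (r, x)))"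
    by (rule Fubini_interval[OF c rT])
  also have "\<dots> = (LINT s:{r..t}|\<nu>. (\<integral>w. ?e (w, s) \<partial>P (r, x)))"
  proof (rule nu.interval_integral_cong)
    fix s assume s: "s \<in> {0..T}" "r \<le> s" "s \<le> t"
    have at: "(\<lambda>w. k (s, X s w)) \<in> bmeas (P (r, x))" if "k \<in> bmeas (time_space T)" for k
      unfolding bmeas_P_iff[OF rT]
      by (rule bmeas_F_M[OF s(1) bmeas_at[OF that s(1)]])
    have "(\<integral>w. ?c (w, s) \<partial>P (r, x)) = (\<integral>w. a (s, X s w) \<partial>P (r, x)) + (\<integral>w. b (s, X s w) * V s w \<partial>P (r, x))"
      unfolding fst_conv snd_conv
      by (intro Bochner_Integration.integral_add p.integrable_bmeas bmeas_mult at a b Vb s)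
    \<comment> \<open>b(s, X_s) is measurable for \<open>F s\<close> and takes the place of
      Z.\<close>
    also have "(\<integral>w. b (s, X s w) * V s w \<partial>P (r, x)) = (\<integral>w. b (s, X s w) * u (s, X s w) \<partial>P (r, x))"
      using V_markov[OF r(1) s(2) _ bmeas_at[OF b s(1)]] s(1) by (simp add: eq)
    also have "(\<integral>w. a (s, X s w) \<partial>P (r, x)) + \<dots> = (\<integral>w. ?e (w, s) \<partial>P (r, x))"
      unfolding fst_conv snd_conv
      by (intro Bochner_Integration.integral_add[symmetric] p.integrable_bmeas bmeas_mult at a b u)
    finally show "(\<integral>w. ?c (w, s) \<partial>P (r, x)) = (\<integral>w. ?e (w, s) \<partial>P (r, x))" .
  qed
  also have "\<dots> = (\<integral>w. (LINT s:{r..t}|\<nu>. ?e (w, s)) \<partial>P (r, x))"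
    by (rule Fubini_interval[OF e rT, symmetric])
  finally show ?thesis by simp
qed

text \<open>Replacing the unknown by \<open>v\<close> in the source gives a problem without linear term, whose \<open>V\<close> is
  an explicit time integral.\<close>

lemma linear_problem_frozen:
  assumes v: "v \<in> bmeas (time_space T)"
  shows "linear_problem T d \<mu> M F X P \<nu> (source v) (\<lambda>_. 0) g"
  by unfold_locales
    (intro bmeas_add bmeas_mult bmeas_const a b v g)+

lemma frozen_V:
  assumes v: "v \<in> bmeas (time_space T)"
  shows "linear_problem.V T X \<nu> (source v) (\<lambda>_. 0) g s w =
    g (X T w) - (LINT q:{s..T}|\<nu>. source v (q, X q w))"
proof -
  have "(LINT q:{l..t}|\<nu>. 0) = (0 :: real)" for l t by (simp add: set_lebesgue_integral_def)
  then show ?thesis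
    unfolding linear_problem.V_def[OF linear_problem_frozen[OF v]] nu.backward_solution_def by simp
qed

text \<open>W is the \<open>V\<close> of the problem with source frozen at u, so its measurability
  and its forward equation are inherited. Discounting cancels the linear term in conditional
  expectation: given the past of s, c - b W has mean c - b u = a at time s.\<close>

lemma solution_eq_value_function:
  assumes u: "u \<in> bmeas (time_space T)"
    and eq: "\<And>s y. s \<in> {0..T} \<Longrightarrow> (\<integral>w. g (X T w) \<partial>P (s, y)) = u (s, y) +
      (\<integral>w. (LINT q:{s..T}|\<nu>. source u (q, X q w)) \<partial>P (s, y))"
    and r: "r \<in> {0..T}"
  shows "u (r, x) = value_function (r, x)"
proof -
  interpret p: prob_space "P (r, x)" by (rule prob_space_P[OF r])
  note pr = bmeas_process
  define c where "c z = a z + b z * u z" for z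
  interpret q: linear_problem T d \<mu> M F X P \<nu> c "\<lambda>_. 0" g
    unfolding c_def by (rule linear_problem_frozen[OF u])
  define W where "W = q.V"
  have W_eq: "W s w = g (X T w) - (LINT q:{s..T}|\<nu>. c (q, X q w))" for s w
    unfolding W_def c_def by (rule frozen_V[OF u])
  have EW: "integral\<^sup>L (P (s, y)) (W s) = u (s, y)" if s: "s \<in> {0..T}" for s y
  proof -
    interpret q: prob_space "P (s, y)" by (rule prob_space_P[OF s])
    have "integral\<^sup>L (P (s, y)) (W s) = (\<integral>w. g (X T w) \<partial>P (s, y)) - (\<integral>w. (LINT q:{s..T}|\<nu>. c (q, X q w)) \<partial>P (s, y))"
      unfolding W_eq
      by (intro Bochner_Integration.integral_diff q.integrable_bmeas
        bmeas_future_P[OF s _ s] bmeas_terminal bmeas_integral_future_T q.a s)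
    then show ?thesis using eq[OF s, of y] by (simp add: c_def)
  qed
  have W_markov: "(\<integral>w. Z w * W s w \<partial>P (r, x)) = (\<integral>w. Z w * u (s, X s w) \<partial>P (r, x))"
    if s: "r \<le> s" "s \<in> {0..T}" and Z: "Z \<in> bmeas (F s)" for s Z
  proof -
    have r0: "0 \<le> r" using r by simp
    show ?thesis
      using markov_future[OF s(2) r0 s(1) Z q.bmeas_V[OF s(2), folded W_def]]
      by (simp only: EW[OF s(2)])
  qed
  have W_forward: "W s w = W r w + (LINT q:{r..s}|\<nu>. c (q, X q w))"
    if "w \<in> space M" "s \<in> {0..T}" "r \<le> s" for s w
    using q.V_equation[OF that(1), of r s] that(2,3) r unfolding W_def by simp
  have WM: "(\<lambda>z. W (snd z) (fst z)) \<in> bmeas (M \<Otimes>\<^sub>M \<nu>)"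
    unfolding W_def by (rule q.bmeas_V_joint)
  have WP: "W s \<in> bmeas (P (r, x))" if "s \<in> {0..T}" for s
    unfolding W_def by (rule bmeas_future_P[OF that q.bmeas_V[OF that] r])
  define A where "A s w = exp (- (LINT q:{r..s}|\<nu>. b (q, X q w)))" for s w
  have A: "A s \<in> bmeas (F s)" if "s \<in> {0..T}" for s
    unfolding A_def[abs_def]
    by (intro bmeas_exp bmeas_uminus bmeas_integral_past b that)
  have AM: "(\<lambda>z. A (snd z) (fst z)) \<in> bmeas (M \<Otimes>\<^sub>M \<nu>)"
  proof -
    have "(\<lambda>z. A (snd z) (fst z)) \<in> bmeas (future r \<Otimes>\<^sub>M \<nu>)"
      unfolding A_def by (intro bmeas_exp bmeas_uminus bmeas_integral_future b r)
    from bmeas_compose[OF this measurable_M_future_nu[OF r]]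
    show ?thesis by simp
  qed
  let ?h = "\<lambda>z. A (snd z) (fst z) * (c (snd z, X (snd z) (fst z)) - b (snd z, X (snd z) (fst z)) * W (snd z) (fst z))"
  let ?k = "\<lambda>z. A (snd z) (fst z) * a (snd z, X (snd z) (fst z))"
  have h: "?h \<in> bmeas (M \<Otimes>\<^sub>M \<nu>)"
    by (intro bmeas_diff bmeas_mult pr b q.a WM AM)
  have k: "?k \<in> bmeas (M \<Otimes>\<^sub>M \<nu>)"
    by (intro bmeas_mult pr a AM)
  have int: "(\<lambda>w. LINT s:{r..T}|\<nu>. f (w, s)) \<in> bmeas (P (r, x))"
    if "f \<in> bmeas (M \<Otimes>\<^sub>M \<nu>)" for f
    unfolding bmeas_P_iff[OF r]
    by (rule nu.bmeas_interval_integral[OF that borel_measurable_const borel_measurable_const])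
  note FP = bmeas_F_P[OF _ _ r]
  have AgP: "(\<lambda>w. A T w * g (X T w)) \<in> bmeas (P (r, x))"
    by (intro bmeas_mult FP[OF T_mem A[OF T_mem]] T_mem
      bmeas_future_P[OF r bmeas_terminal[OF r] r])
  have "(\<integral>w. A T w * g (X T w) \<partial>P (r, x)) = (\<integral>w. W r w + (LINT s:{r..T}|\<nu>. ?h (w, s)) \<partial>P (r, x))"
  proof (rule Bochner_Integration.integral_cong[OF refl])
    fix w assume "w \<in> space (P (r, x))"
    then have w: "w \<in> space M" by (simp add: space_P[OF r])
    have "W T w = g (X T w)"
      unfolding W_eq nu.interval_integral_empty[OF order_refl] by simp
    moreover have "A T w * W T w = W r w + (LINT s:{r..T}|\<nu>. A s w * (c (s, X s w) - b (s, X s w) * W s w))"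
      unfolding A_def
      by (rule nu.discounted_forward_integral[OF bmeas_path[OF b w] bmeas_path[OF a w] _ _
            bmeas_path[OF q.a w] W_forward[OF w]])
        (use r in simp_all)
    ultimately show "A T w * g (X T w) = W r w + (LINT s:{r..T}|\<nu>. ?h (w, s))" by simp
  qed
  also have "\<dots> = (\<integral>w. W r w \<partial>P (r, x)) + (\<integral>w. (LINT s:{r..T}|\<nu>. ?h (w, s)) \<partial>P (r, x))"
    by (intro Bochner_Integration.integral_add p.integrable_bmeas WP r int h)
  also have "(\<integral>w. (LINT s:{r..T}|\<nu>. ?h (w, s)) \<partial>P (r, x)) = (LINT s:{r..T}|\<nu>. (\<integral>w. ?h (w, s) \<partial>P (r, x)))"
    by (rule Fubini_interval[OF h r])
  also have "\<dots> = (LINT s:{r..T}|\<nu>. (\<integral>w. ?k (w, s) \<partial>P (r, x)))"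
  proof (rule nu.interval_integral_cong)
    fix s assume s: "s \<in> {0..T}" "r \<le> s" "s \<le> T"
    have at: "(\<lambda>w. k (s, X s w)) \<in> bmeas (F s)" if "k \<in> bmeas (time_space T)" for k
      by (rule bmeas_at[OF that s(1)])
    \<comment> \<open>The discount factor from r to s is known at time s, and so is its product with
      b(s, X_s).\<close>
    have Ab: "(\<lambda>w. A s w * b (s, X s w)) \<in> bmeas (F s)"
      by (intro bmeas_mult at b A s(1))
    have "(\<integral>w. ?h (w, s) \<partial>P (r, x)) = (\<integral>w. A s w * c (s, X s w) - (A s w * b (s, X s w)) * W s w \<partial>P (r, x))"
      by (simp add: algebra_simps)
    also have "\<dots> = (\<integral>w. A s w * c (s, X s w) \<partial>P (r, x)) - (\<integral>w. (A s w * b (s, X s w)) * W s w \<partial>P (r, x))"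
      by (intro Bochner_Integration.integral_diff p.integrable_bmeas)
        (intro bmeas_mult FP[OF s(1) A] FP[OF s(1) at] FP[OF s(1) Ab] WP b q.a s)+
    also have "(\<integral>w. (A s w * b (s, X s w)) * W s w \<partial>P (r, x)) =
        (\<integral>w. (A s w * b (s, X s w)) * u (s, X s w) \<partial>P (r, x))"
      by (rule W_markov[OF s(2,1) Ab])
    also have "(\<integral>w. A s w * c (s, X s w) \<partial>P (r, x)) - \<dots> =
        (\<integral>w. A s w * c (s, X s w) - (A s w * b (s, X s w)) * u (s, X s w) \<partial>P (r, x))"
      by (intro Bochner_Integration.integral_diff[symmetric] p.integrable_bmeas)
        (intro bmeas_mult FP[OF s(1) A] FP[OF s(1) at] FP[OF s(1) Ab] WP b q.a u s)+
    also have "\<dots> = (\<integral>w. ?k (w, s) \<partial>P (r, x))" by (simp add: c_def algebra_simps)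
    finally show "(\<integral>w. ?h (w, s) \<partial>P (r, x)) = (\<integral>w. ?k (w, s) \<partial>P (r, x))" .
  qed
  also have "\<dots> = (\<integral>w. (LINT s:{r..T}|\<nu>. ?k (w, s)) \<partial>P (r, x))"
    by (rule Fubini_interval[OF k r, symmetric])
  finally have "u (r, x) = (\<integral>w. A T w * g (X T w) \<partial>P (r, x)) - (\<integral>w. (LINT s:{r..T}|\<nu>. ?k (w, s)) \<partial>P (r, x))"
    using EW[OF r, of x] by simp
  also have "\<dots> = (\<integral>w. A T w * g (X T w) - (LINT s:{r..T}|\<nu>. ?k (w, s)) \<partial>P (r, x))"
    by (intro Bochner_Integration.integral_diff[symmetric] p.integrable_bmeas AgP int k)
  also have "\<dots> = value_function (r, x)"
    unfolding value_function_def V_def nu.backward_solution_def A_def by simp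
  finally show ?thesis .
qed

lemma value_function_formula:
  assumes r: "r \<in> {0..T}"
  shows "value_function (r, x) =
    (\<integral>w. exp (- (LINT s:{r..T}|\<nu>. b (s, X s w))) * g (X T w) \<partial>P (r, x)) -
    (\<integral>w. (LINT t:{r..T}|\<nu>. exp (- (LINT s:{r..t}|\<nu>. b (s, X s w))) * a (t, X t w)) \<partial>P (r, x))"
proof -
  interpret p: prob_space "P (r, x)" by (rule prob_space_P[OF r])
  note future_P = bmeas_future_P[OF r _ r]
  have "(\<lambda>w. LINT t:{r..T}|\<nu>. exp (- (LINT s:{r..t}|\<nu>. b (s, X s w))) * a (t, X t w)) \<in> bmeas (future r)"
    using bmeas_section(2)[OF bmeas_discounted_source[OF r] T_mem] by simp
  then show ?thesis
    unfolding value_function_def V_def nu.backward_solution_def fst_conv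
    by (intro Bochner_Integration.integral_diff p.integrable_bmeas future_P)
      (intro bmeas_mult bmeas_exp bmeas_uminus
        bmeas_integral_future_T[OF b r] bmeas_terminal[OF r])
qed

end

section \<open>Measurability in the starting point\<close>

lemma (in spacetime_setting) time_measurable:
  assumes tc: "time_continuous T d"
  shows "fst \<in> borel_measurable (ST T)"
proof (rule borel_measurableI)
  fix S :: "real set" assume S: "open S"
  have "openin (pm_topology d ({0..T} \<times> UNIV)) {p \<in> topspace (pm_topology d ({0..T} \<times> UNIV)). fst p \<in> S}"
    using tc S unfolding time_continuous_def continuous_spacetime_def
    by (intro openin_continuous_map_preimage[where Y=euclideanreal]) simp_all
  then have "{p \<in> {0..T} \<times> UNIV. fst p \<in> S} \<in> sets (ST T)"
    unfolding sets_borel_of topspace_pm_topology by (intro sigma_sets.Basic CollectI)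
  moreover have "fst -` S \<inter> space (ST T) = {p \<in> {0..T} \<times> UNIV. fst p \<in> S}"
    unfolding space_spacetime_borel by blast
  ultimately show "fst -` S \<inter> space (ST T) \<in> sets (ST T)" by simp
qed

lemma (in spacetime_setting) time_tendsto:
  assumes tc: "time_continuous T d" and r: "r \<in> {0..T}" and s: "\<And>n. s n \<in> {0..T}"
    and lim: "(\<lambda>n. d (s n, y n) (r, x)) \<longlonglongrightarrow> 0"
  shows "s \<longlonglongrightarrow> r"
proof -
  have "relatively_continuous (\<lambda>_ _. True) d {0..T} fst"
    using tc unfolding time_continuous_def continuous_spacetime_iff[OF pseudometric] .
  from relatively_continuous_sequentially[OF this r _ lim] show ?thesis
    using s by (simp add: always_eventually)
qed

text \<open>The kernel is only known to be measurable for functionals of the future of a fixed time \<open>t\<close> and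
  starting times up to \<open>t\<close>, so the starting time is discretised from the right by \<open>\<rho> n\<close>.\<close>

lemma (in progressive_markov) expectation_right_continuous_functional:
  assumes tc: "time_continuous T d"
    and H: "\<And>r. r \<in> {0..T} \<Longrightarrow> H r \<in> borel_measurable (future r)"
    and K: "\<And>r w. r \<in> {0..T} \<Longrightarrow> w \<in> space M \<Longrightarrow> \<bar>H r w\<bar> \<le> K"
    and right_cont: "\<And>r \<rho> w. r \<in> {0..T} \<Longrightarrow> w \<in> space M \<Longrightarrow> (\<And>n. \<rho> n \<in> {r..T}) \<Longrightarrow>
      \<rho> \<longlonglongrightarrow> r \<Longrightarrow> (\<lambda>n. H (\<rho> n) w) \<longlonglongrightarrow> H r w"
  shows "(\<lambda>p. \<integral>w. H (fst p) w \<partial>P p :: real) \<in> borel_measurable (ST T)"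
proof -
  let ?B = "ST T"
  \<comment> \<open>A grid of mesh 1/(n+1), clamped to [0, T]. \<open>\<rho> n r\<close> rounds r
    up, so it is at least r and exceeds it by at most the mesh.\<close>
  define \<tau> where "\<tau> n k = max 0 (min T (real_of_int k / real (Suc n)))" for n and k :: int
  define \<rho> where "\<rho> n r = \<tau> n \<lceil>r * real (Suc n)\<rceil>" for n r
  have \<tau>: "\<tau> n k \<in> {0..T}" for n k using T_pos by (auto simp: \<tau>_def)
  have le: "r \<le> \<rho> n r" and ge: "\<rho> n r \<le> r + inverse (real (Suc n))" if r: "r \<in> {0..T}" for n r
  proof -
    define k where "k = real_of_int \<lceil>r * real (Suc n)\<rceil>"
    have k: "r * real (Suc n) \<le> k" "k \<le> r * real (Suc n) + 1"
      unfolding k_def using ceiling_correct[of "r * real (Suc n)"] by linarith+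
    have "r \<le> k / real (Suc n)" using k(1) by (simp add: pos_le_divide_eq)
    moreover have "k / real (Suc n) \<le> r + inverse (real (Suc n))"
      using k(2) by (simp add: pos_divide_le_eq distrib_right)
    moreover have "0 \<le> r" "r \<le> T" "0 \<le> inverse (real (Suc n))" using r by auto
    ultimately show "r \<le> \<rho> n r" "\<rho> n r \<le> r + inverse (real (Suc n))"
      unfolding \<rho>_def \<tau>_def k_def[symmetric] by linarith+
  qed
  have \<rho>: "\<rho> n r \<in> {r..T}" if "r \<in> {0..T}" for n r
    using le[OF that, of n] \<tau>[of n] by (simp add: \<rho>_def)
  have \<rho>_lim: "(\<lambda>n. \<rho> n r) \<longlonglongrightarrow> r" if r: "r \<in> {0..T}" for r
  proof (rule tendsto_sandwich[OF _ _ tendsto_const])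
    show "(\<lambda>n. r + inverse (real (Suc n))) \<longlonglongrightarrow> r"
      using tendsto_add[OF tendsto_const LIMSEQ_inverse_real_of_nat, of r] by simp
    show "\<forall>\<^sub>F n in sequentially. r \<le> \<rho> n r" by (intro always_eventually allI le[OF r])
    show "\<forall>\<^sub>F n in sequentially. \<rho> n r \<le> r + inverse (real (Suc n))" by (intro always_eventually allI ge[OF r])
  qed
  have approx: "(\<lambda>p. \<integral>w. H (\<rho> n (fst p)) w \<partial>P p) \<in> borel_measurable ?B" for n
  proof -
    define A where "A k = {p \<in> space ?B. \<lceil>fst p * real (Suc n)\<rceil> = k}" for k
    have ceil: "(\<lambda>p. \<lceil>fst p * real (Suc n)\<rceil>) \<in> measurable ?B (count_space UNIV)"
      by (rule measurable_compose[OF borel_measurable_times[OF time_measurable[OF tc] borel_measurable_const] measurable_real_ceiling])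
    have A_eq: "A k = (\<lambda>p. \<lceil>fst p * real (Suc n)\<rceil>) -` {k} \<inter> space ?B" for k unfolding A_def by blast
    have A: "A k \<in> sets ?B" for k unfolding A_eq by (rule measurable_sets[OF ceil]) simp
    \<comment> \<open>A starting time rounded up to \<open>\<tau> n k\<close> is at most that time,
      so the starting point lies in the strip on which expectations of \<open>H (\<tau> n k)\<close>
      are measurable.\<close>
    have sub: "A k \<subseteq> {0..\<tau> n k} \<times> UNIV" for k
    proof
      fix p assume p: "p \<in> A k"
      then have "fst p \<in> {0..T}" "\<tau> n k = \<rho> n (fst p)"
        by (auto simp: A_def space_spacetime_borel \<rho>_def)
      with le[of "fst p" n] show "p \<in> {0..\<tau> n k} \<times> UNIV" by (cases p) simp
    qed
    have f: "(\<lambda>p. indicator (A k) p *\<^sub>R (\<integral>w. H (\<tau> n k) w \<partial>P p)) \<in> borel_measurable ?B" for k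
    proof -
      have "\<tau> n k \<le> T" using \<tau>[of n k] by simp
      from measurable_compose[OF measurable_spacetime_borel_sub[OF this sub] expectation_future[OF \<tau> H[OF \<tau>]]]
      have "(\<lambda>p. \<integral>w. H (\<tau> n k) w \<partial>P p) \<in> borel_measurable (restrict_space ?B (A k))" .
      then show ?thesis using A by (subst (asm) borel_measurable_restrict_space_iff) auto
    qed
    \<comment> \<open>The rounded time has countably many values, indexed by k, and the pieces
      \<open>A k\<close> are glued together.\<close>
    have "(\<lambda>p. indicator (A \<lceil>fst p * real (Suc n)\<rceil>) p *\<^sub>R (\<integral>w. H (\<tau> n \<lceil>fst p * real (Suc n)\<rceil>) w \<partial>P p)) \<in> borel_measurable ?B"
      by (rule measurable_compose_countable[OF f ceil])
    moreover have "indicator (A \<lceil>fst p * real (Suc n)\<rceil>) p *\<^sub>R (\<integral>w. H (\<tau> n \<lceil>fst p * real (Suc n)\<rceil>) w \<partial>P p) =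
        (\<integral>w. H (\<rho> n (fst p)) w \<partial>P p)" if "p \<in> space ?B" for p
      using that by (simp add: A_def \<rho>_def)
    ultimately show ?thesis by (simp cong: measurable_cong)
  qed
  show ?thesis
  proof (rule borel_measurable_LIMSEQ_real[OF _ approx])
    fix p assume "p \<in> space ?B"
    then have r: "fst p \<in> {0..T}" by (auto simp: space_spacetime_borel)
    interpret prob_space "P p" using prob_space_P[OF r, of "snd p"] by simp
    have sp: "space (P p) = space M" and st: "sets (P p) = sets M"
      using space_P[OF r, of "snd p"] sets_P[OF r, of "snd p"] by simp_all
    have meas: "H s \<in> borel_measurable (P p)" if "s \<in> {0..T}" for s
      by (rule measurable_mono_sets[OF H[OF that]])
        (simp_all add: sp st space_sigma_process sets_future[OF that])
    have \<rho>T: "\<rho> n (fst p) \<in> {0..T}" for n using \<tau> by (simp only: \<rho>_def)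
    show "(\<lambda>n. \<integral>w. H (\<rho> n (fst p)) w \<partial>P p) \<longlonglongrightarrow> (\<integral>w. H (fst p) w \<partial>P p)"
    proof (rule integral_dominated_convergence[where w="\<lambda>_. K"])
      show "AE w in P p. (\<lambda>n. H (\<rho> n (fst p)) w) \<longlonglongrightarrow> H (fst p) w"
        by (intro AE_I2 right_cont r \<rho> \<rho>_lim) (simp only: sp)
      show "AE w in P p. norm (H (\<rho> n (fst p)) w) \<le> K" for n
        unfolding real_norm_def by (intro AE_I2 K \<rho>T) (simp only: sp)
    qed (use meas r \<rho>T in auto)
  qed
qed

text \<open>Open and half-open D are covered: if every point of D lay above the mean, Y would exceed
  its own mean everywhere, which is impossible; likewise from below.\<close>

lemma (in prob_space) expectation_in_interval:
  fixes Y :: "'a \<Rightarrow> real"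
  assumes D: "is_interval D" and Y: "integrable M Y" "\<And>w. w \<in> space M \<Longrightarrow> Y w \<in> D"
  shows "expectation Y \<in> D"
proof -
  have "\<exists>w\<in>D. w \<le> expectation Y"
  proof (rule ccontr)
    assume "\<not> (\<exists>w\<in>D. w \<le> expectation Y)"
    then have "\<And>w. w \<in> D \<Longrightarrow> expectation Y < w" by force
    with Y(2) have "AE w in M. expectation Y < Y w" by (intro AE_I2) blast
    from expectation_greater[OF Y(1) this] show False by simp
  qed
  moreover have "\<exists>w\<in>D. expectation Y \<le> w"
  proof (rule ccontr)
    assume "\<not> (\<exists>w\<in>D. expectation Y \<le> w)"
    then have "\<And>w. w \<in> D \<Longrightarrow> w < expectation Y" by force
    with Y(2) have "AE w in M. Y w < expectation Y" by (intro AE_I2) blast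
    from expectation_less[OF Y(1) this] show False by simp
  qed
  ultimately show ?thesis using D unfolding is_interval_1 by blast
qed

context markov_diffuse
begin

lemma expectation_le:
  fixes f :: "'w \<Rightarrow> real"
  assumes "r \<in> {0..T}" "f \<in> borel_measurable (P (r, x))" "\<And>w. w \<in> space M \<Longrightarrow> \<bar>f w\<bar> \<le> K"
  shows "\<bar>integral\<^sup>L (P (r, x)) f\<bar> \<le> K"
proof -
  interpret p: prob_space "P (r, x)" by (rule prob_space_P[OF assms(1)])
  show ?thesis
    using p.abs_integral_le[OF assms(2), of K] assms(3) by (simp add: space_P[OF assms(1)] measure_P_space[OF assms(1)])
qed

lemma bmeas_time_space:
  assumes "u \<in> borel_measurable (ST T)"
    and "\<And>r x. r \<in> {0..T} \<Longrightarrow> \<bar>u (r, x)\<bar> \<le> K"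
  shows "u \<in> bmeas (time_space T)"
  by (rule bmeasI[OF borel_measurable_time_space[OF assms(1)], of K])
    (use assms(2) in \<open>auto simp: space_pair_measure space_restrict_space\<close>)

end

context linear_problem
begin

text \<open>Along a path \<open>V\<close> is a constant plus a running integral from 0, which is
  continuous because \<nu> has no point masses.\<close>

lemma V_tendsto:
  assumes w: "w \<in> space M" and r: "r \<in> {0..T}" and \<rho>: "\<And>n. \<rho> n \<in> {0..T}" "\<rho> \<longlonglongrightarrow> r"
  shows "(\<lambda>n. V (\<rho> n) w) \<longlonglongrightarrow> V r w"
proof -
  have "(\<lambda>s. a (s, X s w) + b (s, X s w) * V s w) \<in> bmeas \<nu>"
    using bmeas_section(1)[OF bmeas_V_joint w]
    by (intro bmeas_add bmeas_mult bmeas_path a b w) simp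
  from tendsto_add[OF tendsto_const nu.interval_integral_tendsto[OF this \<rho>(2), of 0], of "V 0 w"]
  have lim: "(\<lambda>n. V 0 w + (LINT s:{0..\<rho> n}|\<nu>. a (s, X s w) + b (s, X s w) * V s w)) \<longlonglongrightarrow>
    V 0 w + (LINT s:{0..r}|\<nu>. a (s, X s w) + b (s, X s w) * V s w)" .
  have "V t w = V 0 w + (LINT s:{0..t}|\<nu>. a (s, X s w) + b (s, X s w) * V s w)" if "t \<in> {0..T}" for t
    using that by (intro V_equation[OF w]) auto
  from lim[folded this[OF \<rho>(1)] this[OF r]] show ?thesis .
qed

lemma V_bound:
  obtains K where "K \<ge> 0" "\<And>r w. r \<in> {0..T} \<Longrightarrow> w \<in> space M \<Longrightarrow> \<bar>V r w\<bar> \<le> K"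
proof -
  obtain K where K: "K \<ge> 0" "\<And>z. z \<in> space (M \<Otimes>\<^sub>M \<nu>) \<Longrightarrow> \<bar>V (snd z) (fst z)\<bar> \<le> K"
    using bmeas_bound[OF bmeas_V_joint] by blast
  have "\<bar>V r w\<bar> \<le> K" if "r \<in> {0..T}" "w \<in> space M" for r w
    using K(2)[of "(w, r)"] that by (simp add: space_pair_measure nu.space_nu)
  with K(1) show ?thesis by (rule that)
qed

lemma value_function_bound:
  obtains K where "K \<ge> 0" "\<And>r x. r \<in> {0..T} \<Longrightarrow> \<bar>value_function (r, x)\<bar> \<le> K"
proof -
  obtain K where K: "K \<ge> 0" "\<And>r w. r \<in> {0..T} \<Longrightarrow> w \<in> space M \<Longrightarrow> \<bar>V r w\<bar> \<le> K"
    using V_bound by blast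
  have "\<bar>value_function (r, x)\<bar> \<le> K" if r: "r \<in> {0..T}" for r x
    unfolding value_function_def fst_conv
    by (rule expectation_le[OF r bmeasD[OF bmeas_future_P[OF r bmeas_V[OF r] r]] K(2)[OF r]])
  with K(1) show ?thesis by (rule that)
qed

text \<open>\<open>V r\<close> is a bounded functional of the future of r and continuous in r on
  each path, which is what rounding the starting times up requires.\<close>

lemma borel_measurable_value_function:
  assumes tc: "time_continuous T d"
  shows "value_function \<in> borel_measurable (ST T)"
proof -
  obtain K where K: "K \<ge> 0" "\<And>r w. r \<in> {0..T} \<Longrightarrow> w \<in> space M \<Longrightarrow> \<bar>V r w\<bar> \<le> K"
    using V_bound by blast
  show ?thesis
    unfolding value_function_def[abs_def]
  proof (rule expectation_right_continuous_functional[OF tc bmeasD[OF bmeas_V] K(2)])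
    fix r \<rho> w assume r: "r \<in> {0..T}" and w: "w \<in> space M" and \<rho>: "\<And>n. \<rho> n \<in> {r..T}" "\<rho> \<longlonglongrightarrow> r"
    have "\<rho> n \<in> {0..T}" for n using \<rho>(1)[of n] r by auto
    from V_tendsto[OF w r this \<rho>(2)] show "(\<lambda>n. V (\<rho> n) w) \<longlonglongrightarrow> V r w" .
  qed
qed

text \<open>The sign conditions keep each \<open>V r w\<close> in D, and averaging does not leave an
  interval.\<close>

lemma value_function_in_interval:
  assumes D: "is_interval D" and gD: "range g \<subseteq> D"
    and lower: "bdd_below D \<Longrightarrow> AE s in \<nu>. \<forall>y. a (s, y) + b (s, y) * Inf D \<le> 0"
    and upper: "bdd_above D \<Longrightarrow> AE s in \<nu>. \<forall>y. 0 \<le> a (s, y) + b (s, y) * Sup D"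
    and r: "r \<in> {0..T}"
  shows "value_function (r, x) \<in> D"
  unfolding value_function_def fst_conv
proof (rule prob_space.expectation_in_interval[OF prob_space_P[OF r] D])
  show "integrable (P (r, x)) (V r)"
    by (rule finite_measure.integrable_bmeas[OF finite_measure_P[OF r]
          bmeas_future_P[OF r bmeas_V[OF r] r]])
  fix w assume "w \<in> space (P (r, x))"
  then have w: "w \<in> space M" by (simp only: space_P[OF r])
  show "V r w \<in> D"
    unfolding V_def
  proof (rule nu.backward_solution_in_interval[OF bmeas_path[OF b w] bmeas_path[OF a w] D _ r])
    show "g (X T w) \<in> D" using gD by blast
    show "AE s in \<nu>. a (s, X s w) + b (s, X s w) * Inf D \<le> 0" if "bdd_below D"
      using lower[OF that] by eventually_elim blast
    show "AE s in \<nu>. 0 \<le> a (s, X s w) + b (s, X s w) * Sup D" if "bdd_above D"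
      using upper[OF that] by eventually_elim blast
  qed
qed

end

section \<open>Continuity of the solution\<close>

lemma relatively_continuous_uniform_limit:
  assumes "\<And>e. e > 0 \<Longrightarrow> \<exists>w. relatively_continuous R d I w \<and> (\<forall>r\<in>I. \<forall>x. \<bar>w (r, x) - u (r, x)\<bar> < e)"
  shows "relatively_continuous R d I u"
  unfolding relatively_continuous_def
proof (intro ballI allI impI)
  fix r x and e :: real assume r: "r \<in> I" and e: "e > 0"
  obtain w where w: "relatively_continuous R d I w" "\<And>r x. r \<in> I \<Longrightarrow> \<bar>w (r, x) - u (r, x)\<bar> < e / 3"
    using assms[of "e / 3"] e by auto
  have "e / 3 > 0" using e by simp
  then obtain \<delta> where \<delta>: "\<delta> > 0"
      "\<forall>s\<in>I. \<forall>y. R r s \<and> d (s, y) (r, x) < \<delta> \<longrightarrow> \<bar>w (s, y) - w (r, x)\<bar> < e / 3"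
    using w(1) r unfolding relatively_continuous_def by blast
  show "\<exists>\<delta>>0. \<forall>s\<in>I. \<forall>y. R r s \<and> d (s, y) (r, x) < \<delta> \<longrightarrow> \<bar>u (s, y) - u (r, x)\<bar> < e"
  proof (intro exI[of _ \<delta>] conjI ballI allI impI)
    fix s y assume s: "s \<in> I" and *: "R r s \<and> d (s, y) (r, x) < \<delta>"
    have "\<bar>w (s, y) - w (r, x)\<bar> < e / 3" using \<delta>(2) s * by blast
    with w(2)[OF s, of y] w(2)[OF r, of x] show "\<bar>u (s, y) - u (r, x)\<bar> < e" by linarith
  qed (rule \<delta>(1))
qed

section \<open>The fixed-point map and continuity of its iterates\<close>

context linear_problem
begin

definition picard :: "(real \<times> 's \<Rightarrow> real) \<Rightarrow> real \<times> 's \<Rightarrow> real" where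
  "picard v p = (\<integral>w. g (X T w) - (LINT s:{fst p..T}|\<nu>. source v (s, X s w)) \<partial>P p)"

context
  fixes v :: "real \<times> 's \<Rightarrow> real"
  assumes v: "v \<in> bmeas (time_space T)"
begin

lemma bmeas_linear: "source v \<in> bmeas (time_space T)"
  by (intro bmeas_add bmeas_mult a b v)

text \<open>Fubini leaves only expectations at single times s, the form in which the Feller property
  applies.\<close>

lemma picard_alt:
  assumes r: "r \<in> {0..T}"
  shows "picard v (r, x) = (\<integral>w. g (X T w) \<partial>P (r, x)) -
    (LINT s:{r..T}|\<nu>. (\<integral>w. source v (s, X s w) \<partial>P (r, x)))"
proof -
  interpret p: prob_space "P (r, x)" by (rule prob_space_P[OF r])
  note future_P = bmeas_future_P[OF r _ r]
  have "picard v (r, x) = (\<integral>w. g (X T w) \<partial>P (r, x)) -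
      (\<integral>w. (LINT s:{r..T}|\<nu>. source v (s, X s w)) \<partial>P (r, x))"
    unfolding picard_def fst_conv
    by (intro Bochner_Integration.integral_diff p.integrable_bmeas future_P
      bmeas_terminal[OF r] bmeas_integral_future_T[OF bmeas_linear r])
  also have "(\<integral>w. (LINT s:{r..T}|\<nu>. source v (s, X s w)) \<partial>P (r, x)) =
      (LINT s:{r..T}|\<nu>. (\<integral>w. source v (s, X s w) \<partial>P (r, x)))"
    using Fubini_interval[OF bmeas_process[OF bmeas_linear] r] by simp
  finally show ?thesis .
qed

text \<open>\<open>picard v\<close> is the value function of the problem frozen at v, whose
  measurability and boundedness are known.\<close>

lemma bmeas_picard:
  assumes tc: "time_continuous T d"
  shows "picard v \<in> bmeas (time_space T)"
proof -
  interpret q: linear_problem T d \<mu> M F X P \<nu> "source v" "\<lambda>_. 0" g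
    by (rule linear_problem_frozen[OF v])
  have "picard v = q.value_function"
    by (rule ext) (simp only: picard_def q.value_function_def frozen_V[OF v])
  moreover obtain K where "\<And>r x. r \<in> {0..T} \<Longrightarrow> \<bar>q.value_function (r, x)\<bar> \<le> K"
    using q.value_function_bound by blast
  note bmeas_time_space[OF q.borel_measurable_value_function[OF tc] this]
  ultimately show ?thesis by (simp only:)
qed

text \<open>For almost every t the function y |-> (a + b v)(t, y) is bounded and continuous, so for
  t > r the Feller property at t gives convergence of its expectation along the starting points. The
  bound L allows the limit to pass under the time integral.\<close>

lemma picard_relatively_continuous:
  assumes tc: "time_continuous T d"
    and feller: "\<And>t \<phi>. t \<in> {0..T} \<Longrightarrow> continuous_on UNIV \<phi> \<Longrightarrow> bounded (range \<phi>) \<Longrightarrow>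
      relatively_continuous R d {0..t} (\<lambda>p. \<integral>w. \<phi> (X t w) \<partial>P p)"
    and g_cont: "continuous_on UNIV g"
    and ab_cont: "AE s in \<nu>. continuous_on UNIV (\<lambda>y. a (s, y)) \<and> continuous_on UNIV (\<lambda>y. b (s, y))"
    and v_cont: "\<And>s. s \<in> {0..T} \<Longrightarrow> continuous_on UNIV (\<lambda>y. v (s, y))"
  shows "relatively_continuous R d {0..T} (picard v)"
proof (rule relatively_continuousI)
  show "0 \<le> d (s, y) (r, x)" if "s \<in> {0..T}" "r \<in> {0..T}" for s y r x
    by (rule dist_nonneg[OF that])
  fix r x s y
  assume r: "r \<in> {0..T}" and s: "\<And>n. s n \<in> {0..T}" and R: "\<And>n. R r (s n)"
    and lim: "(\<lambda>n. d (s n, y n) (r, x)) \<longlonglongrightarrow> 0"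
  note c = bmeas_linear
  have s_lim: "s \<longlonglongrightarrow> r" by (rule time_tendsto[OF tc r s lim])
  have bdd: "bounded (range \<phi>)" if \<phi>: "\<phi> \<in> bmeas borel" for \<phi> :: "'s \<Rightarrow> real"
  proof -
    obtain K where "\<And>y. y \<in> space borel \<Longrightarrow> \<bar>\<phi> y\<bar> \<le> K"
      using bmeas_bound[OF \<phi>] by blast
    then show ?thesis unfolding bounded_iff by (intro exI[of _ K]) auto
  qed
  define e where "e p t = (\<integral>w. source v (t, X t w) \<partial>P p)" for p t
  have eb: "e (r, x) \<in> bmeas \<nu>" if "r \<in> {0..T}" for r x
    unfolding e_def[abs_def]
    using bmeas_expectation[OF bmeas_process[OF c] that] by simp
  obtain L where L: "L \<ge> 0" "\<And>p. p \<in> space (time_space T) \<Longrightarrow> \<bar>a p + b p * v p\<bar> \<le> L"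
    using bmeas_bound[OF c] by blast
  have eL: "\<bar>e (r, x) t\<bar> \<le> L" if r: "r \<in> {0..T}" and t: "t \<in> {0..T}" for r x t
    unfolding e_def
  proof (rule expectation_le[OF r])
    show "(\<lambda>w. source v (t, X t w)) \<in> borel_measurable (P (r, x))"
      by (rule bmeasD[OF bmeas_F_P[OF t bmeas_at[OF c t] r]])
    show "\<bar>source v (t, X t w)\<bar> \<le> L" for w
      using L(2)[of "(t, X t w)"] t by (simp add: space_pair_measure space_restrict_space)
  qed
  have "(\<lambda>n. \<integral>w. g (X T w) \<partial>P (s n, y n)) \<longlonglongrightarrow> (\<integral>w. g (X T w) \<partial>P (r, x))"
    by (rule relatively_continuous_sequentially[OF feller[OF T_mem g_cont bdd[OF g]] r _ lim])
      (intro always_eventually allI conjI s R)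
  moreover have "(\<lambda>n. LINT t:{s n..T}|\<nu>. e (s n, y n) t) \<longlonglongrightarrow> (LINT t:{r..T}|\<nu>. e (r, x) t)"
    unfolding set_lebesgue_integral_def real_scaleR_def
  proof (rule integral_dominated_convergence[where w="\<lambda>_. L"])
    show "(\<lambda>t. indicator {r..T} t * e (r, x) t) \<in> borel_measurable \<nu>"
      by (intro bmeasD bmeas_mult nu.bmeas_indicator_interval eb r)
    show "(\<lambda>t. indicator {s n..T} t * e (s n, y n) t) \<in> borel_measurable \<nu>" for n
      by (intro bmeasD bmeas_mult nu.bmeas_indicator_interval eb s)
    show "AE t in \<nu>. norm (indicator {s n..T} t * e (s n, y n) t) \<le> L" for n
      using L(1) by (intro AE_I2) (simp add: indicator_def eL[OF s] nu.space_nu)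
    show "AE t in \<nu>. (\<lambda>n. indicator {s n..T} t * e (s n, y n) t) \<longlonglongrightarrow> indicator {r..T} t * e (r, x) t"
      using ab_cont nu.AE_neq[of r] AE_space
    proof eventually_elim
      case (elim t)
      then have t: "t \<in> {0..T}" by (simp add: nu.space_nu)
      show ?case
      proof (cases "t < r")
        \<comment> \<open>A time t < r eventually lies before the starting times \<open>s n\<close>,
          where both indicators vanish.\<close>
        case True
        have "\<forall>\<^sub>F n in sequentially. indicator {s n..T} t * e (s n, y n) t = indicator {r..T} t * e (r, x) t"
          using order_tendstoD(1)[OF s_lim True] by eventually_elim (use True in \<open>simp add: indicator_def\<close>)
        then show ?thesis by (rule tendsto_eventually)
      next
        case False
        then have rt: "r < t" using elim by simp
        have cont: "continuous_on UNIV (\<lambda>y. a (t, y) + b (t, y) * v (t, y))"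
          using elim v_cont[OF t] by (intro continuous_intros) auto
        have "(\<lambda>n. e (s n, y n) t) \<longlonglongrightarrow> e (r, x) t"
          unfolding e_def
        \<comment> \<open>Starting times satisfy s n <= t only from some index on, and the Feller
          property at t concerns only such starts.\<close>
        proof (rule relatively_continuous_sequentially[OF feller[OF t cont bdd[OF bmeas_slice[OF c t]]] _ _ lim])
          show "r \<in> {0..t}" using r rt by simp
          show "\<forall>\<^sub>F n in sequentially. s n \<in> {0..t} \<and> R r (s n)"
            using order_tendstoD(2)[OF s_lim rt] by eventually_elim (use s R in simp)
        qed
        moreover have "\<forall>\<^sub>F n in sequentially. e (s n, y n) t = indicator {s n..T} t * e (s n, y n) t"
          using order_tendstoD(2)[OF s_lim rt] by eventually_elim (use t in \<open>simp add: indicator_def\<close>)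
        ultimately have "(\<lambda>n. indicator {s n..T} t * e (s n, y n) t) \<longlonglongrightarrow> e (r, x) t"
          by (rule Lim_transform_eventually)
        then show ?thesis using rt t by (simp add: indicator_def)
      qed
    qed
  qed simp_all
  ultimately have "(\<lambda>n. (\<integral>w. g (X T w) \<partial>P (s n, y n)) - (LINT t:{s n..T}|\<nu>. e (s n, y n) t)) \<longlonglongrightarrow>
      (\<integral>w. g (X T w) \<partial>P (r, x)) - (LINT t:{r..T}|\<nu>. e (r, x) t)"
    by (rule tendsto_diff)
  then show "(\<lambda>n. picard v (s n, y n)) \<longlonglongrightarrow> picard v (r, x)"
    unfolding picard_alt[OF r] picard_alt[OF s] e_def .
qed

end

text \<open>In the weighted norm with weight \<open>exp (2 L \<nu>[0, r])\<close>, where \<open>L\<close> bounds \<open>b\<close>, the map \<open>picard\<close> is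
  a contraction with factor \<open>1/2\<close>.\<close>

lemma solution_relatively_continuous:
  assumes tc: "time_continuous T d" and R: "\<And>t. R t t"
    and feller: "\<And>t \<phi>. t \<in> {0..T} \<Longrightarrow> continuous_on UNIV \<phi> \<Longrightarrow> bounded (range \<phi>) \<Longrightarrow>
      relatively_continuous R d {0..t} (\<lambda>p. \<integral>w. \<phi> (X t w) \<partial>P p)"
    and g_cont: "continuous_on UNIV g"
    and ab_cont: "AE s in \<nu>. continuous_on UNIV (\<lambda>y. a (s, y)) \<and> continuous_on UNIV (\<lambda>y. b (s, y))"
    and u: "u \<in> bmeas (time_space T)"
    and fixpoint: "\<And>r x. r \<in> {0..T} \<Longrightarrow> u (r, x) = picard u (r, x)"
  shows "relatively_continuous R d {0..T} u"
proof -
  obtain L where L: "L \<ge> 0" "\<And>p. p \<in> space (time_space T) \<Longrightarrow> \<bar>b p\<bar> \<le> L"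
    using bmeas_bound[OF b] by blast
  \<comment> \<open>\<open>e\<close> is the reciprocal of the weight: a weighted norm of at most c
    means an absolute value of at most c times \<open>e\<close>.\<close>
  define e where "e s = exp (- (LINT q:{0..s}|\<nu>. 2 * L))" for s
  have e: "e \<in> bmeas \<nu>"
    unfolding e_def[abs_def] by (intro nu.bmeas_exp_integral bmeas_const)
  \<comment> \<open>The integral of 2 L e over [r, T] is at most e r, so a source error of at most L
    e costs at most half of e r.\<close>
  have e_eq: "2 * L * (LINT s:{r..T}|\<nu>. e s) = e r - e T" if r: "r \<in> {0..T}" for r
  proof -
    have "e t = 1 - 2 * L * (LINT s:{0..t}|\<nu>. e s)" if "t \<in> {0..T}" for t
    proof -
      have "(LINT s:{0..t}|\<nu>. - (2 * L) * e s) = - (2 * L) * (LINT s:{0..t}|\<nu>. e s)"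
        by (rule set_integral_mult_right)
      then show ?thesis
        using nu.exp_minus_interval_integral[OF bmeas_const[of "2 * L"] that, of 0] that
        unfolding e_def[symmetric] by simp
    qed
    from this[OF r] this[OF T_mem] have *: "e r = 1 - 2 * L * (LINT s:{0..r}|\<nu>. e s)"
      "e T = 1 - 2 * L * (LINT s:{0..T}|\<nu>. e s)" .
    have "(LINT s:{0..T}|\<nu>. e s) = (LINT s:{0..r}|\<nu>. e s) + (LINT s:{r..T}|\<nu>. e s)"
      using r by (intro nu.interval_integral_split[OF e]) simp_all
    then show ?thesis unfolding * by (simp add: distrib_left)
  qed
  have e0: "0 < e s" for s unfolding e_def by simp
  have eT: "e T \<le> e s" if "s \<in> {0..T}" for s
  proof -
    have "0 \<le> (LINT s:{s..T}|\<nu>. e s)"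
      unfolding set_lebesgue_integral_def by (intro integral_nonneg_AE AE_I2) (simp add: indicator_def less_imp_le[OF e0])
    then have "0 \<le> 2 * L * (LINT s:{s..T}|\<nu>. e s)" using L(1) by simp
    then show ?thesis unfolding e_eq[OF that] by simp
  qed
  have e1: "e s \<le> 1" for s
  proof -
    have "0 \<le> (LINT q:{0..s}|\<nu>. 2 * L)"
      unfolding set_lebesgue_integral_def using L(1) by (intro integral_nonneg_AE AE_I2) (simp add: indicator_def)
    then show ?thesis unfolding e_def by simp
  qed
  obtain K0 where K0: "K0 \<ge> 0" "\<And>p. p \<in> space (time_space T) \<Longrightarrow> \<bar>u p\<bar> \<le> K0"
    using bmeas_bound[OF u] by blast
  \<comment> \<open>Chosen so that the zero function, the starting iterate, is within K e r of u:
    the smallest value of \<open>e\<close> on [0, T] is e T.\<close>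
  define K where "K = K0 / e T"
  have K: "K \<ge> 0" unfolding K_def using K0(1) e0 by (simp add: less_imp_le)
  have sp: "(r, x) \<in> space (time_space T)" if "r \<in> {0..T}" for r x
    using that by (simp add: space_pair_measure space_restrict_space)
  define it where "it n = (picard ^^ n) (\<lambda>_. 0)" for n
  have it: "it n \<in> bmeas (time_space T) \<and> relatively_continuous R d {0..T} (it n) \<and>
    (\<forall>r\<in>{0..T}. \<forall>x. \<bar>it n (r, x) - u (r, x)\<bar> \<le> (1/2) ^ n * K * e r)" for n
  proof (induction n)
    case 0
    have "\<bar>u (r, x)\<bar> \<le> K * e r" if "r \<in> {0..T}" for r x
    proof -
      have "\<bar>u (r, x)\<bar> \<le> K0" by (rule K0(2)[OF sp[OF that]])
      also have "K0 = K * e T" unfolding K_def using e0[of T] by simp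
      also have "\<dots> \<le> K * e r" using K eT[OF that] by (intro mult_left_mono)
      finally show ?thesis .
    qed
    moreover have "relatively_continuous R d {0..T} (\<lambda>_. 0)"
      unfolding relatively_continuous_def by (intro ballI allI impI exI[of _ 1]) simp
    ultimately show ?case by (simp add: it_def bmeas_const)
  next
    case (Suc n)
    then have wn: "it n \<in> bmeas (time_space T)" "relatively_continuous R d {0..T} (it n)"
        "\<And>r x. r \<in> {0..T} \<Longrightarrow> \<bar>it n (r, x) - u (r, x)\<bar> \<le> (1/2) ^ n * K * e r" by auto
    have step: "it (Suc n) = picard (it n)" by (simp add: it_def)
    have "\<bar>it (Suc n) (r, x) - u (r, x)\<bar> \<le> (1/2) ^ Suc n * K * e r" if r: "r \<in> {0..T}" for r x
    proof -
      interpret p: prob_space "P (r, x)" by (rule prob_space_P[OF r])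
      define k where "k v t = (\<integral>w. source v (t, X t w) \<partial>P (r, x))" for v t
      have kb: "k v \<in> bmeas \<nu>" if "v \<in> bmeas (time_space T)" for v
        unfolding k_def[abs_def]
        using bmeas_expectation[OF bmeas_process[OF bmeas_linear[OF that]] r] by simp
      have kd: "\<bar>k u t - k (it n) t\<bar> \<le> L * ((1/2) ^ n * K) * e t" if t: "t \<in> {0..T}" for t
      proof -
        have at: "(\<lambda>w. f (t, X t w)) \<in> bmeas (P (r, x))" if "f \<in> bmeas (time_space T)" for f
          by (rule bmeas_F_P[OF t bmeas_at[OF that t] r])
        have "k u t - k (it n) t = (\<integral>w. source u (t, X t w) - source (it n) (t, X t w) \<partial>P (r, x))"
          unfolding k_def
          by (intro Bochner_Integration.integral_diff[symmetric] p.integrable_bmeas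
              bmeas_add bmeas_mult at a b u wn(1))
        also have "\<bar>\<dots>\<bar> \<le> L * ((1/2) ^ n * K) * e t"
        proof (rule expectation_le[OF r])
          show "(\<lambda>w. source u (t, X t w) - source (it n) (t, X t w)) \<in> borel_measurable (P (r, x))"
            by (intro bmeasD bmeas_diff bmeas_add bmeas_mult at a b u wn(1))
          fix w
          have "\<bar>source u (t, X t w) - source (it n) (t, X t w)\<bar> =
              \<bar>b (t, X t w)\<bar> * \<bar>it n (t, X t w) - u (t, X t w)\<bar>"
            unfolding abs_mult[symmetric] by (subst abs_minus_commute) (simp add: algebra_simps)
          also have "\<dots> \<le> L * ((1/2) ^ n * K * e t)"
            using L wn(3)[OF t] sp[OF t] by (intro mult_mono) auto
          finally show "\<bar>source u (t, X t w) - source (it n) (t, X t w)\<bar> \<le> L * ((1/2) ^ n * K) * e t"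
            by (simp only: mult.assoc)
        qed
        finally show ?thesis .
      qed
      have "it (Suc n) (r, x) - u (r, x) = (LINT t:{r..T}|\<nu>. k u t) - (LINT t:{r..T}|\<nu>. k (it n) t)"
        unfolding step fixpoint[OF r] picard_alt[OF wn(1) r] picard_alt[OF u r] k_def by simp
      also have "\<dots> = (LINT t:{r..T}|\<nu>. k u t - k (it n) t)"
        by (rule nu.interval_integral_diff[symmetric, OF kb[OF u] kb[OF wn(1)]])
      also have "\<bar>\<dots>\<bar> \<le> (LINT t:{r..T}|\<nu>. L * ((1/2) ^ n * K) * e t)"
      proof -
        have kk: "(\<lambda>t. indicator {r..T} t * (k u t - k (it n) t)) \<in> bmeas \<nu>"
          by (intro bmeas_mult bmeas_diff nu.bmeas_indicator_interval kb u wn(1))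
        have "\<bar>LINT t:{r..T}|\<nu>. k u t - k (it n) t\<bar> \<le> (\<integral>t. \<bar>indicator {r..T} t * (k u t - k (it n) t)\<bar> \<partial>\<nu>)"
          unfolding set_lebesgue_integral_def real_scaleR_def by (rule integral_abs_bound)
        also have "\<dots> \<le> (LINT t:{r..T}|\<nu>. L * ((1/2) ^ n * K) * e t)"
          unfolding set_lebesgue_integral_def real_scaleR_def
        proof (rule integral_mono)
          show "integrable \<nu> (\<lambda>t. \<bar>indicator {r..T} t * (k u t - k (it n) t)\<bar>)"
            by (intro integrable_abs nu.integrable_bmeas kk)
          show "integrable \<nu> (\<lambda>t. indicator {r..T} t * (L * ((1/2) ^ n * K) * e t))"
            by (intro nu.integrable_bmeas bmeas_mult bmeas_const
              nu.bmeas_indicator_interval e)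
          show "\<bar>indicator {r..T} t * (k u t - k (it n) t)\<bar> \<le> indicator {r..T} t * (L * ((1/2) ^ n * K) * e t)"
            if "t \<in> space \<nu>" for t
            using kd[OF that[unfolded nu.space_nu]] by (simp add: indicator_def)
        qed
        finally show ?thesis .
      qed
      \<comment> \<open>L is written as half of 2 L, which produces the next power of 1/2.\<close>
      also have "\<dots> = (1/2) ^ Suc n * K * (2 * L * (LINT t:{r..T}|\<nu>. e t))"
        by (simp add: set_integral_mult_right)
      also have "\<dots> \<le> (1/2) ^ Suc n * K * e r"
        unfolding e_eq[OF r] using K e0[of T] by (intro mult_left_mono) auto
      finally show ?thesis .
    qed
    moreover have "relatively_continuous R d {0..T} (it (Suc n))"
      unfolding step
      by (rule picard_relatively_continuous[OF wn(1) tc feller g_cont ab_cont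
            relatively_continuous_imp_continuous_slice[OF wn(2) _ R]])
    moreover have "it (Suc n) \<in> bmeas (time_space T)"
      unfolding step by (rule bmeas_picard[OF wn(1) tc])
    ultimately show ?case by blast
  qed
  show ?thesis
  proof (rule relatively_continuous_uniform_limit)
    fix \<epsilon> :: real assume \<epsilon>: "\<epsilon> > 0"
    have "(\<lambda>n. (1/2) ^ n * K) \<longlonglongrightarrow> 0 * K"
      by (intro tendsto_mult tendsto_const LIMSEQ_power_zero) simp
    then have "(\<lambda>n. (1/2) ^ n * K) \<longlonglongrightarrow> 0" by simp
    from order_tendstoD(2)[OF this \<epsilon>] obtain n where n: "(1/2) ^ n * K < \<epsilon>" using eventually_happens'[OF sequentially_bot] by blast
    have "\<bar>it n (r, x) - u (r, x)\<bar> < \<epsilon>" if r: "r \<in> {0..T}" for r x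
    proof -
      have "\<bar>it n (r, x) - u (r, x)\<bar> \<le> (1/2) ^ n * K * e r" using it[of n] r by blast
      also have "\<dots> \<le> (1/2) ^ n * K" using K e1[of r] by (intro mult_right_le_one_le) (auto simp: less_imp_le[OF e0])
      finally show ?thesis using n by simp
    qed
    with it[of n] show "\<exists>w. relatively_continuous R d {0..T} w \<and> (\<forall>r\<in>{0..T}. \<forall>x. \<bar>w (r, x) - u (r, x)\<bar> < \<epsilon>)"
      by blast
  qed
qed

end

section \<open>Reduction to a finite measure\<close>

text \<open>\<open>\<mu>\<close> need not be \<open>\<sigma>\<close>-finite. With \<open>h\<close> the sum of the two dominating functions, \<open>\<nu> = h \<mu>\<close> is
  finite and the coefficients \<open>a0 / h\<close>, \<open>b0 / h\<close> are bounded. They are no longer Borel for \<open>d\<close>, only for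
  the product topology.\<close>

locale terminal_value_problem = linear_problem T d \<mu> M F X P \<nu> a1 b1 g
  for T :: real and d :: "real \<times> 's::topological_space \<Rightarrow> real \<times> 's \<Rightarrow> real" and \<mu> :: "real measure"
    and M :: "'w measure" and F :: "real \<Rightarrow> 'w measure" and X :: "real \<Rightarrow> 'w \<Rightarrow> 's"
    and P :: "real \<times> 's \<Rightarrow> 'w measure" and \<nu> :: "real measure"
    and a1 b1 :: "real \<times> 's \<Rightarrow> real" and g :: "'s \<Rightarrow> real" +
  fixes h :: "real \<Rightarrow> real" and a0 b0 :: "real \<times> 's \<Rightarrow> real" and D :: "real set"
    and f :: "real \<Rightarrow> 's \<Rightarrow> real \<Rightarrow> real"
  assumes a0: "a0 \<in> borel_measurable (time_space T)" and b0: "b0 \<in> borel_measurable (time_space T)"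
    and h: "h \<in> borel_measurable \<mu>" and h_nonneg: "\<And>s. s \<in> {0..T} \<Longrightarrow> 0 \<le> h s"
    and nu_density: "\<nu> = density \<mu> (\<lambda>s. ennreal (h s))"
    and coefficients: "AE s in \<mu>. \<forall>y. a0 (s, y) = h s * a1 (s, y) \<and> b0 (s, y) = h s * b1 (s, y)"
    and f: "\<And>t x w. t \<in> {0..T} \<Longrightarrow> w \<in> D \<Longrightarrow> f t x w = a0 (t, x) + b0 (t, x) * w"
    and g_consistent: "\<And>x y. d (T, x) (T, y) = 0 \<Longrightarrow> g x = g y"
begin

lemma space_mu: "space \<mu> = {0..T}"
  using sets_eq_imp_space_eq[OF sets_mu] by (simp add: space_restrict_space)

lemma borel_measurable_mu_nu: "borel_measurable \<nu> = borel_measurable \<mu>"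
  unfolding nu_density by (rule measurable_cong_sets[OF sets_density refl])

lemma AE_h_nonneg: "AE s in \<mu>. 0 \<le> h s"
  by (rule AE_I2) (simp add: space_mu h_nonneg)

text \<open>Integration against a density is valid for an arbitrary measure \<mu>. The time
  integrals along a path have integrands of the form h k1 with k1 bounded, up to a null set, and
  thereby become \<nu>-integrals.\<close>

lemma
  fixes k k1 :: "real \<Rightarrow> real"
  assumes k: "k \<in> borel_measurable \<mu>" and k1: "k1 \<in> bmeas \<nu>"
    and eq: "AE s in \<mu>. k s = h s * k1 s"
  shows interval_integral_transfer: "(LINT s:{r..t}|\<mu>. k s) = (LINT s:{r..t}|\<nu>. k1 s)"
    and set_integrable_transfer: "set_integrable \<mu> {r..t} k"
proof -
  have k1m: "k1 \<in> borel_measurable \<mu>"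
    using bmeasD[OF k1] unfolding borel_measurable_mu_nu .
  have ind: "(\<lambda>s. indicator {r..t} s :: real) \<in> borel_measurable \<mu>"
    using bmeasD[OF nu.bmeas_indicator_interval] unfolding borel_measurable_mu_nu .
  have ik1: "(\<lambda>s. indicator {r..t} s *\<^sub>R k1 s) \<in> borel_measurable \<mu>"
    unfolding real_scaleR_def by (intro borel_measurable_times ind k1m)
  have m1: "(\<lambda>s. indicator {r..t} s *\<^sub>R k s) \<in> borel_measurable \<mu>"
    unfolding real_scaleR_def by (intro borel_measurable_times ind k)
  have m2: "(\<lambda>s. h s *\<^sub>R (indicator {r..t} s *\<^sub>R k1 s)) \<in> borel_measurable \<mu>"
    unfolding real_scaleR_def by (intro borel_measurable_times ind k1m h)
  have ae: "AE s in \<mu>. indicator {r..t} s *\<^sub>R k s = h s *\<^sub>R (indicator {r..t} s *\<^sub>R k1 s)"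
    using eq by eventually_elim simp
  show "(LINT s:{r..t}|\<mu>. k s) = (LINT s:{r..t}|\<nu>. k1 s)"
    unfolding set_lebesgue_integral_def nu_density integral_density[OF ik1 h AE_h_nonneg]
    by (rule integral_cong_AE[OF m1 m2 ae])
  have "integrable \<mu> (\<lambda>s. h s *\<^sub>R (indicator {r..t} s *\<^sub>R k1 s))"
    using nu.set_integrable_bmeas[OF k1, of r t]
    unfolding set_integrable_def nu_density integrable_density[OF ik1 h AE_h_nonneg] .
  then show "set_integrable \<mu> {r..t} k"
    unfolding set_integrable_def using integrable_cong_AE[OF m1 m2 ae] by blast
qed

lemma path_borel_measurable:
  assumes c: "c \<in> borel_measurable (time_space T)" and w: "w \<in> space M"
  shows "(\<lambda>s. c (s, X s w) :: real) \<in> borel_measurable \<mu>"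
  unfolding borel_measurable_mu_nu[symmetric]
  using measurable_compose[OF measurable_compose[OF measurable_Pair1'[OF w, of \<nu>] process_all] c] by simp

lemma AE_coefficients_path:
  "AE s in \<mu>. a0 (s, X s w) = h s * a1 (s, X s w) \<and> b0 (s, X s w) = h s * b1 (s, X s w)"
  using coefficients by eventually_elim blast

context
  fixes u :: "real \<times> 's \<Rightarrow> real"
  assumes u: "u \<in> bmeas (time_space T)" and uD: "u ` ({0..T} \<times> UNIV) \<subseteq> D"
begin

lemma source_eq: "t \<in> {0..T} \<Longrightarrow> f t x (u (t, x)) = a0 (t, x) + b0 (t, x) * u (t, x)"
  using uD by (intro f) auto

lemma source_transfer:
  assumes w: "w \<in> space M"
  shows "(\<lambda>s. f s (X s w) (u (s, X s w))) \<in> borel_measurable \<mu>"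
    and "AE s in \<mu>. f s (X s w) (u (s, X s w)) = h s * source u (s, X s w)"
proof -
  have "(\<lambda>s. a0 (s, X s w) + b0 (s, X s w) * u (s, X s w)) \<in> borel_measurable \<mu>"
    by (intro borel_measurable_add borel_measurable_times path_borel_measurable a0 b0 bmeasD[OF u] w)
  moreover have "f s (X s w) (u (s, X s w)) = a0 (s, X s w) + b0 (s, X s w) * u (s, X s w)" if "s \<in> space \<mu>" for s
    using that by (intro source_eq) (simp only: space_mu)
  ultimately show "(\<lambda>s. f s (X s w) (u (s, X s w))) \<in> borel_measurable \<mu>"
    using measurable_cong[of \<mu> "\<lambda>s. f s (X s w) (u (s, X s w))" "\<lambda>s. a0 (s, X s w) + b0 (s, X s w) * u (s, X s w)" borel]
    by blast
  show "AE s in \<mu>. f s (X s w) (u (s, X s w)) = h s * source u (s, X s w)"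
    using AE_coefficients_path[of w] AE_space
  proof eventually_elim
    case (elim s)
    then have "s \<in> {0..T}" by (simp only: space_mu)
    from source_eq[OF this, of "X s w"] elim show ?case by (simp add: algebra_simps)
  qed
qed

lemma source_integral:
  assumes w: "w \<in> space M"
  shows "(LINT s:{r..t}|\<mu>. f s (X s w) (u (s, X s w))) =
      (LINT s:{r..t}|\<nu>. source u (s, X s w))"
    and "set_integrable \<mu> {r..t} (\<lambda>s. f s (X s w) (u (s, X s w)))"
  by (rule interval_integral_transfer[OF source_transfer(1)[OF w] bmeas_path[OF bmeas_linear[OF u] w] source_transfer(2)[OF w]],
      rule set_integrable_transfer[OF source_transfer(1)[OF w] bmeas_path[OF bmeas_linear[OF u] w] source_transfer(2)[OF w]])

lemma source_abs_integral:
  assumes w: "w \<in> space M"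
  shows "(LINT s:{r..t}|\<mu>. \<bar>f s (X s w) (u (s, X s w))\<bar>) =
      (LINT s:{r..t}|\<nu>. \<bar>source u (s, X s w)\<bar>)"
proof (rule interval_integral_transfer)
  show "(\<lambda>s. \<bar>f s (X s w) (u (s, X s w))\<bar>) \<in> borel_measurable \<mu>"
    by (intro borel_measurable_abs source_transfer(1)[OF w])
  show "(\<lambda>s. \<bar>source u (s, X s w)\<bar>) \<in> bmeas \<nu>"
    using bmeas_path[OF bmeas_linear[OF u] w] unfolding bmeas_def by auto
  show "AE s in \<mu>. \<bar>f s (X s w) (u (s, X s w))\<bar> = h s * \<bar>source u (s, X s w)\<bar>"
    using source_transfer(2)[OF w] AE_h_nonneg by eventually_elim (simp add: abs_mult)
qed

lemma expected_source_integral: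
  assumes r: "r \<in> {0..T}"
  shows "(\<integral>w. (LINT s:{l..t}|\<mu>. f s (X s w) (u (s, X s w))) \<partial>P (r, x)) =
    (\<integral>w. (LINT s:{l..t}|\<nu>. source u (s, X s w)) \<partial>P (r, x))"
  by (intro Bochner_Integration.integral_cong refl) (simp only: source_integral(1) space_P[OF r])

end

section \<open>Solutions of (M) in terms of the reduced problem\<close>

lemma bounded_solution_time_space:
  assumes "bounded_global_solution T d \<mu> M X P D f g u"
  shows "u \<in> bmeas (time_space T)" and "u ` ({0..T} \<times> UNIV) \<subseteq> D"
proof -
  have u: "u \<in> borel_measurable (ST T)" "u ` ({0..T} \<times> UNIV) \<subseteq> D" "bounded (u ` ({0..T} \<times> UNIV))"
    using assms unfolding bounded_global_solution_def global_solution_def by blast+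
  obtain K where "\<forall>z\<in>u ` ({0..T} \<times> UNIV). norm z \<le> K"
    using u(3) unfolding bounded_iff by blast
  then have "\<bar>u (r, x)\<bar> \<le> K" if "r \<in> {0..T}" for r x
    using that unfolding real_norm_def by blast
  from bmeas_time_space[OF u(1) this]
  show "u \<in> bmeas (time_space T)" .
  show "u ` ({0..T} \<times> UNIV) \<subseteq> D" by (rule u(2))
qed

lemma bounded_solution_equation:
  assumes sol: "bounded_global_solution T d \<mu> M X P D f g u" and r: "r \<in> {0..T}"
  shows "(\<integral>w. g (X T w) \<partial>P (r, x)) = u (r, x) +
    (\<integral>w. (LINT s:{r..T}|\<nu>. source u (s, X s w)) \<partial>P (r, x))"
proof -
  have sol': "global_solution T d \<mu> M X P D f g u" using sol unfolding bounded_global_solution_def by blast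
  have eqs: "\<forall>r t x. 0 \<le> r \<and> r \<le> t \<and> t \<le> T \<longrightarrow>
      (LINT w|P (r, x). u (t, X t w)) =
        u (r, x) + (LINT w|P (r, x). (LINT s:{r..t}|\<mu>. f s (X s w) (u (s, X s w))))"
    using sol' unfolding global_solution_def by blast
  have uT: "\<forall>x. u (T, x) = g x"
    using sol' unfolding global_solution_def by blast
  have "0 \<le> r \<and> r \<le> T \<and> T \<le> T" using r by simp
  with eqs have "(\<integral>w. u (T, X T w) \<partial>P (r, x)) =
      u (r, x) + (\<integral>w. (LINT s:{r..T}|\<mu>. f s (X s w) (u (s, X s w))) \<partial>P (r, x))"
    by blast
  then show ?thesis
    unfolding expected_source_integral[OF bounded_solution_time_space[OF sol] r] uT[rule_format] .
qed

lemma bounded_solution_eq: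
  assumes sol: "bounded_global_solution T d \<mu> M X P D f g u" and r: "r \<in> {0..T}"
  shows "u (r, x) = value_function (r, x)"
  by (rule solution_eq_value_function[OF bounded_solution_time_space(1)[OF sol] bounded_solution_equation[OF sol] r])

text \<open>Under \<open>P (T, x)\<close> the point (T, X_T) is almost surely at distance 0 from (T,
  x), although X_T may differ from x; consistency of g closes the gap.\<close>

lemma value_function_T: "value_function (T, x) = g x"
proof -
  interpret p: prob_space "P (T, x)" by (rule prob_space_P[OF T_mem])
  have "value_function (T, x) = (\<integral>w. g (X T w) \<partial>P (T, x))"
    unfolding value_function_def fst_conv V_def nu.backward_solution_T by (rule refl)
  also have "\<dots> = (\<integral>w. g x \<partial>P (T, x))"
  proof (rule integral_cong_AE)
    show "(\<lambda>w. g (X T w)) \<in> borel_measurable (P (T, x))"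
      by (rule bmeasD[OF bmeas_future_P[OF T_mem bmeas_terminal[OF T_mem] T_mem]])
    show "AE w in P (T, x). g (X T w) = g x"
      using start[OF T_mem, of x]
    proof eventually_elim
      case (elim w)
      then have "d (T, X T w) (T, x) = 0" using T_mem by blast
      then show ?case by (rule g_consistent)
    qed
  qed simp
  also have "\<dots> = g x" by (simp add: p.prob_space)
  finally show ?thesis .
qed

lemma AE_nu: "(AE s in \<nu>. Q s) \<longleftrightarrow> (AE s in \<mu>. 0 < h s \<longrightarrow> Q s)"
proof -
  have "(\<lambda>s. ennreal (h s)) \<in> borel_measurable \<mu>" using h by measurable
  from AE_density[OF this, of Q] show ?thesis unfolding nu_density by simp
qed

text \<open>Time continuity of d enters through measurability for d, from which consistency follows
  as well. The integral equation is that of the reduced problem, read back from \<nu> to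
  \<mu>.\<close>

lemma value_function_solution:
  assumes tc: "time_continuous T d" and D: "is_interval D" and gD: "range g \<subseteq> D"
    and lower: "bdd_below D \<Longrightarrow> AE s in \<mu>. \<forall>x. a0 (s, x) + b0 (s, x) * Inf D \<le> 0"
    and upper: "bdd_above D \<Longrightarrow> AE s in \<mu>. \<forall>x. a0 (s, x) + b0 (s, x) * Sup D \<ge> 0"
  shows "bounded_global_solution T d \<mu> M X P D f g value_function"
proof -
  let ?u = value_function
  \<comment> \<open>\<nu> ignores the times with h = 0; elsewhere division by h > 0 keeps the
    sign.\<close>
  have lower1: "AE s in \<nu>. \<forall>y. a1 (s, y) + b1 (s, y) * Inf D \<le> 0" if "bdd_below D"
    unfolding AE_nu using lower[OF that] coefficients
  proof eventually_elim
    case (elim s)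
    show ?case
    proof (intro impI allI)
      fix y assume "0 < h s"
      have "h s * (a1 (s, y) + b1 (s, y) * Inf D) \<le> 0"
        using elim(1)[rule_format, of y] elim(2)[rule_format, of y] by (simp add: algebra_simps)
      with \<open>0 < h s\<close> show "a1 (s, y) + b1 (s, y) * Inf D \<le> 0" by (simp add: mult_le_0_iff)
    qed
  qed
  have upper1: "AE s in \<nu>. \<forall>y. 0 \<le> a1 (s, y) + b1 (s, y) * Sup D" if "bdd_above D"
    unfolding AE_nu using upper[OF that] coefficients
  proof eventually_elim
    case (elim s)
    show ?case
    proof (intro impI allI)
      fix y assume "0 < h s"
      have "0 \<le> h s * (a1 (s, y) + b1 (s, y) * Sup D)"
        using elim(1)[rule_format, of y] elim(2)[rule_format, of y] by (simp add: algebra_simps)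
      with \<open>0 < h s\<close> show "0 \<le> a1 (s, y) + b1 (s, y) * Sup D" by (simp add: zero_le_mult_iff)
    qed
  qed
  obtain K where K: "K \<ge> 0" "\<And>r x. r \<in> {0..T} \<Longrightarrow> \<bar>?u (r, x)\<bar> \<le> K"
    using value_function_bound by blast
  note meas = borel_measurable_value_function[OF tc]
  have u: "?u \<in> bmeas (time_space T)"
    by (rule bmeas_time_space[OF meas K(2)])
  have uD: "?u ` ({0..T} \<times> UNIV) \<subseteq> D"
    using value_function_in_interval[OF D gD lower1 upper1] by blast
  have cons: "consistent_on ({0..T} \<times> UNIV) d ?u"
    unfolding consistent_on_def
    by (intro ballI impI borel_measurable_pm_topology_eq[OF pseudometric meas])
  have bdd: "bounded (?u ` ({0..T} \<times> UNIV))"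
    unfolding bounded_iff real_norm_def using K(2) by blast
  have "integrable (P (r, x)) (\<lambda>w. \<bar>?u (t, X t w)\<bar>) \<and>
        (\<forall>w\<in>space M. set_integrable \<mu> {r..t} (\<lambda>s. f s (X s w) (?u (s, X s w)))) \<and>
        integrable (P (r, x)) (\<lambda>w. LINT s:{r..t}|\<mu>. \<bar>f s (X s w) (?u (s, X s w))\<bar>) \<and>
        (LINT w|P (r, x). ?u (t, X t w)) =
          ?u (r, x) + (LINT w|P (r, x). (LINT s:{r..t}|\<mu>. f s (X s w) (?u (s, X s w))))"
    if rt: "0 \<le> r" "r \<le> t" "t \<le> T" for r t x
  proof (intro conjI ballI)
    have r: "r \<in> {0..T}" and t: "t \<in> {0..T}" using rt by auto
    interpret p: prob_space "P (r, x)" by (rule prob_space_P[OF r])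
    show "integrable (P (r, x)) (\<lambda>w. \<bar>?u (t, X t w)\<bar>)"
      by (intro integrable_abs p.integrable_bmeas
        bmeas_F_P[OF t bmeas_at[OF u t] r])
    show "set_integrable \<mu> {r..t} (\<lambda>s. f s (X s w) (?u (s, X s w)))" if "w \<in> space M" for w
      by (rule source_integral(2)[OF u uD that])
    have "(\<lambda>p. \<bar>a1 p + b1 p * ?u p\<bar>) \<in> bmeas (time_space T)"
      using bmeas_linear[OF u] unfolding bmeas_def by auto
    from bmeas_integral_past[OF this t, of r]
    have "integrable (P (r, x)) (\<lambda>w. LINT s:{r..t}|\<nu>. \<bar>source ?u (s, X s w)\<bar>)"
      by (intro p.integrable_bmeas bmeas_F_P[OF t _ r])
    moreover have "integrable (P (r, x)) (\<lambda>w. LINT s:{r..t}|\<mu>. \<bar>f s (X s w) (?u (s, X s w))\<bar>) \<longleftrightarrow>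
        integrable (P (r, x)) (\<lambda>w. LINT s:{r..t}|\<nu>. \<bar>source ?u (s, X s w)\<bar>)"
      by (rule Bochner_Integration.integrable_cong[OF refl]) (simp only: source_abs_integral[OF u uD] space_P[OF r])
    ultimately show "integrable (P (r, x)) (\<lambda>w. LINT s:{r..t}|\<mu>. \<bar>f s (X s w) (?u (s, X s w))\<bar>)" by blast
    show "(LINT w|P (r, x). ?u (t, X t w)) =
        ?u (r, x) + (LINT w|P (r, x). (LINT s:{r..t}|\<mu>. f s (X s w) (?u (s, X s w))))"
      unfolding expected_source_integral[OF u uD r] by (rule value_function_equation[OF u refl rt])
  qed
  with meas uD cons bdd value_function_T show ?thesis
    unfolding bounded_global_solution_def global_solution_def by blast
qed

lemma discount_transfer:
  assumes w: "w \<in> space M"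
  shows "(LINT s:{r..t}|\<mu>. b0 (s, X s w)) = (LINT s:{r..t}|\<nu>. b1 (s, X s w))"
proof (rule interval_integral_transfer[OF path_borel_measurable[OF b0 w] bmeas_path[OF b w]])
  show "AE s in \<mu>. b0 (s, X s w) = h s * b1 (s, X s w)"
    using AE_coefficients_path[of w] by eventually_elim blast
qed

lemma value_function_representation:
  assumes r: "r \<in> {0..T}"
  shows "value_function (r, x) =
    (\<integral>w. exp (- (LINT s:{r..T}|\<mu>. b0 (s, X s w))) * g (X T w) \<partial>P (r, x)) -
    (\<integral>w. (LINT t:{r..T}|\<mu>. exp (- (LINT s:{r..t}|\<mu>. b0 (s, X s w))) * a0 (t, X t w)) \<partial>P (r, x))"
proof -
  have "(LINT t:{r..T}|\<mu>. exp (- (LINT s:{r..t}|\<mu>. b0 (s, X s w))) * a0 (t, X t w)) =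
      (LINT t:{r..T}|\<nu>. exp (- (LINT s:{r..t}|\<nu>. b1 (s, X s w))) * a1 (t, X t w))"
    if w: "w \<in> space M" for w
    unfolding discount_transfer[OF w]
  proof (rule interval_integral_transfer)
    note E = nu.bmeas_exp_integral(2)[OF bmeas_path[OF b w], of r]
    show "(\<lambda>t. exp (- (LINT s:{r..t}|\<nu>. b1 (s, X s w))) * a0 (t, X t w)) \<in> borel_measurable \<mu>"
      using bmeasD[OF E] unfolding borel_measurable_mu_nu
      by (intro borel_measurable_times path_borel_measurable[OF a0 w])
    show "(\<lambda>t. exp (- (LINT s:{r..t}|\<nu>. b1 (s, X s w))) * a1 (t, X t w)) \<in> bmeas \<nu>"
      by (intro bmeas_mult E bmeas_path[OF a w])
    show "AE t in \<mu>. exp (- (LINT s:{r..t}|\<nu>. b1 (s, X s w))) * a0 (t, X t w) =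
        h t * (exp (- (LINT s:{r..t}|\<nu>. b1 (s, X s w))) * a1 (t, X t w))"
      using AE_coefficients_path[of w] by eventually_elim simp
  qed
  then have "(\<integral>w. (LINT t:{r..T}|\<mu>. exp (- (LINT s:{r..t}|\<mu>. b0 (s, X s w))) * a0 (t, X t w)) \<partial>P (r, x)) =
      (\<integral>w. (LINT t:{r..T}|\<nu>. exp (- (LINT s:{r..t}|\<nu>. b1 (s, X s w))) * a1 (t, X t w)) \<partial>P (r, x))"
    by (intro Bochner_Integration.integral_cong refl) (simp only: space_P[OF r])
  moreover have "(\<integral>w. exp (- (LINT s:{r..T}|\<mu>. b0 (s, X s w))) * g (X T w) \<partial>P (r, x)) =
      (\<integral>w. exp (- (LINT s:{r..T}|\<nu>. b1 (s, X s w))) * g (X T w) \<partial>P (r, x))"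
    by (intro Bochner_Integration.integral_cong refl) (simp only: space_P[OF r] discount_transfer)
  ultimately show ?thesis using value_function_formula[OF r, of x] by (simp only:)
qed

lemma bounded_solution_relatively_continuous:
  assumes sol: "bounded_global_solution T d \<mu> M X P D f g u"
    and tc: "time_continuous T d" and R: "\<And>t. R t t"
    and feller: "\<And>t \<phi>. t \<in> {0..T} \<Longrightarrow> continuous_on UNIV \<phi> \<Longrightarrow> bounded (range \<phi>) \<Longrightarrow>
      relatively_continuous R d {0..t} (\<lambda>p. \<integral>w. \<phi> (X t w) \<partial>P p)"
    and g_cont: "continuous_on UNIV g"
    and cont: "AE s in \<mu>. continuous_on UNIV (\<lambda>y. a0 (s, y)) \<and> continuous_on UNIV (\<lambda>y. b0 (s, y))"
  shows "relatively_continuous R d {0..T} u"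
proof (rule solution_relatively_continuous[OF tc R feller g_cont])
  show u: "u \<in> bmeas (time_space T)" by (rule bounded_solution_time_space[OF sol])
  show "AE s in \<nu>. continuous_on UNIV (\<lambda>y. a1 (s, y)) \<and> continuous_on UNIV (\<lambda>y. b1 (s, y))"
    unfolding AE_nu using cont coefficients
  proof eventually_elim
    case (elim s)
    show ?case
    proof
      assume "0 < h s"
      \<comment> \<open>At a fixed time h s is a positive constant, so dividing by it preserves
        continuity in the state.\<close>
      then have eq: "(\<lambda>y. a1 (s, y)) = (\<lambda>y. a0 (s, y) / h s)" "(\<lambda>y. b1 (s, y)) = (\<lambda>y. b0 (s, y) / h s)"
        using elim(2) by (simp_all add: fun_eq_iff)
      show "continuous_on UNIV (\<lambda>y. a1 (s, y)) \<and> continuous_on UNIV (\<lambda>y. b1 (s, y))"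
        unfolding eq using elim(1) \<open>0 < h s\<close> by (intro conjI continuous_on_divide continuous_on_const) auto
    qed
  qed
  show "u (r, x) = picard u (r, x)" if r: "r \<in> {0..T}" for r x
  proof -
    interpret p: prob_space "P (r, x)" by (rule prob_space_P[OF r])
    have "picard u (r, x) = (\<integral>w. g (X T w) \<partial>P (r, x)) -
        (\<integral>w. (LINT s:{r..T}|\<nu>. source u (s, X s w)) \<partial>P (r, x))"
      unfolding picard_alt[OF u r]
      using Fubini_interval[OF bmeas_process[OF bmeas_linear[OF u]] r] by simp
    with bounded_solution_equation[OF sol r, of x] show ?thesis by simp
  qed
qed

end

section \<open>Assembly: the finite measure, the bounded coefficients and the theorem\<close>

lemma (in spacetime_setting) singleton_null_mu: "emeasure \<mu> {s} = 0"
proof (rule ccontr)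
  assume *: "emeasure \<mu> {s} \<noteq> 0"
  then have "{s} \<in> sets \<mu>" using emeasure_notin_sets by blast
  moreover have "emeasure \<mu> B = 0 \<or> emeasure \<mu> ({s} - B) = 0" if "B \<subseteq> {s}" for B
  proof -
    have "B = {} \<or> {s} - B = {}" using that by blast
    then show ?thesis by auto
  qed
  ultimately have "is_atom \<mu> {s}"
    using * unfolding is_atom_def by (simp add: zero_less_iff_neq_zero)
  with atomless_mu show False unfolding atomless_def by blast
qed

theorem corollary2p15:
  fixes T :: real
    and d :: "real \<times> 's::topological_space \<Rightarrow> real \<times> 's \<Rightarrow> real"
    and \<mu> :: "real measure"
    and M :: "'w measure" and F :: "real \<Rightarrow> 'w measure"
    and X :: "real \<Rightarrow> 'w \<Rightarrow> 's" and P :: "real \<times> 's \<Rightarrow> 'w measure"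
    and D :: "real set" and f :: "real \<Rightarrow> 's \<Rightarrow> real \<Rightarrow> real" and g :: "'s \<Rightarrow> real"
    and a b :: "real \<times> 's \<Rightarrow> real"
  assumes process: "progressive_markov T d \<mu> M F X P"
    and D: "is_interval D" "\<exists>v\<in>D. \<exists>w\<in>D. v < w"
    and g: "g \<in> borel_measurable borel" "range g \<subseteq> D" "bounded (range g)"
      "\<And>x y. d (T, x) (T, y) = 0 \<Longrightarrow> g x = g y"
    and a: "a \<in> borel_measurable (spacetime_borel d {0..T})" "dominated T \<mu> a"
    and b: "b \<in> borel_measurable (spacetime_borel d {0..T})" "dominated T \<mu> b"
    and f: "\<And>t x w. t \<in> {0..T} \<Longrightarrow> w \<in> D \<Longrightarrow> f t x w = a (t, x) + b (t, x) * w"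
    and lower: "bdd_below D \<Longrightarrow> AE s in \<mu>. \<forall>x. a (s, x) + b (s, x) * Inf D \<le> 0"
    and upper: "bdd_above D \<Longrightarrow> AE s in \<mu>. \<forall>x. a (s, x) + b (s, x) * Sup D \<ge> 0"
  shows
    "(time_continuous T d \<longrightarrow> (\<exists>u. bounded_global_solution T d \<mu> M X P D f g u)) \<and>
     (\<forall>u v. bounded_global_solution T d \<mu> M X P D f g u \<and>
        bounded_global_solution T d \<mu> M X P D f g v \<longrightarrow>
        (\<forall>r\<in>{0..T}. \<forall>x. u (r, x) = v (r, x))) \<and>
     (\<forall>u. bounded_global_solution T d \<mu> M X P D f g u \<longrightarrow>
        (\<forall>r\<in>{0..T}. \<forall>x. u (r, x) =
           (LINT \<omega>|P (r, x). exp (- (LINT s:{r..T}|\<mu>. b (s, X s \<omega>))) * g (X T \<omega>)) -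
           (LINT \<omega>|P (r, x). (LINT t:{r..T}|\<mu>.
              exp (- (LINT s:{r..t}|\<mu>. b (s, X s \<omega>))) * a (t, X t \<omega>)))) \<and>
        (time_continuous T d \<and>
         (AE s in \<mu>. continuous_on UNIV (\<lambda>x. a (s, x)) \<and> continuous_on UNIV (\<lambda>x. b (s, x))) \<and>
         continuous_on UNIV g \<longrightarrow>
           (feller T d X P \<longrightarrow> continuous_spacetime d {0..T} u) \<and>
           (right_hand_feller T d X P \<longrightarrow> right_continuous_spacetime d {0..T} u)))"
proof -
  interpret progressive_markov T d \<mu> M F X P by (rule process)
  note a_meas = borel_measurable_time_space[OF a(1)] and b_meas = borel_measurable_time_space[OF b(1)]
  have space_mu: "space \<mu> = {0..T}"
    using sets_eq_imp_space_eq[OF sets_mu] by (simp add: space_restrict_space)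
  obtain a' where a': "integrable \<mu> a'" "\<And>s. s \<in> {0..T} \<Longrightarrow> 0 \<le> a' s" "AE s in \<mu>. \<forall>y. \<bar>a (s, y)\<bar> \<le> a' s"
    using a(2) unfolding dominated_def by blast
  obtain b' where b': "integrable \<mu> b'" "\<And>s. s \<in> {0..T} \<Longrightarrow> 0 \<le> b' s" "AE s in \<mu>. \<forall>y. \<bar>b (s, y)\<bar> \<le> b' s"
    using b(2) unfolding dominated_def by blast
  define h where "h s = a' s + b' s" for s
  have h: "integrable \<mu> h" "h \<in> borel_measurable \<mu>"
    unfolding h_def[abs_def] using a'(1) b'(1) by simp_all
  have h_nonneg: "0 \<le> h s" if "s \<in> {0..T}" for s
    unfolding h_def using a'(2)[OF that] b'(2)[OF that] by simp
  define \<nu> where "\<nu> = density \<mu> (\<lambda>s. ennreal (h s))"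
  have dom: "AE s in \<mu>. \<forall>y. \<bar>a (s, y)\<bar> \<le> h s \<and> \<bar>b (s, y)\<bar> \<le> h s"
    using a'(3) b'(3) AE_space
  proof eventually_elim
    case (elim s)
    then have "0 \<le> a' s" "0 \<le> b' s" using a'(2) b'(2) by (simp_all add: space_mu)
    show ?case
    proof
      fix y show "\<bar>a (s, y)\<bar> \<le> h s \<and> \<bar>b (s, y)\<bar> \<le> h s"
        using elim(1)[rule_format, of y] elim(2)[rule_format, of y] \<open>0 \<le> a' s\<close> \<open>0 \<le> b' s\<close>
        unfolding h_def by linarith
    qed
  qed
  \<comment> \<open>One null set serves all states y. Removing it makes the domination pointwise, so
    that the rescaled coefficients can be bounded everywhere.\<close>
  obtain N where N: "N \<in> null_sets \<mu>" "\<And>s. s \<in> space \<mu> - N \<Longrightarrow> \<forall>y. \<bar>a (s, y)\<bar> \<le> h s \<and> \<bar>b (s, y)\<bar> \<le> h s"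
    using AE_E3[OF dom] by blast
  define G where "G = {s \<in> space \<mu>. h s \<noteq> 0} - N"
  have G: "G \<in> sets \<mu>"
  proof -
    have "{s \<in> space \<mu>. h s \<noteq> 0} \<in> sets \<mu>" using h(2) by measurable
    then show ?thesis unfolding G_def using N(1) by blast
  qed
  \<comment> \<open>Division by h takes place on \<open>G\<close>, where h > 0 and the domination
    holds; elsewhere the value is 0. Off N, where h = 0, domination forces the coefficient to
    vanish, so c = h * scaled c persists there.\<close>
  define scaled where "scaled c p = indicator G (fst p) * (c p / h (fst p))" for c :: "real \<times> 's \<Rightarrow> real" and p
  have scaled: "scaled c \<in> bmeas (time_space T)"
    if c: "c \<in> borel_measurable (time_space T)" and cN: "\<And>s y. s \<in> space \<mu> - N \<Longrightarrow> \<bar>c (s, y)\<bar> \<le> h s" for c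
  proof (rule bmeasI[where K=1])
    have fst_mu: "fst \<in> measurable (time_space T) \<mu>"
      using measurable_fst[of "restrict_space borel {0..T}" "borel :: 's measure"]
        measurable_cong_sets[OF refl sets_mu, of "time_space T"] by simp
    show "scaled c \<in> borel_measurable (time_space T)"
      unfolding scaled_def[abs_def]
      by (intro borel_measurable_times borel_measurable_divide c measurable_compose[OF fst_mu h(2)]
          measurable_compose[OF fst_mu borel_measurable_indicator[OF G]])
    show "\<bar>scaled c p\<bar> \<le> 1" for p
    proof (cases "fst p \<in> G")
      case True
      then have s: "fst p \<in> space \<mu> - N" "h (fst p) \<noteq> 0" unfolding G_def by auto
      then have "0 < h (fst p)" using h_nonneg[of "fst p"] unfolding space_mu by auto
      with cN[OF s(1), of "snd p"] True show ?thesis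
        unfolding scaled_def by (simp add: abs_divide)
    qed (simp add: scaled_def)
  qed
  have coeff: "c (s, y) = h s * scaled c (s, y)"
    if s: "s \<in> space \<mu> - N" and c: "\<bar>c (s, y)\<bar> \<le> h s" for c s y
    using that unfolding scaled_def G_def by (cases "h s = 0") auto
  \<comment> \<open>Finite because h is integrable; points stay null because \<nu> has a density
    with respect to \<mu>.\<close>
  have nu: "diffuse_measure \<nu> T"
  proof (rule diffuse_measure.intro)
    show "finite_measure \<nu>"
    proof (rule finite_measureI)
      have "emeasure \<nu> (space \<nu>) = (\<integral>\<^sup>+s. ennreal (h s) \<partial>\<mu>)"
        unfolding \<nu>_def using h(2) by (simp add: emeasure_density cong: nn_integral_cong)
      also have "\<dots> = ennreal (\<integral>s. h s \<partial>\<mu>)"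
        by (rule nn_integral_eq_integral[OF h(1)], rule AE_I2) (simp add: space_mu h_nonneg)
      finally show "emeasure \<nu> (space \<nu>) \<noteq> \<infinity>" by simp
    qed
    show "diffuse_measure_axioms \<nu> T"
    proof
      show "sets \<nu> = sets (restrict_space borel {0..T})" unfolding \<nu>_def by (simp add: sets_mu)
      show "emeasure \<nu> {s} = 0" for s
      proof (cases "{s} \<in> sets \<mu>")
        case True
        then have "{s} \<in> null_sets \<mu>" using singleton_null_mu by (intro null_setsI)
        then have "{s} \<in> null_sets \<nu>"
          unfolding \<nu>_def using absolutely_continuousI_density[of "\<lambda>s. ennreal (h s)" \<mu>] h(2)
          by (auto simp: absolutely_continuous_def)
        then show ?thesis by (rule null_setsD1)
      qed (simp add: \<nu>_def emeasure_notin_sets)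
    qed
  qed
  have gb: "g \<in> bmeas borel"
    using g(1,3) unfolding bmeas_def bounded_iff by auto
  interpret tvp: terminal_value_problem T d \<mu> M F X P \<nu> "scaled a" "scaled b" g h a b D f
  proof (intro terminal_value_problem.intro linear_problem.intro markov_diffuse.intro process nu
      linear_problem_axioms.intro terminal_value_problem_axioms.intro)
    show "scaled a \<in> bmeas (time_space T)" "scaled b \<in> bmeas (time_space T)"
      using N(2) by (blast intro!: scaled a_meas b_meas)+
    show "AE s in \<mu>. \<forall>y. a (s, y) = h s * scaled a (s, y) \<and> b (s, y) = h s * scaled b (s, y)"
    proof (rule AE_I'[OF N(1)], rule subsetI, rule ccontr)
      fix s assume s: "s \<in> {s \<in> space \<mu>. \<not> (\<forall>y. a (s, y) = h s * scaled a (s, y) \<and> b (s, y) = h s * scaled b (s, y))}" "s \<notin> N"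
      then have sN: "s \<in> space \<mu> - N" by blast
      have "\<forall>y. a (s, y) = h s * scaled a (s, y) \<and> b (s, y) = h s * scaled b (s, y)"
        using N(2)[OF sN] by (intro allI conjI coeff[OF sN]) blast+
      with s(1) show False by blast
    qed
  qed (use gb a_meas b_meas h(2) h_nonneg f g(4) in \<open>simp_all add: \<nu>_def\<close>)
  \<comment> \<open>R will be the total relation in the Feller case and <= in the right-hand Feller
    case; both are reflexive.\<close>
  have cont: "relatively_continuous R d {0..T} u"
    if "bounded_global_solution T d \<mu> M X P D f g u" "time_continuous T d" "\<And>t. R t t"
      "\<And>t \<phi>. t \<in> {0..T} \<Longrightarrow> continuous_on UNIV \<phi> \<Longrightarrow> bounded (range \<phi>) \<Longrightarrow>
        relatively_continuous R d {0..t} (\<lambda>p. \<integral>\<omega>. \<phi> (X t \<omega>) \<partial>P p)"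
      "AE s in \<mu>. continuous_on UNIV (\<lambda>x. a (s, x)) \<and> continuous_on UNIV (\<lambda>x. b (s, x))" "continuous_on UNIV g"
    for u R
    using tvp.bounded_solution_relatively_continuous[OF that(1,2,3,4,6,5)] .
  show ?thesis
  proof (intro conjI allI impI ballI)
    assume "time_continuous T d"
    from tvp.value_function_solution[OF this D(1) g(2) lower upper]
    show "\<exists>u. bounded_global_solution T d \<mu> M X P D f g u" by blast
  next
    fix u v r x
    assume uv: "bounded_global_solution T d \<mu> M X P D f g u \<and> bounded_global_solution T d \<mu> M X P D f g v"
      and r: "r \<in> {0..T}"
    show "u (r, x) = v (r, x)"
      using tvp.bounded_solution_eq[OF conjunct1[OF uv] r] tvp.bounded_solution_eq[OF conjunct2[OF uv] r] by simp
  next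
    fix u r x
    assume u: "bounded_global_solution T d \<mu> M X P D f g u" and r: "r \<in> {0..T}"
    show "u (r, x) =
           (LINT \<omega>|P (r, x). exp (- (LINT s:{r..T}|\<mu>. b (s, X s \<omega>))) * g (X T \<omega>)) -
           (LINT \<omega>|P (r, x). (LINT t:{r..T}|\<mu>.
              exp (- (LINT s:{r..t}|\<mu>. b (s, X s \<omega>))) * a (t, X t \<omega>)))"
      unfolding tvp.bounded_solution_eq[OF u r] by (rule tvp.value_function_representation[OF r])
  next
    fix u
    assume u: "bounded_global_solution T d \<mu> M X P D f g u"
      and *: "time_continuous T d \<and>
         (AE s in \<mu>. continuous_on UNIV (\<lambda>x. a (s, x)) \<and> continuous_on UNIV (\<lambda>x. b (s, x))) \<and>
         continuous_on UNIV g"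
      and feller: "feller T d X P"
    have "relatively_continuous (\<lambda>_ _. True) d {0..t} (\<lambda>p. \<integral>\<omega>. \<phi> (X t \<omega>) \<partial>P p)"
      if t: "t \<in> {0..T}" and \<phi>: "continuous_on UNIV \<phi>" "bounded (range \<phi>)" for t and \<phi> :: "'s \<Rightarrow> real"
    proof -
      have tT: "t \<le> T" using t by simp
      have "continuous_spacetime d {0..t} (\<lambda>p. LINT \<omega>|P p. \<phi> (X t \<omega>))"
        using feller t \<phi> unfolding feller_def by blast
      then show ?thesis unfolding continuous_spacetime_iff[OF pseudometric_sub[OF tT]] .
    qed
    from cont[OF u _ TrueI this] *
    show "continuous_spacetime d {0..T} u"
      unfolding continuous_spacetime_iff[OF pseudometric] by blast
  next
    fix u
    assume u: "bounded_global_solution T d \<mu> M X P D f g u"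
      and *: "time_continuous T d \<and>
         (AE s in \<mu>. continuous_on UNIV (\<lambda>x. a (s, x)) \<and> continuous_on UNIV (\<lambda>x. b (s, x))) \<and>
         continuous_on UNIV g"
      and feller: "right_hand_feller T d X P"
    have "relatively_continuous (\<lambda>r s. r \<le> s) d {0..t} (\<lambda>p. \<integral>\<omega>. \<phi> (X t \<omega>) \<partial>P p)"
      if t: "t \<in> {0..T}" and \<phi>: "continuous_on UNIV \<phi>" "bounded (range \<phi>)" for t and \<phi> :: "'s \<Rightarrow> real"
      using feller t \<phi> unfolding right_hand_feller_def right_continuous_spacetime_iff by blast
    from cont[OF u _ order_refl this] *
    show "right_continuous_spacetime d {0..T} u"
      unfolding right_continuous_spacetime_iff by blast
  qed
qed

end
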